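(* Let $\Delta$ be a Harnack part of $[B(\mathcal H)^n]_1^-$ and define ${\bf d}:\Delta\times\Delta\to[0,\infty)$ by $${\bf d}(A,B):=\frac{\omega(A,B)^2-1}{\omega(A,B)^2+1},\qquad A,B\in\Delta.$$ Then: (i) ${\bf d}$ is a bounded metric on $\Delta$; (ii) for any free holomorphic automorphism $\Phi$ of the noncommutative unit ball $[B(\mathcal H)^n]_1$, $${\bf d}(X,Y)={\bf d}(\Phi(X),\Phi(Y)),\qquad X,Y\in\Delta.$$
   Context: $\mathcal H$ is a separable infinite dimensional Hilbert space. For $X=(X_1,\dots,X_n)\in B(\mathcal H)^n$ (identified with the row operator $[X_1\,\cdots\,X_n]$), $\|X\|=\|\sum_iX_iX_i^*\|^{1/2}$, $[B(\mathcal H)^n]_1=\{X:\|X\|<1\}$, $[B(\mathcal H)^n]_1^-=\{X:\|X\|\le1\}$. For $A,B\in[B(\mathcal H)^n]_1^-$ and $c\ge1$, write $A\overset{H}{\underset{c}\sim}B$ if $$\frac1{c^2}\Re p(B_1,\dots,B_n)\le\Re p(A_1,\dots,A_n)\le c^2\,\Re p(B_1,\dots,B_n)$$ for every noncommutative polynomial $p\in\mathbb C[X_1,\dots,X_n]\otimes M_{m\times m}$ with matrix coefficients, $m\in\mathbb N$, such that $\Re p\ge0$ (i.e. $\Re p(X)=\frac12(p(X)+p(X)^* )\ge0$ for all $X\in[B(\mathcal H)^n]_1$). $A$ and $B$ are Harnack equivalent, $A\overset H\sim B$, if $A\overset{H}{\underset{c}\sim}B$ for some $c\ge1$; the equivalence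 classes are the Harnack parts of $[B(\mathcal H)^n]_1^-$. For $A,B$ in the same Harnack part, $\omega(A,B):=\inf\{c\ge1:\ A\overset{H}{\underset{c}\sim}B\}$. The formula for ${\bf d}$ is used on every Harnack part (in (ii), on the right-hand side, on the Harnack part containing $\Phi(X)$ and $\Phi(Y)$). A free holomorphic automorphism of $[B(\mathcal H)^n]_1$ is a bijection of $[B(\mathcal H)^n]_1$ which, together with its inverse, is free holomorphic, i.e. each component is given by a power series $\sum_k\sum_{|\alpha|=k}a_\alpha X_\alpha$ in the noncommuting variables $X_1,\dots,X_n$, with scalar coefficients, convergent in norm in $k$ on $[B(\mathcal H)^n]_1$ (here $X_\alpha=X_{i_1}\cdots X_{i_k}$ for a word $\alpha=g_{i_1}\cdots g_{i_k}$). Every such automorphism is of the form $\Phi=\Phi_U\circ\Phi_\lambda$, with $\Phi_U(X)=[X_1,\dots,X_n]U$ for a unitary $U$ on $\mathbb C^n$ and, for some $\lambda\in\mathbb C^n$ with $\|\lambda\|_2<1$, $\Phi_\lambda(X)=\lambda-(1-\|\lambda\|_2^2)^{1/2}(I-\sum_i\bar\lambda_iX_i)^{-1}[X_1,\dots,X_n](I-\lambda^*\lambda)^{1/2}$ ($\lambda$ viewed as the row $[\lambda_1I,\dots,\lambda_nI]$); these formulas extend $\Phi$ to a homeomorphism of $[B(\mathcal H)^n]_1^-$, and $\Phi(X)$ for $X\in[B(\mathcal H)^n]_1^-$ refers to this extension. *)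

theory Defs
  imports "HOL-Analysis.Analysis" "HOL-Library.Poly_Mapping"
begin

section \<open>Complex Hilbert spaces and bounded operators\<close>

text \<open>The inner product is conjugate-linear in the first argument; completeness comes from
  \<^class>\<open>banach\<close>.\<close>

class chilbert_space = banach +
  fixes scaleC :: "complex \<Rightarrow> 'a \<Rightarrow> 'a"  (infixr \<open>*\<^sub>C\<close> 75)
    and cinner :: "'a \<Rightarrow> 'a \<Rightarrow> complex"
  assumes scaleC_add_right: "a *\<^sub>C (x + y) = a *\<^sub>C x + a *\<^sub>C y"
    and scaleC_add_left: "(a + b) *\<^sub>C x = a *\<^sub>C x + b *\<^sub>C x"
    and scaleC_scaleC: "a *\<^sub>C b *\<^sub>C x = (a * b) *\<^sub>C x"
    and scaleC_one: "1 *\<^sub>C x = x"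
    and scaleR_scaleC: "r *\<^sub>R x = complex_of_real r *\<^sub>C x"
    and cinner_commute: "cinner x y = cnj (cinner y x)"
    and cinner_add_right: "cinner x (y + z) = cinner x y + cinner x z"
    and cinner_scaleC_right: "cinner x (a *\<^sub>C y) = a * cinner x y"
    and cinner_self: "cinner x x = complex_of_real ((norm x)\<^sup>2)"

lemma norm_scaleC: "norm (a *\<^sub>C x) = cmod a * norm (x :: 'a::chilbert_space)"
proof -
  have "cinner (a *\<^sub>C x) (a *\<^sub>C x) = a * (cnj a * cinner x x)"
    by (metis cinner_commute cinner_scaleC_right complex_cnj_mult)
  then have "complex_of_real ((norm (a *\<^sub>C x))\<^sup>2) = complex_of_real ((cmod a * norm x)\<^sup>2)"
    by (simp add: cinner_self complex_norm_square power_mult_distrib mult.assoc del: of_real_power)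
  then have "(norm (a *\<^sub>C x))\<^sup>2 = (cmod a * norm x)\<^sup>2"
    using of_real_eq_iff by blast
  then show ?thesis
    by (simp add: power2_eq_iff_nonneg)
qed

lemma bounded_linear_scaleC: "bounded_linear (\<lambda>x :: 'a::chilbert_space. a *\<^sub>C x)"
proof (rule bounded_linear_intro)
  show "a *\<^sub>C r *\<^sub>R x = r *\<^sub>R a *\<^sub>C x" for r and x :: 'a
    by (simp add: scaleR_scaleC scaleC_scaleC mult.commute)
  show "norm (a *\<^sub>C x) \<le> norm x * cmod a" for x :: 'a
    by (simp add: norm_scaleC)
qed (rule scaleC_add_right)

text \<open>\<^typ>\<open>'h \<Rightarrow>\<^sub>L 'h\<close> consists of the real-linear bounded operators; B(H) is the subspace
  of the complex-linear ones.\<close>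

definition complex_linear_op :: "('h::chilbert_space \<Rightarrow>\<^sub>L 'h) \<Rightarrow> bool" where
  "complex_linear_op T \<longleftrightarrow> (\<forall>c x. blinfun_apply T (c *\<^sub>C x) = c *\<^sub>C blinfun_apply T x)"

lift_definition scaleC_op :: "complex \<Rightarrow> ('h::chilbert_space \<Rightarrow>\<^sub>L 'h) \<Rightarrow> ('h \<Rightarrow>\<^sub>L 'h)" 
  is "\<lambda>c T x. c *\<^sub>C T x"
  by (rule bounded_linear_compose[OF bounded_linear_scaleC])

definition adj_op :: "('h::chilbert_space \<Rightarrow>\<^sub>L 'h) \<Rightarrow> ('h \<Rightarrow>\<^sub>L 'h)" where
  "adj_op T = (THE S. \<forall>x y. cinner (blinfun_apply S x) y = cinner x (blinfun_apply T y))"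

definition inv_op :: "('h::chilbert_space \<Rightarrow>\<^sub>L 'h) \<Rightarrow> ('h \<Rightarrow>\<^sub>L 'h)" where
  "inv_op T = (THE S. S o\<^sub>L T = id_blinfun \<and> T o\<^sub>L S = id_blinfun)"

section \<open>The noncommutative unit ball\<close>

type_synonym ('n, 'h) op_tuple = "'n \<Rightarrow> ('h \<Rightarrow>\<^sub>L 'h)"

definition row_norm :: "('n::finite, 'h::chilbert_space) op_tuple \<Rightarrow> real" where
  "row_norm X = sqrt (norm (\<Sum>i\<in>UNIV. X i o\<^sub>L adj_op (X i)))"

definition nc_ball :: "('n::finite, 'h::chilbert_space) op_tuple set" where
  "nc_ball = {X. (\<forall>i. complex_linear_op (X i)) \<and> row_norm X < 1}"

definition nc_cball :: "('n::finite, 'h::chilbert_space) op_tuple set" where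
  "nc_cball = {X. (\<forall>i. complex_linear_op (X i)) \<and> row_norm X \<le> 1}"

text \<open>Words in the free monoid on the generators are lists over the index type.\<close>

primrec word_op :: "('n, 'h::chilbert_space) op_tuple \<Rightarrow> 'n list \<Rightarrow> ('h \<Rightarrow>\<^sub>L 'h)" where
  "word_op X [] = id_blinfun"
| "word_op X (i # \<alpha>) = X i o\<^sub>L word_op X \<alpha>"

section \<open>Noncommutative polynomials with matrix coefficients\<close>

text \<open>An m by m matrix over the noncommutative polynomials is given by its entries
  \<open>p i j\<close> with \<open>i, j < m\<close>; each entry is a finitely supported function on words. Its value at X
  is the operator matrix with entries \<open>nc_eval p X i j\<close>, acting on the m-fold direct sum of the
  Hilbert space.\<close>

type_synonym 'n nc_matrix_poly = "nat \<Rightarrow> nat \<Rightarrow> ('n list \<Rightarrow>\<^sub>0 complex)"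
type_synonym 'h op_matrix = "nat \<Rightarrow> nat \<Rightarrow> ('h \<Rightarrow>\<^sub>L 'h)"

definition nc_eval ::
  "'n nc_matrix_poly \<Rightarrow> ('n, 'h::chilbert_space) op_tuple \<Rightarrow> 'h op_matrix" where
  "nc_eval p X = (\<lambda>i j. \<Sum>\<alpha>\<in>Poly_Mapping.keys (p i j).
     scaleC_op (Poly_Mapping.lookup (p i j) \<alpha>) (word_op X \<alpha>))"

definition op_matrix_Re :: "'h::chilbert_space op_matrix \<Rightarrow> 'h op_matrix" where
  "op_matrix_Re T = (\<lambda>i j. (1/2) *\<^sub>R (T i j + adj_op (T j i)))"

definition op_matrix_le :: "nat \<Rightarrow> 'h::chilbert_space op_matrix \<Rightarrow> 'h op_matrix \<Rightarrow> bool" where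
  "op_matrix_le m S T \<longleftrightarrow>
     (\<forall>\<xi>. (\<Sum>i<m. \<Sum>j<m. cinner (\<xi> i) (blinfun_apply (T i j - S i j) (\<xi> j))) \<in> \<real>\<^sub>\<ge>\<^sub>0)"

definition nc_Re_nonneg ::
  "'h::chilbert_space itself \<Rightarrow> nat \<Rightarrow> 'n::finite nc_matrix_poly \<Rightarrow> bool" where
  "nc_Re_nonneg _ m p \<longleftrightarrow>
     (\<forall>X \<in> (nc_ball :: ('n, 'h) op_tuple set). 
        op_matrix_le m (\<lambda>i j. 0) (op_matrix_Re (nc_eval p X)))"

section \<open>Harnack equivalence\<close>

definition harnack_le ::
  "real \<Rightarrow> ('n::finite, 'h::chilbert_space) op_tuple \<Rightarrow> ('n, 'h) op_tuple \<Rightarrow> bool" where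
  "harnack_le c A B \<longleftrightarrow>
     (\<forall>m (p :: 'n nc_matrix_poly). nc_Re_nonneg TYPE('h) m p \<longrightarrow>
        op_matrix_le m (\<lambda>i j. (1 / c\<^sup>2) *\<^sub>R op_matrix_Re (nc_eval p B) i j)
                       (op_matrix_Re (nc_eval p A)) \<and>
        op_matrix_le m (op_matrix_Re (nc_eval p A))
                       (\<lambda>i j. c\<^sup>2 *\<^sub>R op_matrix_Re (nc_eval p B) i j))"

definition harnack_equiv ::
  "('n::finite, 'h::chilbert_space) op_tuple \<Rightarrow> ('n, 'h) op_tuple \<Rightarrow> bool" where
  "harnack_equiv A B \<longleftrightarrow> A \<in> nc_cball \<and> B \<in> nc_cball \<and> (\<exists>c\<ge>1. harnack_le c A B)"

definition harnack_parts :: "('n::finite, 'h::chilbert_space) op_tuple set set" where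
  "harnack_parts = nc_cball // {(A, B). harnack_equiv A B}"

definition harnack_omega ::
  "('n::finite, 'h::chilbert_space) op_tuple \<Rightarrow> ('n, 'h) op_tuple \<Rightarrow> real" where
  "harnack_omega A B = Inf {c. 1 \<le> c \<and> harnack_le c A B}"

text \<open>The distance is only meaningful within a Harnack part. Between different parts it is set
  to 0 because \<^locale>\<open>Metric_space\<close> demands a nonnegative function on the whole type.\<close>

definition harnack_dist ::
  "('n::finite, 'h::chilbert_space) op_tuple \<Rightarrow> ('n, 'h) op_tuple \<Rightarrow> real" where
  "harnack_dist A B =
     (if harnack_equiv A B
      then ((harnack_omega A B)\<^sup>2 - 1) / ((harnack_omega A B)\<^sup>2 + 1) else 0)"

section \<open>Free holomorphic automorphisms\<close>

definition free_holomorphic ::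
  "(('n::finite, 'h::chilbert_space) op_tuple \<Rightarrow> ('n, 'h) op_tuple) \<Rightarrow> bool" where
  "free_holomorphic F \<longleftrightarrow>
     (\<exists>a :: 'n \<Rightarrow> 'n list \<Rightarrow> complex. \<forall>X\<in>nc_ball. \<forall>j.
        (\<lambda>k. \<Sum>\<alpha> | length \<alpha> = k. scaleC_op (a j \<alpha>) (word_op X \<alpha>)) sums F X j)"

definition free_holomorphic_automorphism ::
  "(('n::finite, 'h::chilbert_space) op_tuple \<Rightarrow> ('n, 'h) op_tuple) \<Rightarrow> bool" where
  "free_holomorphic_automorphism \<Phi> \<longleftrightarrow>
     bij_betw \<Phi> nc_ball nc_ball \<and> free_holomorphic \<Phi> \<and>
     free_holomorphic (inv_into nc_ball \<Phi>)"

definition conj_transpose :: "complex^'n^'n \<Rightarrow> complex^'n^'n" where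
  "conj_transpose U = (\<chi> i j. cnj (U $ j $ i))"

definition unitary_matrix :: "complex^'n^'n \<Rightarrow> bool" where
  "unitary_matrix U \<longleftrightarrow> U ** conj_transpose U = mat 1 \<and> conj_transpose U ** U = mat 1"

definition pos_semidef :: "complex^'n^'n \<Rightarrow> bool" where
  "pos_semidef D \<longleftrightarrow> 
     (\<forall>v :: complex^'n. (\<Sum>i\<in>UNIV. \<Sum>j\<in>UNIV. cnj (v $ i) * D $ i $ j * v $ j) \<in> \<real>\<^sub>\<ge>\<^sub>0)"

definition matrix_sqrt :: "complex^'n^'n \<Rightarrow> complex^'n^'n" where
  "matrix_sqrt M = (THE D. pos_semidef D \<and> D ** D = M)"

text \<open>The row \<open>[X\<^sub>1, \<dots>, X\<^sub>n]\<close> times a scalar matrix.\<close>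

definition row_mult ::
  "('n::finite, 'h::chilbert_space) op_tuple \<Rightarrow> complex^'n^'n \<Rightarrow> ('n, 'h) op_tuple" where
  "row_mult X M = (\<lambda>j. \<Sum>i\<in>UNIV. scaleC_op (M $ i $ j) (X i))"

text \<open>The vector \<open>l\<close> is regarded as a row, so \<open>l* l\<close> is the matrix with (i,j) entry
  \<open>cnj (l $ i) * l $ j\<close>.\<close>

definition ball_involution ::
  "complex^'n \<Rightarrow> ('n::finite, 'h::chilbert_space) op_tuple \<Rightarrow> ('n, 'h) op_tuple" where
  "ball_involution l X = (\<lambda>j.
     scaleC_op (l $ j) id_blinfun -
     sqrt (1 - (norm l)\<^sup>2) *\<^sub>R
       (inv_op (id_blinfun - (\<Sum>i\<in>UNIV. scaleC_op (cnj (l $ i)) (X i))) o\<^sub>L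
        row_mult X (matrix_sqrt (mat 1 - (\<chi> i j. cnj (l $ i) * l $ j))) j))"

text \<open>Every free holomorphic automorphism is given on the open ball by the formula below for
  some \<open>U\<close> and \<open>l\<close>, and the same formula defines its extension to the closed ball.\<close>

definition closed_ball_extension ::
  "(('n::finite, 'h::chilbert_space) op_tuple \<Rightarrow> ('n, 'h) op_tuple) \<Rightarrow>
   ('n, 'h) op_tuple \<Rightarrow> ('n, 'h) op_tuple" where
  "closed_ball_extension \<Phi> = (SOME \<Psi>. \<exists>U l. unitary_matrix U \<and> norm l < 1 \<and>
     (\<forall>X\<in>nc_ball. \<Phi> X = row_mult (ball_involution l X) U) \<and>
     \<Psi> = (\<lambda>X. row_mult (ball_involution l X) U))"

end

theory Submission
  imports Defs
begin

text \<open>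
  \<^emph>\<open>The metric.\<close> The Harnack relations compose: constants \<open>c\<close> for \<open>A, B\<close> and \<open>d\<close> for \<open>B, C\<close> give the
  constant \<open>c d\<close> for \<open>A, C\<close>. Hence \<open>ln \<omega>\<close> satisfies the triangle inequality, and the distance is
  \<open>tanh (ln \<omega>)\<close> with \<open>tanh\<close> increasing and subadditive (\<open>tanh_log_triangle\<close>). The infimum \<open>\<omega>\<close> is
  attained, so \<open>\<omega> = 1\<close> means that \<open>Re p\<close> takes the same value at \<open>A\<close> and \<open>B\<close> for all admissible \<open>p\<close>;
  the polynomials \<open>1 + u X\<^sub>i\<close> already separate points (\<open>harnack_le_1_imp_eq\<close>).

  \<^emph>\<open>The explicit automorphisms.\<close> Let \<open>\<Theta> X = row_mult (ball_involution l X) U\<close>. Direct computation shows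
  that \<open>\<Theta>\<close> preserves both balls and has an inverse of the same shape. The inverse of \<open>I - X l\<^sup>*\<close> is a
  Neumann series that converges uniformly on the closed ball, so \<open>p \<circ> \<Theta>\<close> is a uniform limit of
  polynomials there. After a small multiple of \<open>I\<close> is added, these polynomials have nonnegative real
  part, and the Harnack inequalities carry over with the same constant (\<open>harnack_le_transfer\<close>).
  Applied to \<open>\<Theta>\<close> and its inverse, this shows that \<open>\<omega>\<close> is invariant.

  \<^emph>\<open>All automorphisms are explicit.\<close> The value \<open>\<nu> = \<Phi> 0\<close> is scalar, and the involution for \<open>\<nu>\<close>
  composed with \<open>\<Phi>\<close> is a bijection \<open>G\<close> of the ball that fixes 0. On nilpotent tuples \<open>G\<close> is a
  polynomial. Its linear part is contractive, and so is that of the inverse, whence it is unitary.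
  Evaluation at truncated creation operators on a Fock space inside the Hilbert space (which exists
  in infinite dimension) bounds the sum of the squared moduli of the coefficients of each
  component by 1; the linear coefficients exhaust this bound, so all other coefficients vanish
  (\<open>origin_fixing_bijection_linear\<close>). Therefore \<open>\<Phi>\<close> agrees with some \<open>\<Theta>\<close> on nilpotent tuples. Both
  are free holomorphic, and nilpotent tuples determine the coefficients of a free holomorphic
  function, so they agree on the whole ball, and the extension of \<open>\<Phi>\<close> to the closed ball is some
  such \<open>\<Theta>\<close>.
\<close>

section \<open>Complex Hilbert spaces\<close>

interpretation cvs: vector_space "scaleC :: complex \<Rightarrow> 'h::chilbert_space \<Rightarrow> 'h"
  by unfold_locales (auto simp: scaleC_add_right scaleC_add_left scaleC_scaleC scaleC_one)

lemma cinner_add_left: "cinner (x + y) z = cinner x z + cinner y (z::'h::chilbert_space)"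
  by (metis cinner_add_right cinner_commute complex_cnj_add)

lemma cinner_scaleC_left: "cinner (a *\<^sub>C x) y = cnj a * cinner x (y::'h::chilbert_space)"
  by (metis cinner_commute cinner_scaleC_right complex_cnj_mult)

lemma cinner_zero_right [simp]: "cinner x (0::'h::chilbert_space) = 0"
  using cinner_add_right[of x 0 0] by simp

lemma cinner_zero_left [simp]: "cinner (0::'h::chilbert_space) x = 0"
  using cinner_add_left[of 0 0 x] by simp

lemma cinner_minus_right: "cinner x (- y) = - cinner x (y::'h::chilbert_space)"
  using cinner_add_right[of x y "- y"] by (simp add: add_eq_0_iff)

lemma cinner_minus_left: "cinner (- x) y = - cinner x (y::'h::chilbert_space)"
  using cinner_add_left[of x "- x" y] by (simp add: add_eq_0_iff)

lemma cinner_diff_right: "cinner x (y - z) = cinner x y - cinner x (z::'h::chilbert_space)"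
  using cinner_add_right[of x y "- z"] by (simp add: cinner_minus_right)

lemma cinner_diff_left: "cinner (x - y) z = cinner x z - cinner y (z::'h::chilbert_space)"
  using cinner_add_left[of x "- y" z] by (simp add: cinner_minus_left)

lemma cinner_sum_right: "cinner x (sum f S) = (\<Sum>i\<in>S. cinner x (f i :: 'h::chilbert_space))"
  by (induction S rule: infinite_finite_induct) (auto simp: cinner_add_right)

lemma cinner_sum_left: "cinner (sum f S) x = (\<Sum>i\<in>S. cinner (f i) (x :: 'h::chilbert_space))"
  by (induction S rule: infinite_finite_induct) (auto simp: cinner_add_left)

lemma cinner_scaleR_right: "cinner x (r *\<^sub>R y) = of_real r * cinner x (y::'h::chilbert_space)"
  by (simp add: scaleR_scaleC cinner_scaleC_right)

lemma cinner_scaleR_left: "cinner (r *\<^sub>R x) y = of_real r * cinner x (y::'h::chilbert_space)"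
  by (simp add: scaleR_scaleC cinner_scaleC_left)

lemma Re_cinner_self: "Re (cinner x x) = (norm (x::'h::chilbert_space))\<^sup>2"
  by (simp add: cinner_self)

lemma norm_add_squared:
  "(norm (x + y))\<^sup>2 = (norm x)\<^sup>2 + 2 * Re (cinner x y) + (norm (y::'h::chilbert_space))\<^sup>2"
proof -
  have "Re (cinner y x) = Re (cinner x y)"
    by (metis cinner_commute complex_cnj(1) complex.exhaust_sel complex.sel(1))
  then show ?thesis
    by (simp flip: Re_cinner_self add: cinner_add_left cinner_add_right)
qed

lemma norm_diff_squared:
  "(norm (x - y))\<^sup>2 = (norm x)\<^sup>2 - 2 * Re (cinner x y) + (norm (y::'h::chilbert_space))\<^sup>2"
  using norm_add_squared[of x "- y"] by (simp add: cinner_minus_right)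

text \<open>The vector \<open>x - c y\<close> is the component of \<open>x\<close> orthogonal to \<open>y\<close>; its squared norm is the
  difference of the two sides, up to scaling.\<close>

lemma cinner_Cauchy_Schwarz: "cmod (cinner x y) \<le> norm x * norm (y::'h::chilbert_space)"
proof (cases "y = 0")
  case False
  define c where "c = cinner y x / of_real ((norm y)\<^sup>2)"
  have "cinner x (c *\<^sub>C y) = of_real ((cmod (cinner x y))\<^sup>2 / (norm y)\<^sup>2)"
    unfolding c_def cinner_scaleC_right
    using complex_norm_square[of "cinner x y"]
    by (simp add: cinner_commute[of y x] mult.commute)
  moreover have "norm (c *\<^sub>C y) = cmod (cinner x y) / norm y"
    unfolding c_def norm_scaleC using False
    by (simp add: norm_divide cinner_commute[of y x] power2_eq_square norm_mult)
  ultimately have "(norm (x - c *\<^sub>C y))\<^sup>2 = (norm x)\<^sup>2 - (cmod (cinner x y) / norm y)\<^sup>2"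
    by (simp add: norm_diff_squared power_divide)
  then have "(cmod (cinner x y) / norm y)\<^sup>2 \<le> (norm x)\<^sup>2"
    by (metis diff_ge_0_iff_ge zero_le_power2)
  then have "cmod (cinner x y) / norm y \<le> norm x"
    by (rule power2_le_imp_le) simp
  then show ?thesis
    using False by (simp add: field_simps)
qed simp

lemma bounded_linear_cinner_right: "bounded_linear (\<lambda>y. cinner x (y::'h::chilbert_space))"
proof (rule bounded_linear_intro)
  show "norm (cinner x y) \<le> norm y * norm x" for y
    using cinner_Cauchy_Schwarz[of x y] by (simp add: mult.commute)
qed (auto simp: cinner_add_right cinner_scaleR_right scaleR_conv_of_real)

lemma cinner_eqI:
  assumes "\<And>y. cinner x y = cinner x' (y::'h::chilbert_space)" shows "x = x'"
proof -
  have "cinner (x - x') (x - x') = 0"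
    using assms by (simp add: cinner_diff_left)
  then show ?thesis by (simp add: cinner_self)
qed

text \<open>The vector is found as the minimiser of \<open>J y = norm y ^ 2 / 2 - Re (f y)\<close>. The parallelogram law
  makes every minimising sequence a Cauchy sequence, and the vanishing of the first variation at
  the minimiser is the claim.\<close>

lemma riesz_representation:
  fixes f :: "'h::chilbert_space \<Rightarrow> complex"
  assumes f: "bounded_linear f" and fC: "\<And>c y. f (c *\<^sub>C y) = c * f y"
  shows "\<exists>z. \<forall>y. f y = cinner z y"
proof -
  interpret f: bounded_linear f by (rule f)
  obtain K where K: "\<And>y. norm (f y) \<le> norm y * K"
    using f.bounded by blast
  define J where "J y = (norm y)\<^sup>2 / 2 - Re (f y)" for y
  have J_lower: "- (K\<^sup>2 / 2) \<le> J y" for y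
  proof -
    have "Re (f y) \<le> norm y * K"
      using K[of y] complex_Re_le_cmod[of "f y"] by linarith
    moreover have "0 \<le> (norm y - K)\<^sup>2" by simp
    ultimately show ?thesis
      by (simp add: J_def power2_diff)
  qed
  define d where "d = Inf (range J)"
  have bdd: "bdd_below (range J)" using J_lower by (auto intro!: bdd_belowI2)
  have d_le: "d \<le> J y" for y
    unfolding d_def by (rule cInf_lower[OF _ bdd]) simp
  have "\<exists>y. J y < d + 1 / real (Suc k)" for k
  proof (rule ccontr)
    assume "\<not> ?thesis"
    then have "d + 1 / real (Suc k) \<le> Inf (range J)"
      by (intro cInf_greatest) (auto simp: not_less)
    then have "1 / real (Suc k) \<le> 0" unfolding d_def by linarith
    then show False by simp
  qed
  then obtain u where u: "\<And>k. J (u k) < d + 1 / real (Suc k)" by metis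
  \<comment> \<open>The midpoint of two vectors cannot have a value of \<open>J\<close> below the infimum \<open>d\<close>.\<close>
  have gap: "(norm (v - w))\<^sup>2 \<le> 4 * ((J v - d) + (J w - d))" for v w
  proof -
    have "Re (f ((1/2) *\<^sub>R (v + w))) = (Re (f v) + Re (f w)) / 2"
      by (simp add: f.scaleR f.add)
    moreover have "(norm ((1/2) *\<^sub>R (v + w)))\<^sup>2 = (norm (v + w))\<^sup>2 / 4"
      by (simp add: power_divide)
    ultimately have "J ((1/2) *\<^sub>R (v + w)) = (norm (v + w))\<^sup>2 / 8 - (Re (f v) + Re (f w)) / 2"
      unfolding J_def by argo
    with d_le[of "(1/2) *\<^sub>R (v + w)"]
    have "d \<le> (norm (v + w))\<^sup>2 / 8 - (Re (f v) + Re (f w)) / 2" by simp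
    moreover have "(norm (v + w))\<^sup>2 + (norm (v - w))\<^sup>2 = 2 * (norm v)\<^sup>2 + 2 * (norm w)\<^sup>2"
      by (simp add: norm_add_squared norm_diff_squared)
    ultimately show ?thesis
      unfolding J_def by argo
  qed
  have "Cauchy u"
  proof (rule CauchyI)
    fix e :: real assume e: "0 < e"
    obtain k0 where k0: "8 / real (Suc k0) < e\<^sup>2"
      using reals_Archimedean[of "e\<^sup>2 / 8"] e by (auto simp: field_simps)
    have "norm (u m - u n) < e" if "m \<ge> k0" "n \<ge> k0" for m n
    proof -
      have *: "J (u k) - d \<le> 1 / real (Suc k0)" if "k \<ge> k0" for k
      proof -
        have "1 / real (Suc k) \<le> 1 / real (Suc k0)"
          using that by (intro divide_left_mono) auto
        then show ?thesis using u[of k] by linarith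
      qed
      have "(norm (u m - u n))\<^sup>2 \<le> 4 * (1 / real (Suc k0) + 1 / real (Suc k0))"
        using gap[of "u m" "u n"] *[OF that(1)] *[OF that(2)] by argo
      also have "\<dots> < e\<^sup>2" using k0 by simp
      finally show ?thesis using e by (simp add: power2_less_imp_less)
    qed
    then show "\<exists>M. \<forall>m\<ge>M. \<forall>n\<ge>M. norm (u m - u n) < e" by blast
  qed
  then obtain z where z: "u \<longlonglongrightarrow> z"
    using Cauchy_convergent convergent_def by blast
  have "(\<lambda>k. J (u k)) \<longlonglongrightarrow> J z"
    unfolding J_def by (intro tendsto_intros z f.tendsto) simp
  moreover have "(\<lambda>k. d + 1 / real (Suc k)) \<longlonglongrightarrow> d + 0"
    by (intro tendsto_add tendsto_const) (use LIMSEQ_inverse_real_of_nat in \<open>simp add: divide_inverse\<close>)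
  ultimately have "J z \<le> d + 0"
    by (rule LIMSEQ_le) (use u less_imp_le in blast)
  then have Jz: "J z \<le> J y" for y using d_le[of y] by simp
  have Re_eq: "Re (f y) = Re (cinner z y)" for y
  proof -
    define g where "g = Re (cinner z y) - Re (f y)"
    have pos: "0 \<le> t * g + t\<^sup>2 * (norm y)\<^sup>2 / 2" for t
    proof -
      have "J (z + t *\<^sub>R y) = J z + (t * g + t\<^sup>2 * (norm y)\<^sup>2 / 2)"
        unfolding J_def g_def norm_add_squared f.add f.scaleR cinner_scaleR_right norm_scaleR
        by (simp add: power_mult_distrib add_divide_distrib right_diff_distrib)
      then show ?thesis using Jz[of "z + t *\<^sub>R y"] by linarith
    qed
    have "g = 0"
    proof (rule ccontr)
      assume g: "g \<noteq> 0"
      define N where "N = (norm y)\<^sup>2"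
      have N: "N \<ge> 0" by (simp add: N_def)
      \<comment> \<open>The step \<open>t = -g / (N + 1)\<close> is close to the minimiser \<open>-g / N\<close> of the quadratic polynomial in
        \<open>t\<close> and is defined also for \<open>N = 0\<close>.\<close>
      have "(- g / (N + 1)) * g + (- g / (N + 1))\<^sup>2 * N / 2 = - (g\<^sup>2 * (N + 2) / (2 * (N + 1)\<^sup>2))"
        using N by (simp add: divide_simps) (simp add: power2_eq_square algebra_simps)
      moreover have "g\<^sup>2 * (N + 2) / (2 * (N + 1)\<^sup>2) > 0"
        using g N by (intro divide_pos_pos mult_pos_pos) auto
      ultimately show False
        using pos[of "- g / (N + 1)"] by (simp add: N_def)
    qed
    then show ?thesis by (simp add: g_def)
  qed
  have "f y = cinner z y" for y
  proof (rule complex_eqI)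
    show "Re (f y) = Re (cinner z y)" by (rule Re_eq)
    show "Im (f y) = Im (cinner z y)"
      using Re_eq[of "\<i> *\<^sub>C y"] by (simp add: fC cinner_scaleC_right)
  qed
  then show ?thesis by blast
qed

section \<open>Adjoints\<close>

lemma clinear_apply:
  "complex_linear_op T \<Longrightarrow> blinfun_apply T (c *\<^sub>C x) = c *\<^sub>C blinfun_apply T x"
  by (simp add: complex_linear_op_def)

text \<open>The adjoint comes from representing the functionals \<open>y \<mapsto> cinner x (T y)\<close>, which are
  complex-linear because \<open>T\<close> is.\<close>

lemma adj_op_exists:
  fixes T :: "'h::chilbert_space \<Rightarrow>\<^sub>L 'h"
  assumes T: "complex_linear_op T"
  shows "\<exists>S. \<forall>x y. cinner (blinfun_apply S x) y = cinner x (blinfun_apply T y)"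
proof -
  have "\<exists>z. \<forall>y. cinner x (T y) = cinner z y" for x
    by (rule riesz_representation)
      (auto intro: bounded_linear_compose[OF bounded_linear_cinner_right blinfun.bounded_linear_right]
        simp: clinear_apply[OF T] cinner_scaleC_right)
  then obtain S where S: "\<And>x y. cinner x (T y) = cinner (S x) y" by metis
  have "bounded_linear S"
  proof (rule bounded_linear_intro)
    show "S (x + y) = S x + S y" for x y
      by (rule cinner_eqI) (simp add: cinner_add_left flip: S)
    show "S (r *\<^sub>R x) = r *\<^sub>R S x" for r x
      by (rule cinner_eqI) (simp add: cinner_scaleR_left flip: S)
    show "norm (S x) \<le> norm x * norm T" for x
    proof (cases "S x = 0")
      case False
      have "(norm (S x))\<^sup>2 = Re (cinner x (T (S x)))"
        by (simp add: S Re_cinner_self)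
      also have "\<dots> \<le> norm x * norm (T (S x))"
        using cinner_Cauchy_Schwarz complex_Re_le_cmod order_trans by blast
      also have "\<dots> \<le> norm x * (norm T * norm (S x))"
        by (intro mult_left_mono norm_blinfun) simp
      finally show ?thesis
        using False by (simp add: power2_eq_square mult.assoc)
    qed simp
  qed
  then show ?thesis
    by (intro exI[of _ "Blinfun S"]) (simp add: bounded_linear_Blinfun_apply S)
qed

lemma cinner_adj_op:
  fixes T :: "'h::chilbert_space \<Rightarrow>\<^sub>L 'h"
  assumes T: "complex_linear_op T"
  shows "cinner (adj_op T x) y = cinner x (T y)"
proof -
  obtain S where S: "\<forall>x y. cinner (blinfun_apply S x) y = cinner x (blinfun_apply T y)"
    using adj_op_exists[OF T] by blast
  have "\<exists>!S. \<forall>x y. cinner (blinfun_apply S x) y = cinner x (blinfun_apply T y)"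
  proof (rule ex1I[of _ S])
    show "S' = S" if "\<forall>x y. cinner (blinfun_apply S' x) y = cinner x (blinfun_apply T y)" for S'
      by (rule blinfun_eqI, rule cinner_eqI) (use S that in simp)
  qed (rule S)
  from theI'[OF this] show ?thesis unfolding adj_op_def by blast
qed

lemma cinner_adj_op_right:
  fixes T :: "'h::chilbert_space \<Rightarrow>\<^sub>L 'h"
  assumes T: "complex_linear_op T"
  shows "cinner x (adj_op T y) = cinner (T x) y"
  by (metis cinner_adj_op[OF T] cinner_commute)

lemma adj_op_eqI:
  fixes T :: "'h::chilbert_space \<Rightarrow>\<^sub>L 'h"
  assumes "complex_linear_op T" "\<And>y. cinner z y = cinner x (T y)"
  shows "adj_op T x = z"
  by (rule cinner_eqI) (simp add: assms cinner_adj_op)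

section \<open>Complex linear operators\<close>

lemma scaleC_op_apply [simp]: "blinfun_apply (scaleC_op c T) x = c *\<^sub>C T x"
  by transfer simp

lemma clinear_id [simp]: "complex_linear_op id_blinfun"
  by (simp add: complex_linear_op_def)
lemma clinear_0 [simp]: "complex_linear_op 0"
  by (simp add: complex_linear_op_def)
lemma clinear_add: "complex_linear_op S \<Longrightarrow> complex_linear_op T \<Longrightarrow> complex_linear_op (S + T)"
  by (simp add: complex_linear_op_def blinfun.add_left scaleC_add_right)
lemma clinear_diff: "complex_linear_op S \<Longrightarrow> complex_linear_op T \<Longrightarrow> complex_linear_op (S - T)"
  by (simp add: complex_linear_op_def blinfun.diff_left cvs.scale_right_diff_distrib)
lemma clinear_scaleC: "complex_linear_op T \<Longrightarrow> complex_linear_op (scaleC_op c T)"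
  by (simp add: complex_linear_op_def scaleC_scaleC mult.commute)
lemma clinear_comp: "complex_linear_op S \<Longrightarrow> complex_linear_op T \<Longrightarrow> complex_linear_op (S o\<^sub>L T)"
  by (simp add: complex_linear_op_def)
lemma clinear_sum: "(\<And>i. i \<in> I \<Longrightarrow> complex_linear_op (f i)) \<Longrightarrow> complex_linear_op (sum f I)"
  by (induction I rule: infinite_finite_induct) (auto intro: clinear_add)
lemma clinear_limit:
  assumes "F \<longlonglongrightarrow> T" "\<And>k. complex_linear_op (F k)"
  shows "complex_linear_op T"
  unfolding complex_linear_op_def
proof (intro allI)
  fix c x
  have 1: "(\<lambda>k. F k (c *\<^sub>C x)) \<longlonglongrightarrow> T (c *\<^sub>C x)"
    by (intro tendsto_intros assms)
  have 2: "(\<lambda>k. c *\<^sub>C F k x) \<longlonglongrightarrow> c *\<^sub>C T x"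
    by (intro bounded_linear.tendsto[OF bounded_linear_scaleC] tendsto_intros assms)
  show "T (c *\<^sub>C x) = c *\<^sub>C T x"
    using LIMSEQ_unique[OF 1] 2 assms(2) by (simp add: complex_linear_op_def)
qed
lemmas clinear_intros = clinear_id clinear_0 clinear_add clinear_diff clinear_scaleC clinear_comp clinear_sum

lemma clinear_word: "(\<And>i. complex_linear_op (X i)) \<Longrightarrow> complex_linear_op (word_op X \<alpha>)"
  by (induction \<alpha>) (auto intro: clinear_intros)

lemma word_op_append: "word_op X (\<alpha> @ \<beta>) = word_op X \<alpha> o\<^sub>L word_op X \<beta>"
  by (induction \<alpha>) (auto intro: blinfun_eqI)

lemma norm_scaleC_op: "norm (scaleC_op c T) \<le> cmod c * norm T"
proof (rule norm_blinfun_bound)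
  show "norm (scaleC_op c T x) \<le> cmod c * norm T * norm x" for x
    using norm_blinfun[of T x] by (simp add: norm_scaleC mult.assoc mult_left_mono)
qed simp

section \<open>The row norm and the closed ball\<close>

text \<open>The sum on the left is the quadratic form of the operator \<open>\<Sum> X\<^sub>i X\<^sub>i\<^sup>*\<close> at \<open>x\<close>. This and
  the converse \<open>row_norm_leI\<close> reduce every statement on row norms to sums of squared vector norms.\<close>

lemma row_adj_bound:
  fixes X :: "('n::finite, 'h::chilbert_space) op_tuple"
  assumes X: "\<And>i. complex_linear_op (X i)"
  shows "(\<Sum>i\<in>UNIV. (norm (adj_op (X i) x))\<^sup>2) \<le> (row_norm X)\<^sup>2 * (norm x)\<^sup>2"
proof -
  define T where "T = (\<Sum>i\<in>UNIV. X i o\<^sub>L adj_op (X i))"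
  have "(\<Sum>i\<in>UNIV. (norm (adj_op (X i) x))\<^sup>2) = Re (cinner x (T x))"
    by (simp add: T_def blinfun.sum_left cinner_sum_right X Re_cinner_self flip: cinner_adj_op)
  also have "\<dots> \<le> norm x * norm (T x)"
    using cinner_Cauchy_Schwarz complex_Re_le_cmod order_trans by blast
  also have "\<dots> \<le> norm x * (norm T * norm x)"
    by (intro mult_left_mono norm_blinfun) simp
  finally show ?thesis
    by (simp add: row_norm_def T_def power2_eq_square mult_ac)
qed

text \<open>The row operator and the column of its adjoints have the same norm; this is the duality argument
  for one direction.\<close>

lemma row_apply_bound:
  fixes X :: "('n::finite, 'h::chilbert_space) op_tuple"
  assumes X: "\<And>i. complex_linear_op (X i)" and c: "0 \<le> c"
    and adj: "\<And>x. (\<Sum>i\<in>UNIV. (norm (adj_op (X i) x))\<^sup>2) \<le> c\<^sup>2 * (norm x)\<^sup>2"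
  shows "norm (\<Sum>i\<in>UNIV. X i (y i)) \<le> c * sqrt (\<Sum>i\<in>UNIV. (norm (y i))\<^sup>2)"
proof -
  define v where "v = (\<Sum>i\<in>UNIV. X i (y i))"
  have "(norm v)\<^sup>2 = Re (\<Sum>i\<in>UNIV. cinner (adj_op (X i) v) (y i))"
    by (simp add: cinner_adj_op X flip: cinner_sum_right v_def Re_cinner_self del: Re_sum)
  also have "\<dots> \<le> (\<Sum>i\<in>UNIV. norm (adj_op (X i) v) * norm (y i))"
    unfolding Re_sum
    by (intro sum_mono order_trans[OF complex_Re_le_cmod cinner_Cauchy_Schwarz])
  also have "\<dots> \<le> sqrt (\<Sum>i\<in>UNIV. (norm (adj_op (X i) v))\<^sup>2) * sqrt (\<Sum>i\<in>UNIV. (norm (y i))\<^sup>2)"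
    using L2_set_mult_ineq[of "\<lambda>i. norm (adj_op (X i) v)" "\<lambda>i. norm (y i)" UNIV]
    by (simp add: L2_set_def)
  also have "\<dots> \<le> (c * norm v) * sqrt (\<Sum>i\<in>UNIV. (norm (y i))\<^sup>2)"
    using adj[of v] c
    by (intro mult_right_mono real_le_lsqrt) (auto simp: power_mult_distrib sum_nonneg)
  finally have *: "norm v * norm v \<le> norm v * (c * sqrt (\<Sum>i\<in>UNIV. (norm (y i))\<^sup>2))"
    by (simp add: power2_eq_square mult_ac)
  show ?thesis
  proof (cases "v = 0")
    case True
    then show ?thesis using c by (simp add: v_def[symmetric] sum_nonneg)
  next
    case False
    then show ?thesis using * by (simp add: v_def[symmetric])
  qed
qed

lemma row_norm_leI:
  fixes X :: "('n::finite, 'h::chilbert_space) op_tuple"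
  assumes X: "\<And>i. complex_linear_op (X i)" and c: "0 \<le> c"
    and adj: "\<And>x. (\<Sum>i\<in>UNIV. (norm (adj_op (X i) x))\<^sup>2) \<le> c\<^sup>2 * (norm x)\<^sup>2"
  shows "row_norm X \<le> c"
proof -
  have "norm (\<Sum>i\<in>UNIV. X i o\<^sub>L adj_op (X i)) \<le> c\<^sup>2"
  proof (rule norm_blinfun_bound)
    fix x
    have "norm ((\<Sum>i\<in>UNIV. X i o\<^sub>L adj_op (X i)) x) \<le> c * sqrt (\<Sum>i\<in>UNIV. (norm (adj_op (X i) x))\<^sup>2)"
      using row_apply_bound[OF X c adj, of "\<lambda>i. adj_op (X i) x"] by (simp add: blinfun.sum_left)
    also have "\<dots> \<le> c * (c * norm x)"
      using adj[of x] c
      by (intro mult_left_mono real_le_lsqrt) (auto simp: power_mult_distrib sum_nonneg)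
    finally show "norm ((\<Sum>i\<in>UNIV. X i o\<^sub>L adj_op (X i)) x) \<le> c\<^sup>2 * norm x"
      by (simp add: power2_eq_square mult.assoc)
  qed simp
  then show ?thesis
    unfolding row_norm_def using c by (intro real_le_lsqrt) auto
qed

lemma row_norm_nonneg: "0 \<le> row_norm X" by (simp add: row_norm_def)

lemma nc_ball_imp_cball: "X \<in> nc_ball \<Longrightarrow> X \<in> nc_cball"
  by (auto simp: nc_ball_def nc_cball_def)

lemma nc_cball_cl: "X \<in> nc_cball \<Longrightarrow> complex_linear_op (X i)"
  by (simp add: nc_cball_def)

lemma nc_cball_iff:
  "X \<in> nc_cball \<longleftrightarrow> (\<forall>i. complex_linear_op (X i)) \<and>
    (\<forall>x. (\<Sum>i\<in>UNIV. (norm (adj_op (X i) x))\<^sup>2) \<le> (norm x)\<^sup>2)" (is "?L \<longleftrightarrow> ?R")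
proof
  assume L: ?L
  then have "(row_norm X)\<^sup>2 * (norm x)\<^sup>2 \<le> (norm x)\<^sup>2" for x
    using row_norm_nonneg[of X] by (intro mult_left_le_one_le) (auto simp: nc_cball_def power_le_one)
  then show ?R
    using L row_adj_bound[of X] order_trans unfolding nc_cball_def by blast
next
  assume ?R then show ?L using row_norm_leI[of X 1] by (simp add: nc_cball_def)
qed

lemma nc_ball_iff:
  "X \<in> nc_ball \<longleftrightarrow> (\<forall>i. complex_linear_op (X i)) \<and>
    (\<exists>c. 0 \<le> c \<and> c < 1 \<and> (\<forall>x. (\<Sum>i\<in>UNIV. (norm (adj_op (X i) x))\<^sup>2) \<le> c * (norm x)\<^sup>2))"
  (is "?L \<longleftrightarrow> ?R")
proof
  assume L: ?L
  then have "(row_norm X)\<^sup>2 < 1"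
    using row_norm_nonneg[of X] by (simp add: nc_ball_def power_less_one_iff)
  then show ?R
    using L row_adj_bound[of X] unfolding nc_ball_def by (intro conjI exI[of _ "(row_norm X)\<^sup>2"]) auto
next
  assume ?R
  then obtain c where c: "0 \<le> c" "c < 1" and X: "\<And>i. complex_linear_op (X i)"
    and le: "\<And>x. (\<Sum>i\<in>UNIV. (norm (adj_op (X i) x))\<^sup>2) \<le> c * (norm x)\<^sup>2" by blast
  have "row_norm X \<le> sqrt c"
    using c X le by (intro row_norm_leI) auto
  also have "\<dots> < 1" using c by simp
  finally show ?L using X by (simp add: nc_ball_def)
qed

lemma nc_cball_row_apply:
  assumes "X \<in> nc_cball"
  shows "norm (\<Sum>i\<in>UNIV. X i (y i)) \<le> sqrt (\<Sum>i\<in>UNIV. (norm (y i))\<^sup>2)"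
  using row_apply_bound[of X 1 y] assms by (simp add: nc_cball_iff)

lemma nc_cball_norm_le:
  assumes X: "X \<in> nc_cball" shows "norm (X i) \<le> 1"
proof (rule norm_blinfun_bound)
  fix x
  have "norm (\<Sum>j\<in>UNIV. X j (if j = i then x else 0)) \<le> sqrt (\<Sum>j\<in>UNIV. (norm (if j = i then x else 0))\<^sup>2)"
    by (rule nc_cball_row_apply[OF X])
  moreover have "(\<Sum>j\<in>UNIV. X j (if j = i then x else 0)) = X i x"
    by (subst sum.remove[of _ i]) (auto intro!: sum.neutral)
  moreover have "(\<Sum>j\<in>UNIV. (norm (if j = i then x else 0))\<^sup>2) = (norm x)\<^sup>2"
    by (subst sum.remove[of _ i]) (auto intro!: sum.neutral)
  ultimately show "norm (X i x) \<le> 1 * norm x" by simp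
qed simp

lemma nc_cball_norm_word:
  assumes X: "X \<in> nc_cball" shows "norm (word_op X \<alpha>) \<le> 1"
proof (induction \<alpha>)
  case Nil
  show ?case by (rule norm_blinfun_bound) auto
next
  case (Cons i \<alpha>)
  have "norm (word_op X (i # \<alpha>)) \<le> norm (X i) * norm (word_op X \<alpha>)"
    by (simp add: norm_blinfun_compose)
  also have "\<dots> \<le> 1" using nc_cball_norm_le[OF X, of i] Cons by (simp add: mult_le_one)
  finally show ?case .
qed

section \<open>Values of noncommutative polynomials\<close>

text \<open>The value of a scalar noncommutative polynomial, that is, one entry of \<^const>\<open>nc_eval\<close>.\<close>

definition poly_value :: "('n list \<Rightarrow>\<^sub>0 complex) \<Rightarrow> ('n, 'h::chilbert_space) op_tuple \<Rightarrow> 'h \<Rightarrow>\<^sub>L 'h" where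
  "poly_value q X = (\<Sum>\<alpha>\<in>Poly_Mapping.keys q. scaleC_op (Poly_Mapping.lookup q \<alpha>) (word_op X \<alpha>))"

lemma nc_eval_poly_value: "nc_eval p X i j = poly_value (p i j) X"
  by (simp add: nc_eval_def poly_value_def)

lemma scaleC_op_add_left: "scaleC_op (a + b) T = scaleC_op a T + scaleC_op b T"
  by (rule blinfun_eqI) (simp add: blinfun.add_left scaleC_add_left)
lemma scaleC_op_zero [simp]: "scaleC_op 0 T = 0"
  by (rule blinfun_eqI) simp
lemma scaleC_op_one [simp]: "scaleC_op 1 T = T"
  by (rule blinfun_eqI) (simp add: scaleC_one)

lemma poly_value_superset:
  assumes "finite S" "Poly_Mapping.keys q \<subseteq> S"
  shows "poly_value q X = (\<Sum>\<alpha>\<in>S. scaleC_op (Poly_Mapping.lookup q \<alpha>) (word_op X \<alpha>))"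
  unfolding poly_value_def using assms
  by (intro sum.mono_neutral_left) (auto simp: in_keys_iff)

lemma poly_value_zero [simp]: "poly_value 0 X = 0"
  by (simp add: poly_value_def)

lemma poly_value_add: "poly_value (q + r) X = poly_value q X + poly_value r X"
proof -
  let ?S = "Poly_Mapping.keys q \<union> Poly_Mapping.keys r"
  have "poly_value (q + r) X = (\<Sum>\<alpha>\<in>?S. scaleC_op (Poly_Mapping.lookup (q + r) \<alpha>) (word_op X \<alpha>))"
    using Poly_Mapping.keys_add[of q r] by (intro poly_value_superset) auto
  also have "\<dots> = (\<Sum>\<alpha>\<in>?S. scaleC_op (Poly_Mapping.lookup q \<alpha>) (word_op X \<alpha>))
      + (\<Sum>\<alpha>\<in>?S. scaleC_op (Poly_Mapping.lookup r \<alpha>) (word_op X \<alpha>))"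
    by (simp add: lookup_add scaleC_op_add_left sum.distrib)
  finally show ?thesis by (simp add: poly_value_superset[of ?S])
qed

lemma poly_value_single: "poly_value (Poly_Mapping.single \<alpha> c) X = scaleC_op c (word_op X \<alpha>)"
  by (subst poly_value_superset[of "{\<alpha>}"]) auto

lemma clinear_poly_value: "(\<And>i. complex_linear_op (X i)) \<Longrightarrow> complex_linear_op (poly_value q X)"
  unfolding poly_value_def by (intro clinear_intros clinear_word)

section \<open>The Harnack relation in terms of quadratic forms\<close>

definition quad_form :: "nat \<Rightarrow> 'h::chilbert_space op_matrix \<Rightarrow> (nat \<Rightarrow> 'h) \<Rightarrow> real" where
  "quad_form m T \<xi> = Re (\<Sum>i<m. \<Sum>j<m. cinner (\<xi> i) (T i j (\<xi> j)))"

text \<open>The real part of an operator matrix is self-adjoint, so its quadratic form is real: the form of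
  the matrix and that of its adjoint are complex conjugates. Operator inequalities between real
  parts thereby become inequalities between real numbers.\<close>

lemma cinner_op_matrix_Re:
  assumes "\<And>i j. complex_linear_op (T i j)"
  shows "(\<Sum>i<m. \<Sum>j<m. cinner (\<xi> i) (op_matrix_Re T i j (\<xi> j))) = of_real (quad_form m T \<xi>)"
proof -
  define Q where "Q = (\<Sum>i<m. \<Sum>j<m. cinner (\<xi> i) (T i j (\<xi> j)))"
  have e: "cinner (\<xi> i) (op_matrix_Re T i j (\<xi> j)) =
      (1/2) * (cinner (\<xi> i) (T i j (\<xi> j)) + cnj (cinner (\<xi> j) (T j i (\<xi> i))))" for i j
    by (simp add: op_matrix_Re_def blinfun.add_left blinfun.scaleR_left cinner_scaleR_right
        cinner_add_right cinner_adj_op_right assms cinner_commute[of "T j i (\<xi> i)"])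
  have "(\<Sum>i<m. \<Sum>j<m. cinner (\<xi> i) (op_matrix_Re T i j (\<xi> j))) =
      (1/2) * (Q + (\<Sum>i<m. \<Sum>j<m. cnj (cinner (\<xi> j) (T j i (\<xi> i)))))"
    unfolding e Q_def by (simp only: sum.distrib flip: sum_distrib_left)
  also have "(\<Sum>i<m. \<Sum>j<m. cnj (cinner (\<xi> j) (T j i (\<xi> i)))) = cnj Q"
    unfolding Q_def by (subst sum.swap) (simp add: cnj_sum)
  also have "(1/2) * (Q + cnj Q) = of_real (Re Q)"
    by (simp add: complex_add_cnj)
  finally show ?thesis by (simp add: Q_def quad_form_def)
qed

lemma op_matrix_le_scaleR_Re_iff:
  assumes "\<And>i j. complex_linear_op (S i j)" "\<And>i j. complex_linear_op (T i j)"
  shows "op_matrix_le m (\<lambda>i j. a *\<^sub>R op_matrix_Re S i j) (\<lambda>i j. b *\<^sub>R op_matrix_Re T i j)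
    \<longleftrightarrow> (\<forall>\<xi>. a * quad_form m S \<xi> \<le> b * quad_form m T \<xi>)"
proof -
  have "(\<Sum>i<m. \<Sum>j<m. cinner (\<xi> i) ((b *\<^sub>R op_matrix_Re T i j - a *\<^sub>R op_matrix_Re S i j) (\<xi> j)))
      = of_real (b * quad_form m T \<xi> - a * quad_form m S \<xi>)" for \<xi>
    by (simp add: blinfun.diff_left blinfun.scaleR_left cinner_diff_right cinner_scaleR_right
        sum_subtractf cinner_op_matrix_Re assms flip: sum_distrib_left)
  then show ?thesis
    unfolding op_matrix_le_def by (simp add: complex_nonneg_Reals_iff)
qed

lemma clinear_nc_eval: "(\<And>i. complex_linear_op (X i)) \<Longrightarrow> complex_linear_op (nc_eval p X i j)"
  unfolding nc_eval_poly_value by (rule clinear_poly_value)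

lemma nc_Re_nonneg_iff:
  "nc_Re_nonneg TYPE('h::chilbert_space) m p \<longleftrightarrow>
    (\<forall>X \<in> (nc_ball :: ('n::finite, 'h) op_tuple set). \<forall>\<xi>. 0 \<le> quad_form m (nc_eval p X) \<xi>)"
proof -
  have "op_matrix_le m (\<lambda>i j. 0) (op_matrix_Re (nc_eval p X)) \<longleftrightarrow>
      (\<forall>\<xi>. 0 \<le> quad_form m (nc_eval p X) \<xi>)" if "X \<in> nc_ball" for X :: "('n, 'h) op_tuple"
  proof -
    have X: "complex_linear_op (X i)" for i using that by (simp add: nc_ball_def)
    from op_matrix_le_scaleR_Re_iff[of "nc_eval p X" "nc_eval p X" m 0 1, OF clinear_nc_eval[OF X] clinear_nc_eval[OF X]]
    show ?thesis by simp
  qed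
  then show ?thesis by (simp add: nc_Re_nonneg_def)
qed

lemma harnack_le_iff:
  fixes A B :: "('n::finite, 'h::chilbert_space) op_tuple"
  assumes A: "A \<in> nc_cball" and B: "B \<in> nc_cball"
  shows "harnack_le c A B \<longleftrightarrow> (\<forall>m p \<xi>. nc_Re_nonneg TYPE('h) m p \<longrightarrow>
      (1 / c\<^sup>2) * quad_form m (nc_eval p B) \<xi> \<le> quad_form m (nc_eval p A) \<xi> \<and>
      quad_form m (nc_eval p A) \<xi> \<le> c\<^sup>2 * quad_form m (nc_eval p B) \<xi>)"
proof -
  have clA: "complex_linear_op (nc_eval p A i j)" and clB: "complex_linear_op (nc_eval p B i j)"
    for p :: "'n nc_matrix_poly" and i j
    using A B by (auto intro!: clinear_nc_eval simp: nc_cball_cl)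
  have "op_matrix_le m (\<lambda>i j. (1 / c\<^sup>2) *\<^sub>R op_matrix_Re (nc_eval p B) i j) (op_matrix_Re (nc_eval p A))
      \<longleftrightarrow> (\<forall>\<xi>. (1 / c\<^sup>2) * quad_form m (nc_eval p B) \<xi> \<le> quad_form m (nc_eval p A) \<xi>)"
    for m and p :: "'n nc_matrix_poly"
    using op_matrix_le_scaleR_Re_iff[of "nc_eval p B" "nc_eval p A" m "1 / c\<^sup>2" 1, OF clB clA] by simp
  moreover have "op_matrix_le m (op_matrix_Re (nc_eval p A)) (\<lambda>i j. c\<^sup>2 *\<^sub>R op_matrix_Re (nc_eval p B) i j)
      \<longleftrightarrow> (\<forall>\<xi>. quad_form m (nc_eval p A) \<xi> \<le> c\<^sup>2 * quad_form m (nc_eval p B) \<xi>)"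
    for m and p :: "'n nc_matrix_poly"
    using op_matrix_le_scaleR_Re_iff[of "nc_eval p A" "nc_eval p B" m 1 "c\<^sup>2", OF clA clB] by simp
  ultimately show ?thesis unfolding harnack_le_def by simp blast
qed

section \<open>The Harnack metric\<close>

lemma harnack_le_refl: "A \<in> nc_cball \<Longrightarrow> harnack_le 1 A A"
  by (simp add: harnack_le_iff)

lemma harnack_le_sym:
  assumes "A \<in> nc_cball" "B \<in> nc_cball" "1 \<le> c" "harnack_le c A B"
  shows "harnack_le c B A"
proof -
  have c: "c\<^sup>2 > 0" using assms by simp
  show ?thesis
    using assms(4) c unfolding harnack_le_iff[OF assms(1,2)] harnack_le_iff[OF assms(2,1)]
    by (simp add: divide_le_eq mult.commute)
qed

lemma harnack_le_trans:
  assumes "A \<in> nc_cball" "B \<in> nc_cball" "C \<in> nc_cball" "1 \<le> c" "1 \<le> d"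
    and AB: "harnack_le c A B" and BC: "harnack_le d B C"
  shows "harnack_le (c * d) A C"
  unfolding harnack_le_iff[OF assms(1,3)]
proof (intro allI impI conjI)
  fix m :: nat and p :: "'a nc_matrix_poly" and \<xi> :: "nat \<Rightarrow> 'b"
  assume p: "nc_Re_nonneg TYPE('b) m p"
  define a where "a = quad_form m (nc_eval p A) \<xi>"
  define b where "b = quad_form m (nc_eval p B) \<xi>"
  define e where "e = quad_form m (nc_eval p C) \<xi>"
  have ab: "(1 / c\<^sup>2) * b \<le> a" "a \<le> c\<^sup>2 * b"
    using AB p unfolding harnack_le_iff[OF assms(1,2)] a_def b_def by blast+
  have be: "(1 / d\<^sup>2) * e \<le> b" "b \<le> d\<^sup>2 * e"
    using BC p unfolding harnack_le_iff[OF assms(2,3)] e_def b_def by blast+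
  have "(1 / (c * d)\<^sup>2) * e = (1 / c\<^sup>2) * ((1 / d\<^sup>2) * e)" by (simp add: power_mult_distrib)
  also have "\<dots> \<le> (1 / c\<^sup>2) * b" using be(1) by (intro mult_left_mono) auto
  finally show "(1 / (c * d)\<^sup>2) * quad_form m (nc_eval p C) \<xi> \<le> quad_form m (nc_eval p A) \<xi>"
    using ab(1) by (simp add: a_def e_def)
  have "a \<le> c\<^sup>2 * (d\<^sup>2 * e)" using ab(2) mult_left_mono[OF be(2), of "c\<^sup>2"] by simp
  then show "quad_form m (nc_eval p A) \<xi> \<le> (c * d)\<^sup>2 * quad_form m (nc_eval p C) \<xi>"
    by (simp add: a_def e_def power_mult_distrib mult.assoc)
qed

lemma harnack_equiv_refl: "A \<in> nc_cball \<Longrightarrow> harnack_equiv A A"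
  unfolding harnack_equiv_def using harnack_le_refl by blast

lemma harnack_equiv_sym: "harnack_equiv A B \<Longrightarrow> harnack_equiv B A"
  unfolding harnack_equiv_def using harnack_le_sym by blast

lemma harnack_equiv_trans: "harnack_equiv A B \<Longrightarrow> harnack_equiv B C \<Longrightarrow> harnack_equiv A C"
proof -
  assume AB: "harnack_equiv A B" and BC: "harnack_equiv B C"
  then obtain c d where cd: "1 \<le> c" "1 \<le> d" "harnack_le c A B" "harnack_le d B C"
    unfolding harnack_equiv_def by blast
  have "1 \<le> c * d" using cd(1,2) mult_mono[of 1 c 1 d] by simp
  then show ?thesis
    using harnack_le_trans[of A B C c d] AB BC cd unfolding harnack_equiv_def by blast
qed

lemma equiv_harnack_equiv: "equiv nc_cball {(A, B). harnack_equiv A B}"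
proof (rule equivI)
  show "{(A, B). harnack_equiv A B} \<subseteq> nc_cball \<times> nc_cball" by (auto simp: harnack_equiv_def)
  show "refl_on nc_cball {(A, B). harnack_equiv A B}"
    by (rule refl_onI) (auto simp: harnack_equiv_refl)
  show "sym {(A, B). harnack_equiv A B}"
    by (rule symI) (auto intro: harnack_equiv_sym)
  show "trans {(A, B). harnack_equiv A B}"
    by (rule transI) (auto intro: harnack_equiv_trans)
qed

text \<open>For a fixed polynomial and a fixed vector the admissible constants form a closed set; the Harnack
  constants are the intersection of these sets.\<close>

lemma harnack_omega_attained:
  fixes A B :: "('n::finite, 'h::chilbert_space) op_tuple"
  assumes "harnack_equiv A B"
  shows "1 \<le> harnack_omega A B" "harnack_le (harnack_omega A B) A B"
proof -
  have A: "A \<in> nc_cball" and B: "B \<in> nc_cball" using assms by (auto simp: harnack_equiv_def)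
  define S where "S = {c. 1 \<le> c \<and> harnack_le c A B}"
  define K where "K m p \<xi> = {c::real. c \<ge> 1 \<and> quad_form m (nc_eval p B) \<xi> \<le> c\<^sup>2 * quad_form m (nc_eval p A) \<xi> \<and>
      quad_form m (nc_eval p A) \<xi> \<le> c\<^sup>2 * quad_form m (nc_eval p B) \<xi>}" for m and p :: "'n nc_matrix_poly" and \<xi>
  have closedK: "closed (K m p \<xi>)" for m p \<xi>
    unfolding K_def by (intro closed_Collect_conj closed_Collect_le continuous_intros)
  have S_eq: "S = {1..} \<inter> (\<Inter>m. \<Inter>p\<in>{p. nc_Re_nonneg TYPE('h) m p}. \<Inter>\<xi>. K m p \<xi>)"
  proof -
    have "harnack_le c A B \<longleftrightarrow> (\<forall>m p \<xi>. nc_Re_nonneg TYPE('h) m p \<longrightarrow> c \<in> K m p \<xi>)" if "1 \<le> c" for c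
      using that unfolding harnack_le_iff[OF A B] K_def by (simp add: divide_le_eq mult.commute)
    then show ?thesis unfolding S_def by auto
  qed
  have "closed S"
    unfolding S_eq by (intro closed_Int closed_INT closed_atLeast ballI closedK)
  moreover have "S \<noteq> {}" using assms by (auto simp: S_def harnack_equiv_def)
  moreover have "bdd_below S" by (rule bdd_belowI[of _ 1]) (auto simp: S_def)
  ultimately have "Inf S \<in> S" by (simp add: closed_contains_Inf)
  then show "1 \<le> harnack_omega A B" "harnack_le (harnack_omega A B) A B"
    by (auto simp: harnack_omega_def S_def)
qed

lemma harnack_omega_le: "1 \<le> c \<Longrightarrow> harnack_le c A B \<Longrightarrow> harnack_omega A B \<le> c"
  unfolding harnack_omega_def by (rule cInf_lower) (auto intro: bdd_belowI[of _ 1])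

lemma harnack_omega_commute:
  assumes "harnack_equiv A B" shows "harnack_omega A B = harnack_omega B A"
proof -
  have "{c. 1 \<le> c \<and> harnack_le c A B} = {c. 1 \<le> c \<and> harnack_le c B A}"
    using assms harnack_le_sym unfolding harnack_equiv_def by blast
  then show ?thesis by (simp add: harnack_omega_def)
qed

lemma harnack_omega_triangle:
  assumes "harnack_equiv A B" "harnack_equiv B C"
  shows "harnack_omega A C \<le> harnack_omega A B * harnack_omega B C"
proof (rule harnack_omega_le)
  note AB = harnack_omega_attained[OF assms(1)] and BC = harnack_omega_attained[OF assms(2)]
  show "1 \<le> harnack_omega A B * harnack_omega B C"
    using AB(1) BC(1) mult_mono[of 1 "harnack_omega A B" 1 "harnack_omega B C"] by simp
  show "harnack_le (harnack_omega A B * harnack_omega B C) A C"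
    using assms AB BC harnack_le_trans unfolding harnack_equiv_def by blast
qed

text \<open>Polarisation: replacing \<open>z\<close> by \<open>\<i> z\<close> in the symmetric part of the sesquilinear form recovers the
  form itself.\<close>

lemma complex_linear_op_ext_quadratic:
  fixes S T :: "'h::chilbert_space \<Rightarrow>\<^sub>L 'h"
  assumes S: "complex_linear_op S" and T: "complex_linear_op T"
    and eq: "\<And>x. cinner x (S x) = cinner x (T x)"
  shows "S = T"
proof (rule blinfun_eqI)
  fix y
  define D where "D = S - T"
  have D: "complex_linear_op D" unfolding D_def by (intro clinear_intros S T)
  have D0: "cinner x (D x) = 0" for x
    by (simp add: D_def blinfun.diff_left cinner_diff_right eq)
  have 1: "cinner x (D z) + cinner z (D x) = 0" for x z
    using D0[of "x + z"] by (simp add: blinfun.add_right cinner_add_left cinner_add_right D0 add.commute)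
  have 2: "cinner x (D z) - cinner z (D x) = 0" for x z
    using 1[of x "\<i> *\<^sub>C z"] 
    by (simp add: clinear_apply[OF D] cinner_scaleC_left cinner_scaleC_right)
  have "cinner (D y) (D y) = 0"
  proof -
    have "cinner (D y) (D y) + cinner (D y) (D y) = 0"
      using 1[of "D y" y] 2[of "D y" y] by (metis add.commute eq_iff_diff_eq_0 add_diff_eq diff_add_cancel)
    then show ?thesis by simp
  qed
  then show "S y = T y" by (simp add: cinner_self D_def blinfun.diff_left)
qed

text \<open>The polynomials \<open>1 + u X\<^sub>i\<close> with \<open>cmod u = 1\<close> have nonnegative real part on the ball because
  each \<open>X\<^sub>i\<close> is a contraction. For \<open>u = 1\<close> and \<open>u = \<i>\<close> they determine the quadratic form of
  \<open>A i\<close>.\<close>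

lemma harnack_le_1_imp_eq:
  fixes A B :: "('n::finite, 'h::chilbert_space) op_tuple"
  assumes A: "A \<in> nc_cball" and B: "B \<in> nc_cball" and le: "harnack_le 1 A B"
  shows "A = B"
proof
  fix i
  define p :: "complex \<Rightarrow> 'n nc_matrix_poly" where
    "p u = (\<lambda>_ _. Poly_Mapping.single [] 1 + Poly_Mapping.single [i] u)" for u
  have qf: "quad_form 1 (nc_eval (p u) X) \<xi> = (norm (\<xi> 0))\<^sup>2 + Re (u * cinner (\<xi> 0) (X i (\<xi> 0)))"
    for u and \<xi> and X :: "('n, 'h) op_tuple"
    by (simp add: quad_form_def nc_eval_poly_value p_def poly_value_add poly_value_single
        blinfun.add_left cinner_add_right cinner_scaleC_right cinner_self)
  have pos: "nc_Re_nonneg TYPE('h) 1 (p u)" if u: "cmod u = 1" for u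
    unfolding nc_Re_nonneg_iff
  proof (intro ballI allI)
    fix X :: "('n, 'h) op_tuple" and \<xi> :: "nat \<Rightarrow> 'h"
    assume X: "X \<in> nc_ball"
    have "cmod (u * cinner (\<xi> 0) (X i (\<xi> 0))) \<le> norm (\<xi> 0) * norm (X i (\<xi> 0))"
      using cinner_Cauchy_Schwarz by (simp add: norm_mult u)
    also have "\<dots> \<le> norm (\<xi> 0) * (norm (X i) * norm (\<xi> 0))"
      by (intro mult_left_mono norm_blinfun) simp
    also have "\<dots> \<le> norm (\<xi> 0) * (1 * norm (\<xi> 0))"
      using nc_cball_norm_le[OF nc_ball_imp_cball[OF X], of i]
      by (intro mult_left_mono mult_right_mono) auto
    finally have "cmod (u * cinner (\<xi> 0) (X i (\<xi> 0))) \<le> (norm (\<xi> 0))\<^sup>2"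
      by (simp add: power2_eq_square)
    then show "0 \<le> quad_form 1 (nc_eval (p u) X) \<xi>"
      unfolding qf using abs_Re_le_cmod[of "u * cinner (\<xi> 0) (X i (\<xi> 0))"] by linarith
  qed
  have eq: "Re (u * cinner x (A i x)) = Re (u * cinner x (B i x))" if "cmod u = 1" for u x
  proof -
    have "quad_form 1 (nc_eval (p u) A) (\<lambda>_. x) = quad_form 1 (nc_eval (p u) B) (\<lambda>_. x)"
      using le pos[OF that] unfolding harnack_le_iff[OF A B] by (simp add: order_antisym)
    then show ?thesis unfolding qf by simp
  qed
  have "cinner x (A i x) = cinner x (B i x)" for x
    using eq[of 1 x] eq[of "\<i>" x] by (simp add: complex_eq_iff)
  then show "A i = B i"
    by (intro complex_linear_op_ext_quadratic nc_cball_cl[OF A] nc_cball_cl[OF B])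
qed

text \<open>With \<open>w = exp t\<close> the expression on the left is \<open>tanh t\<close>, which is increasing and subadditive on
  the nonnegative reals.\<close>

lemma tanh_log_triangle:
  fixes a b w :: real
  assumes "1 \<le> a" "1 \<le> b" "1 \<le> w" "w \<le> a * b"
  shows "(w\<^sup>2 - 1) / (w\<^sup>2 + 1) \<le> (a\<^sup>2 - 1) / (a\<^sup>2 + 1) + (b\<^sup>2 - 1) / (b\<^sup>2 + 1)"
proof -
  \<comment> \<open>With nonnegative \<open>x\<close>, \<open>y\<close> the estimates become termwise.\<close>
  define x where "x = a\<^sup>2 - 1"
  define y where "y = b\<^sup>2 - 1"
  have xy: "0 \<le> x" "0 \<le> y" using assms by (auto simp: x_def y_def)
  have a2: "a\<^sup>2 = x + 1" and b2: "b\<^sup>2 = y + 1" by (auto simp: x_def y_def)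
  have w2: "w\<^sup>2 \<le> (x + 1) * (y + 1)"
    using power_mono[OF assms(4), of 2] assms by (simp add: power_mult_distrib a2 b2)
  have "(w\<^sup>2 - 1) / (w\<^sup>2 + 1) = 1 - 2 / (w\<^sup>2 + 1)"
    using assms by (simp add: field_simps add_nonneg_eq_0_iff)
  also have "\<dots> \<le> 1 - 2 / ((x + 1) * (y + 1) + 1)"
  proof -
    have "2 / ((x + 1) * (y + 1) + 1) \<le> 2 / (w\<^sup>2 + 1)"
      using w2 xy by (intro divide_left_mono mult_pos_pos) (auto intro: add_nonneg_pos)
    then show ?thesis by simp
  qed
  also have "\<dots> = (x + y + x * y) / (2 + x + y + x * y)"
  proof -
    have "2 + x + y + x * y > 0" using xy by (simp add: add_pos_nonneg)
    moreover have "(x + 1) * (y + 1) + 1 = 2 + x + y + x * y" by (simp add: algebra_simps)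
    ultimately show ?thesis by (simp add: field_simps)
  qed
  also have "\<dots> \<le> (2 * x + 2 * y + 2 * (x * y)) / ((x + 2) * (y + 2))"
  proof -
    have p: "0 < 2 + x + y + x * y" "0 < (x + 2) * (y + 2)" using xy by (auto intro: add_pos_nonneg mult_pos_pos)
    have "(x + y + x * y) * ((x + 2) * (y + 2)) \<le> (2 * x + 2 * y + 2 * (x * y)) * (2 + x + y + x * y)"
    proof -
      have "(x + y + x * y) * ((x + 2) * (y + 2)) \<le> (x + y + x * y) * (2 * (2 + x + y + x * y))"
        using xy by (intro mult_left_mono) (auto simp: algebra_simps)
      then show ?thesis by (simp add: algebra_simps)
    qed
    then show ?thesis using p by (simp add: divide_le_eq le_divide_eq mult.commute)
  qed
  also have "\<dots> = x / (x + 2) + y / (y + 2)"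
    using xy by (simp add: add_frac_eq) (simp add: algebra_simps)
  finally show ?thesis by (simp add: a2 b2 add.commute)
qed

lemma harnack_dist_eq:
  "harnack_equiv A B \<Longrightarrow> harnack_dist A B = ((harnack_omega A B)\<^sup>2 - 1) / ((harnack_omega A B)\<^sup>2 + 1)"
  by (simp add: harnack_dist_def)

lemma harnack_dist_nonneg: "0 \<le> harnack_dist A B"
  using harnack_omega_attained(1)[of A B]
  by (auto simp: harnack_dist_def intro!: divide_nonneg_nonneg)

lemma harnack_dist_le_1: "harnack_dist A B \<le> 1"
  by (simp add: harnack_dist_def divide_le_eq_1 add_nonneg_pos)

lemma harnack_part_equiv:
  assumes "\<Delta> \<in> harnack_parts" "A \<in> \<Delta>" "B \<in> \<Delta>"
  shows "harnack_equiv A B"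
  using assms quotient_eqI[of nc_cball] equiv_harnack_equiv
    quotient_eq_iff[OF equiv_harnack_equiv, of \<Delta> \<Delta> A B] unfolding harnack_parts_def by blast

lemma harnack_dist_Metric_space:
  assumes \<Delta>: "\<Delta> \<in> harnack_parts"
  shows "Metric_space \<Delta> harnack_dist"
proof
  show "0 \<le> harnack_dist A B" for A B :: "('a, 'b) op_tuple" by (rule harnack_dist_nonneg)
  show "harnack_dist A B = harnack_dist B A" for A B :: "('a, 'b) op_tuple"
    unfolding harnack_dist_def using harnack_omega_commute[of A B] harnack_equiv_sym by auto
  show "harnack_dist A B = 0 \<longleftrightarrow> A = B" if "A \<in> \<Delta>" "B \<in> \<Delta>" for A B
  proof -
    note e = harnack_part_equiv[OF \<Delta> that]
    note w = harnack_omega_attained[OF e]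
    have cball: "A \<in> nc_cball" "B \<in> nc_cball" using e by (auto simp: harnack_equiv_def)
    have "harnack_dist A B = 0 \<longleftrightarrow> (harnack_omega A B)\<^sup>2 = 1"
      by (simp add: harnack_dist_eq[OF e] add_nonneg_eq_0_iff)
    also have "\<dots> \<longleftrightarrow> harnack_omega A B = 1" using w(1) by (auto simp: power2_eq_1_iff)
    also have "\<dots> \<longleftrightarrow> A = B"
    proof
      assume "harnack_omega A B = 1"
      then show "A = B" using w(2) harnack_le_1_imp_eq[OF cball] by simp
    next
      assume "A = B"
      then show "harnack_omega A B = 1"
        using w(1) harnack_omega_le[OF _ harnack_le_refl[OF cball(1)]] by simp
    qed
    finally show ?thesis .
  qed
  show "harnack_dist A C \<le> harnack_dist A B + harnack_dist B C"
    if "A \<in> \<Delta>" "B \<in> \<Delta>" "C \<in> \<Delta>" for A B C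
  proof -
    note AB = harnack_part_equiv[OF \<Delta> that(1,2)] and BC = harnack_part_equiv[OF \<Delta> that(2,3)]
      and AC = harnack_part_equiv[OF \<Delta> that(1,3)]
    show ?thesis
      unfolding harnack_dist_eq[OF AB] harnack_dist_eq[OF BC] harnack_dist_eq[OF AC]
      by (intro tanh_log_triangle harnack_omega_attained(1) harnack_omega_triangle AB BC AC)
  qed
qed

lemma harnack_dist_mbounded:
  assumes \<Delta>: "\<Delta> \<in> harnack_parts"
  shows "Metric_space.mbounded \<Delta> harnack_dist \<Delta>"
proof -
  interpret Metric_space \<Delta> harnack_dist by (rule harnack_dist_Metric_space[OF \<Delta>])
  show ?thesis
    unfolding mbounded_alt using harnack_dist_le_1 by auto
qed

section \<open>The square root of \<open>I - l* l\<close>\<close>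

lemma norm_vec_complex_sq: "(norm (v :: complex^'n))\<^sup>2 = (\<Sum>i\<in>UNIV. (cmod (v $ i))\<^sup>2)"
  by (simp add: norm_vec_def L2_set_def sum_nonneg)

text \<open>The scalar \<open>(1 - |l|\<^sup>2)\<^sup>1\<^sup>/\<^sup>2\<close>. It is the eigenvalue of \<open>(I - l\<^sup>* l)\<^sup>1\<^sup>/\<^sup>2\<close> on
  the line of \<open>l\<close>; on the orthogonal complement the eigenvalue is 1.\<close>

definition ball_defect :: "complex^'n \<Rightarrow> real" where
  "ball_defect l = sqrt (1 - (norm l)\<^sup>2)"

text \<open>The number \<open>k\<close> with \<open>(I - l\<^sup>* l)\<^sup>1\<^sup>/\<^sup>2 = I - k l\<^sup>* l\<close>, namely \<open>(1 - s) / |l|\<^sup>2\<close> for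
  \<open>s = (1 - |l|\<^sup>2)\<^sup>1\<^sup>/\<^sup>2\<close>. Written as \<open>1 / (1 + s)\<close> it makes sense also for \<open>l = 0\<close>.\<close>

definition ball_kappa :: "complex^'n \<Rightarrow> real" where
  "ball_kappa l = 1 / (1 + ball_defect l)"

context
  fixes l :: "complex^'n" and s k :: real
  assumes l: "norm l < 1"
  defines "s \<equiv> ball_defect l" and "k \<equiv> ball_kappa l"
begin

lemma ball_defect_pos: "0 < s"
  using l by (simp add: s_def ball_defect_def abs_square_less_1)

lemma ball_defect_sq: "s\<^sup>2 = 1 - (norm l)\<^sup>2"
  using l by (simp add: s_def ball_defect_def abs_square_le_1 power_le_one)

lemma ball_kappa_pos: "0 < k"
  using ball_defect_pos by (simp add: k_def ball_kappa_def flip: s_def)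

lemma ball_kappa_defect: "k + s * k = 1"
  using ball_defect_pos by (simp add: k_def ball_kappa_def field_simps flip: s_def)

lemma ball_kappa_norm: "k * (norm l)\<^sup>2 = 1 - s"
proof -
  have "k * (norm l)\<^sup>2 = k * ((1 + s) * (1 - s))"
  proof -
    have "(norm l)\<^sup>2 = (1 + s) * (1 - s)"
      using ball_defect_sq by (simp add: power2_eq_square algebra_simps)
    then show ?thesis by simp
  qed
  also have "\<dots> = (k + s * k) * (1 - s)" by (simp add: algebra_simps)
  finally show ?thesis by (simp add: ball_kappa_defect)
qed

lemma ball_kappa_quadratic: "2 * k - k\<^sup>2 * (norm l)\<^sup>2 = 1"
proof -
  have "k\<^sup>2 * (norm l)\<^sup>2 = k * (1 - s)"
    using ball_kappa_norm by (simp add: power2_eq_square mult.assoc)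
  then show ?thesis using ball_kappa_defect by (simp add: algebra_simps)
qed

text \<open>The matrix \<open>D0 = I - k l\<^sup>* l\<close> is positive definite with square \<open>M = I - l\<^sup>* l\<close>. If \<open>D\<close> is
  another positive semidefinite square root, then \<open>D\<close> commutes with \<open>D0\<close>, since \<open>D0\<close> is a linear
  combination of \<open>I\<close> and \<open>M = D\<^sup>2\<close>. Hence \<open>(D + D0) (D - D0) = 0\<close>, and \<open>D + D0\<close> is injective.\<close>

lemma matrix_sqrt_defect:
  "matrix_sqrt (mat 1 - (\<chi> i j. cnj (l $ i) * l $ j)) =
    (\<chi> i j. (if i = j then 1 else 0) - of_real k * cnj (l $ i) * l $ j)"
    (is "matrix_sqrt ?M = ?D0")
proof -
  let ?lin = "\<lambda>v. \<Sum>j\<in>UNIV. l $ j * v $ j"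
  have M_apply: "(?M *v v) $ i = v $ i - cnj (l $ i) * ?lin v" for v i
    by (simp add: matrix_vector_mult_def mat_def left_diff_distrib sum_subtractf
        if_distrib[of "\<lambda>x. x * _"] sum_distrib_left mult.assoc cong: if_cong)
  have D0_apply: "(?D0 *v v) $ i = v $ i - of_real k * cnj (l $ i) * ?lin v" for v i
    by (simp add: matrix_vector_mult_def left_diff_distrib sum_subtractf
        if_distrib[of "\<lambda>x. x * _"] sum_distrib_left mult.assoc cong: if_cong)
  have lin_self: "?lin (\<chi> i. cnj (l $ i)) = of_real ((norm l)\<^sup>2)"
    by (simp add: norm_vec_complex_sq complex_norm_square flip: of_real_power)
  have lin_D0: "?lin (?D0 *v v) = of_real s * ?lin v" for v
  proof -
    have "?lin (?D0 *v v) = ?lin v - of_real k * ?lin (\<chi> i. cnj (l $ i)) * ?lin v"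
      unfolding D0_apply
      by (simp add: right_diff_distrib sum_subtractf sum_distrib_left sum_distrib_right mult_ac)
    also have "\<dots> = (1 - of_real (k * (norm l)\<^sup>2)) * ?lin v"
      unfolding lin_self by (simp add: left_diff_distrib)
    finally show ?thesis unfolding ball_kappa_norm by simp
  qed
  have D0_sq_apply: "?D0 *v (?D0 *v v) = ?M *v v" for v
  proof (rule vec_eq_iff[THEN iffD2], rule allI)
    fix i
    have "(?D0 *v (?D0 *v v)) $ i = v $ i - of_real (k + s * k) * (cnj (l $ i) * ?lin v)"
      unfolding D0_apply[of "?D0 *v v"] unfolding lin_D0 unfolding D0_apply[of v] by (simp add: algebra_simps)
    then show "(?D0 *v (?D0 *v v)) $ i = (?M *v v) $ i"
      unfolding M_apply ball_kappa_defect by simp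
  qed
  have form: "(\<Sum>i\<in>UNIV. \<Sum>j\<in>UNIV. cnj (v $ i) * D $ i $ j * v $ j) =
      (\<Sum>i\<in>UNIV. cnj (v $ i) * (D *v v) $ i)" for v and D :: "complex^'n^'n"
    by (simp add: matrix_vector_mult_def sum_distrib_left mult.assoc)
  have D0_form: "(\<Sum>i\<in>UNIV. cnj (v $ i) * (?D0 *v v) $ i) =
      of_real ((norm v)\<^sup>2 - k * (cmod (?lin v))\<^sup>2)" for v
  proof -
    have "(\<Sum>i\<in>UNIV. cnj (v $ i) * (?D0 *v v) $ i) =
       (\<Sum>i\<in>UNIV. cnj (v $ i) * v $ i) - of_real k * cnj (?lin v) * ?lin v"
      unfolding D0_apply 
      by (simp add: right_diff_distrib sum_subtractf sum_distrib_left sum_distrib_right mult_ac)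
    also have "\<dots> = of_real ((norm v)\<^sup>2 - k * (cmod (?lin v))\<^sup>2)"
      unfolding norm_vec_complex_sq of_real_diff of_real_sum of_real_mult complex_norm_square
      by (simp add: mult_ac)
    finally show ?thesis .
  qed
  have lin_le: "(cmod (?lin v))\<^sup>2 \<le> (norm l)\<^sup>2 * (norm v)\<^sup>2" for v
  proof -
    have "cmod (?lin v) \<le> (\<Sum>j\<in>UNIV. cmod (l $ j) * cmod (v $ j))"
      by (rule order_trans[OF norm_sum]) (simp add: norm_mult)
    also have "\<dots> \<le> norm l * norm v"
      using L2_set_mult_ineq[of "\<lambda>j. cmod (l $ j)" "\<lambda>j. cmod (v $ j)" UNIV]
      by (simp add: norm_vec_def)
    finally show ?thesis
      by (metis norm_ge_zero power_mono power_mult_distrib)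
  qed
  have D0_lower: "s * (norm v)\<^sup>2 \<le> (norm v)\<^sup>2 - k * (cmod (?lin v))\<^sup>2" for v
  proof -
    have "k * (cmod (?lin v))\<^sup>2 \<le> (k * (norm l)\<^sup>2) * (norm v)\<^sup>2"
      using lin_le[of v] ball_kappa_pos by (simp add: mult.assoc)
    then show ?thesis unfolding ball_kappa_norm by (simp add: algebra_simps)
  qed
  have D0: "pos_semidef ?D0 \<and> ?D0 ** ?D0 = ?M"
  proof
    show "?D0 ** ?D0 = ?M"
      by (simp add: matrix_eq D0_sq_apply flip: matrix_vector_mul_assoc)
    show "pos_semidef ?D0"
      unfolding pos_semidef_def form D0_form
    proof
      fix v :: "complex^'n"
      have "0 \<le> s * (norm v)\<^sup>2" using ball_defect_pos by simp
      then show "complex_of_real ((norm v)\<^sup>2 - k * (cmod (?lin v))\<^sup>2) \<in> \<real>\<^sub>\<ge>\<^sub>0"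
        using D0_lower[of v] by (subst nonneg_Reals_of_real_iff) linarith
    qed
  qed
  have "D = ?D0" if D: "pos_semidef D" "D ** D = ?M" for D
    unfolding matrix_eq
  proof
    fix v
    have DD: "D *v (D *v v) = ?M *v v" for v using D(2) by (simp add: matrix_vector_mul_assoc)
    \<comment> \<open>As a polynomial in \<open>D\<close>, the matrix \<open>D0\<close> commutes with \<open>D\<close>.\<close>
    have D0_via_D: "?D0 *v v = (1 - k) *\<^sub>R v + k *\<^sub>R (D *v (D *v v))" for v
      unfolding DD vec_eq_iff vector_add_component vector_scaleR_component D0_apply M_apply
      by (simp add: scaleR_conv_of_real algebra_simps)
    have comm: "D *v (?D0 *v v) = ?D0 *v (D *v v)" for v
      unfolding D0_via_D by (simp add: matrix_vector_right_distrib linear_scale[OF matrix_vector_mul_linear])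
    define u where "u = D *v v - ?D0 *v v"
    have "D *v u + ?D0 *v u = 0"
      unfolding u_def
      by (simp add: matrix_vector_mult_diff_distrib comm D0_sq_apply DD)
    then have "D *v u = - (?D0 *v u)" by (simp add: eq_neg_iff_add_eq_0)
    then have "(\<Sum>i\<in>UNIV. cnj (u $ i) * (D *v u) $ i) = - of_real ((norm u)\<^sup>2 - k * (cmod (?lin u))\<^sup>2)"
      by (simp only: D0_form[symmetric]) (simp add: sum_negf)
    moreover have "(\<Sum>i\<in>UNIV. cnj (u $ i) * (D *v u) $ i) \<in> \<real>\<^sub>\<ge>\<^sub>0"
      using D(1) unfolding pos_semidef_def form by blast
    ultimately have "(norm u)\<^sup>2 - k * (cmod (?lin u))\<^sup>2 \<le> 0"
      by (simp add: complex_nonneg_Reals_iff)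
    with D0_lower[of u] have "s * (norm u)\<^sup>2 \<le> 0" by linarith
    then have "u = 0" using ball_defect_pos by (simp add: mult_le_0_iff)
    then show "D *v v = ?D0 *v v" by (simp add: u_def)
  qed
  then show ?thesis
    unfolding matrix_sqrt_def using D0 by (intro the_equality) auto
qed

end

section \<open>Inverting \<open>I - Z\<close> for a strict contraction \<open>Z\<close>\<close>

primrec op_power :: "('h::chilbert_space \<Rightarrow>\<^sub>L 'h) \<Rightarrow> nat \<Rightarrow> ('h \<Rightarrow>\<^sub>L 'h)" where
  "op_power Z 0 = id_blinfun"
| "op_power Z (Suc n) = Z o\<^sub>L op_power Z n"

lemma norm_op_power: "norm (op_power Z n) \<le> norm Z ^ n"
proof (induction n)
  case 0
  show ?case by (rule norm_blinfun_bound) auto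
next
  case (Suc n)
  have "norm (op_power Z (Suc n)) \<le> norm Z * norm (op_power Z n)"
    by (simp add: norm_blinfun_compose)
  then show ?case using Suc mult_left_mono[OF Suc, of "norm Z"] by simp
qed

lemma clinear_op_power: "complex_linear_op Z \<Longrightarrow> complex_linear_op (op_power Z n)"
  by (induction n) (auto intro: clinear_intros)

lemma op_power_commute: "op_power Z n (Z x) = Z (op_power Z n x)"
  by (induction n) auto

text \<open>The Neumann series of \<open>(I - Z)\<^sup>-\<^sup>1\<close>.\<close>

definition resolvent :: "('h::chilbert_space \<Rightarrow>\<^sub>L 'h) \<Rightarrow> ('h \<Rightarrow>\<^sub>L 'h)" where
  "resolvent Z = suminf (op_power Z)"

lemma resolvent_sums:
  assumes "norm Z < 1" shows "op_power Z sums resolvent Z"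
proof -
  have "summable (\<lambda>k. norm Z ^ k)" using assms by (simp add: summable_geometric)
  then have "summable (op_power Z)"
    by (rule summable_comparison_test'[of _ 0]) (rule norm_op_power)
  then show ?thesis unfolding resolvent_def by (rule summable_sums)
qed

lemma
  assumes Z: "norm Z < 1"
  shows resolvent_right: "resolvent Z x - Z (resolvent Z x) = x"
    and resolvent_left: "resolvent Z (x - Z x) = x"
proof -
  have "(\<lambda>k. op_power Z k x) sums resolvent Z x" for x
    by (rule bounded_linear.sums[OF _ resolvent_sums[OF Z]]) (rule blinfun.bounded_linear_left)
  note S = this
  have ZS: "(\<lambda>k. op_power Z (Suc k) x) sums Z (resolvent Z x)"
    using bounded_linear.sums[OF blinfun.bounded_linear_right S[of x], of Z] by simp
  then have "op_power Z 0 x + Z (resolvent Z x) = resolvent Z x"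
    using sums_unique2[OF S[of x] sums_Suc[OF ZS]] by (simp add: add.commute)
  then show 1: "resolvent Z x - Z (resolvent Z x) = x"
    by (simp add: algebra_simps)
  have "(\<lambda>k. op_power Z (Suc k) x) sums resolvent Z (Z x)"
    using S[of "Z x"] by (simp add: op_power_commute)
  then have "resolvent Z (Z x) = Z (resolvent Z x)"
    using ZS by (rule sums_unique2)
  then show "resolvent Z (x - Z x) = x"
    using 1 by (simp add: blinfun.diff_right)
qed

lemma clinear_resolvent:
  assumes "norm Z < 1" "complex_linear_op Z" shows "complex_linear_op (resolvent Z)"
proof -
  have "(\<lambda>n. \<Sum>k<n. op_power Z k) \<longlonglongrightarrow> resolvent Z"
    using resolvent_sums[OF assms(1)] by (simp add: sums_def)
  then show ?thesis by (rule clinear_limit) (intro clinear_intros clinear_op_power assms(2))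
qed

lemma inv_op_resolvent:
  assumes "norm Z < 1" shows "inv_op (id_blinfun - Z) = resolvent Z"
  unfolding inv_op_def
proof (rule the_equality)
  show "resolvent Z o\<^sub>L (id_blinfun - Z) = id_blinfun \<and> (id_blinfun - Z) o\<^sub>L resolvent Z = id_blinfun"
    using resolvent_left[OF assms] resolvent_right[OF assms]
    by (auto intro!: blinfun_eqI simp: blinfun.diff_left)
  show "S = resolvent Z" if "S o\<^sub>L (id_blinfun - Z) = id_blinfun \<and> (id_blinfun - Z) o\<^sub>L S = id_blinfun" for S
  proof (rule blinfun_eqI)
    fix x
    have "((id_blinfun - Z) o\<^sub>L S) x = id_blinfun x"
      using that by simp
    then have "S x - Z (S x) = x" by (simp add: blinfun.diff_left)
    then show "S x = resolvent Z x" using resolvent_left[OF assms, of "S x"] by simp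
  qed
qed

lemma norm_resolvent:
  assumes "norm Z \<le> r" "r < 1" shows "norm (resolvent Z) \<le> 1 / (1 - r)"
proof (rule norm_blinfun_bound)
  have r: "0 \<le> r" using assms(1) norm_ge_zero order_trans by blast
  show "0 \<le> 1 / (1 - r)" using assms by simp
  fix x
  have "norm (Z (resolvent Z x)) \<le> r * norm (resolvent Z x)"
    using norm_blinfun[of Z "resolvent Z x"] assms(1)
    by (meson mult_right_mono norm_ge_zero order_trans)
  moreover have "norm (resolvent Z x) \<le> norm x + norm (Z (resolvent Z x))"
    using resolvent_right[of Z x] assms by (metis le_less_trans norm_triangle_ineq diff_add_cancel)
  ultimately have "(1 - r) * norm (resolvent Z x) \<le> norm x" by (simp add: algebra_simps)
  then show "norm (resolvent Z x) \<le> 1 / (1 - r) * norm x"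
    using assms by (simp add: field_simps)
qed

text \<open>The remainder of the Neumann series is \<open>Z\<^sup>n (I - Z)\<^sup>-\<^sup>1\<close>. The bound depends on \<open>r\<close> only, so the
  approximation is uniform over all \<open>Z\<close> of norm at most \<open>r\<close>.\<close>

lemma resolvent_tail:
  assumes "norm Z \<le> r" "r < 1"
  shows "norm (resolvent Z - (\<Sum>k<n. op_power Z k)) \<le> r ^ n / (1 - r)"
proof -
  have Z1: "norm Z < 1" and r: "0 \<le> r" using assms norm_ge_zero[of Z] by linarith+
  have "resolvent Z - (\<Sum>k<n. op_power Z k) = op_power Z n o\<^sub>L resolvent Z"
  proof (induction n)
    case 0
    show ?case by (rule blinfun_eqI) simp
  next
    case (Suc n)
    have "resolvent Z - (\<Sum>k<Suc n. op_power Z k) = (op_power Z n o\<^sub>L resolvent Z) - op_power Z n"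
      using Suc by (simp add: algebra_simps)
    also have "\<dots> = op_power Z (Suc n) o\<^sub>L resolvent Z"
    proof (rule blinfun_eqI)
      fix x
      have "op_power Z n (resolvent Z x) - op_power Z n x = op_power Z n (resolvent Z x - x)"
        by (simp add: blinfun.diff_right)
      also have "resolvent Z x - x = Z (resolvent Z x)"
        using resolvent_right[OF Z1, of x] by (metis diff_diff_eq2 add_diff_cancel_left')
      finally show "((op_power Z n o\<^sub>L resolvent Z) - op_power Z n) x = (op_power Z (Suc n) o\<^sub>L resolvent Z) x"
        by (simp add: blinfun.diff_left op_power_commute)
    qed
    finally show ?case .
  qed
  then have "norm (resolvent Z - (\<Sum>k<n. op_power Z k)) \<le> norm (op_power Z n) * norm (resolvent Z)"
    by (simp add: norm_blinfun_compose)
  also have "\<dots> \<le> r ^ n * (1 / (1 - r))"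
    using norm_op_power[of Z n] power_mono[OF assms(1), of n] norm_resolvent[OF assms] r assms
    by (intro mult_mono) auto
  finally show ?thesis by simp
qed

section \<open>Multiplying a row by a unitary matrix\<close>

lemma clinear_row_mult: "(\<And>i. complex_linear_op (X i)) \<Longrightarrow> complex_linear_op (row_mult X U j)"
  unfolding row_mult_def by (intro clinear_intros)

lemma row_mult_apply: "row_mult X U j x = (\<Sum>i\<in>UNIV. (U $ i $ j) *\<^sub>C X i x)"
  by (simp add: row_mult_def blinfun.sum_left)

lemma row_mult_row_mult:
  "row_mult (row_mult X U) V = row_mult X (U ** V)"
proof
  fix j
  show "row_mult (row_mult X U) V j = row_mult X (U ** V) j"
  proof (rule blinfun_eqI)
    fix x
    have "row_mult (row_mult X U) V j x = (\<Sum>k\<in>UNIV. \<Sum>i\<in>UNIV. (V $ k $ j * U $ i $ k) *\<^sub>C X i x)"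
      by (simp add: row_mult_apply cvs.scale_sum_right scaleC_scaleC)
    also have "\<dots> = (\<Sum>i\<in>UNIV. \<Sum>k\<in>UNIV. (V $ k $ j * U $ i $ k) *\<^sub>C X i x)"
      by (rule sum.swap)
    also have "\<dots> = row_mult X (U ** V) j x"
      by (simp add: row_mult_apply matrix_matrix_mult_def cvs.scale_sum_left mult.commute)
    finally show "row_mult (row_mult X U) V j x = row_mult X (U ** V) j x" .
  qed
qed

lemma row_mult_mat_1 [simp]: "row_mult X (mat 1) = X"
proof
  show "row_mult X (mat 1) j = X j" for j
    by (rule blinfun_eqI)
      (simp add: row_mult_apply mat_def if_distrib[of "\<lambda>c. c *\<^sub>C _"] scaleC_one cong: if_cong)
qed

lemma adj_row_mult:
  assumes X: "\<And>i. complex_linear_op (X i)"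
  shows "adj_op (row_mult X U j) x = (\<Sum>i\<in>UNIV. cnj (U $ i $ j) *\<^sub>C adj_op (X i) x)"
  by (rule adj_op_eqI) (auto intro: clinear_row_mult X simp: row_mult_apply cinner_sum_left cinner_sum_right
      cinner_scaleC_left cinner_scaleC_right cinner_adj_op X)

lemma unitary_row_sum:
  assumes "unitary_matrix U"
  shows "(\<Sum>j\<in>UNIV. U $ i $ j * cnj (U $ k $ j)) = (if i = k then 1 else 0)"
proof -
  have "(U ** conj_transpose U) $ i $ k = (mat 1 :: complex^'a^'a) $ i $ k"
    using assms by (simp add: unitary_matrix_def)
  then show ?thesis by (simp add: matrix_matrix_mult_def conj_transpose_def mat_def)
qed

lemma unitary_col_sum:
  assumes "unitary_matrix U"
  shows "(\<Sum>i\<in>UNIV. cnj (U $ i $ j) * U $ i $ k) = (if j = k then 1 else 0)"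
proof -
  have "(conj_transpose U ** U) $ j $ k = (mat 1 :: complex^'a^'a) $ j $ k"
    using assms by (simp add: unitary_matrix_def)
  then show ?thesis by (simp add: matrix_matrix_mult_def conj_transpose_def mat_def)
qed

lemma adj_row_mult_unitary:
  assumes X: "\<And>i. complex_linear_op (X i)" and U: "unitary_matrix U"
  shows "(\<Sum>j\<in>UNIV. (norm (adj_op (row_mult X U j) x))\<^sup>2) = (\<Sum>i\<in>UNIV. (norm (adj_op (X i) x))\<^sup>2)"
proof -
  define h where "h i = adj_op (X i) x" for i
  have "complex_of_real ((norm (adj_op (row_mult X U j) x))\<^sup>2) =
    (\<Sum>i\<in>UNIV. \<Sum>k\<in>UNIV. (U $ i $ j * cnj (U $ k $ j)) * cinner (h i) (h k))" for j
    unfolding cinner_self[symmetric] adj_row_mult[OF X] cinner_sum_left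
    unfolding cinner_sum_right cinner_scaleC_left cinner_scaleC_right
    by (simp add: h_def mult_ac)
  then have "complex_of_real (\<Sum>j\<in>UNIV. (norm (adj_op (row_mult X U j) x))\<^sup>2) =
    (\<Sum>j\<in>UNIV. \<Sum>i\<in>UNIV. \<Sum>k\<in>UNIV. (U $ i $ j * cnj (U $ k $ j)) * cinner (h i) (h k))"
    unfolding of_real_sum by simp
  also have "\<dots> = (\<Sum>i\<in>UNIV. \<Sum>k\<in>UNIV. \<Sum>j\<in>UNIV. (U $ i $ j * cnj (U $ k $ j)) * cinner (h i) (h k))"
    by (subst sum.swap, rule sum.cong[OF refl], rule sum.swap)
  also have "\<dots> = (\<Sum>i\<in>UNIV. \<Sum>k\<in>UNIV. (if i = k then 1 else 0) * cinner (h i) (h k))"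
    by (simp add: unitary_row_sum[OF U] flip: sum_distrib_right)
  also have "\<dots> = of_real (\<Sum>i\<in>UNIV. (norm (h i))\<^sup>2)"
    by (simp add: if_distrib[of "\<lambda>c. c * _"] cinner_self cong: if_cong)
  finally show ?thesis unfolding h_def of_real_eq_iff .
qed

lemma row_mult_unitary_cball:
  "X \<in> nc_cball \<Longrightarrow> unitary_matrix U \<Longrightarrow> row_mult X U \<in> nc_cball"
  by (simp add: nc_cball_iff clinear_row_mult adj_row_mult_unitary)

lemma row_mult_unitary_ball:
  "X \<in> nc_ball \<Longrightarrow> unitary_matrix U \<Longrightarrow> row_mult X U \<in> nc_ball"
  by (simp add: nc_ball_iff clinear_row_mult adj_row_mult_unitary)

lemma conj_transpose_conj_transpose [simp]: "conj_transpose (conj_transpose U) = U"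
  by (simp add: conj_transpose_def vec_eq_iff)

lemma unitary_conj_transpose: "unitary_matrix U \<Longrightarrow> unitary_matrix (conj_transpose U)"
  by (simp add: unitary_matrix_def)

section \<open>The involutions of the closed ball\<close>

text \<open>The operator \<open>X l\<^sup>*\<close>; the involution contains the inverse of \<open>I - X l\<^sup>*\<close>.\<close>

definition row_pair :: "complex^'n \<Rightarrow> ('n::finite, 'h::chilbert_space) op_tuple \<Rightarrow> 'h \<Rightarrow>\<^sub>L 'h" where
  "row_pair l X = (\<Sum>i\<in>UNIV. scaleC_op (cnj (l $ i)) (X i))"

lemma row_pair_apply: "row_pair l X x = (\<Sum>i\<in>UNIV. cnj (l $ i) *\<^sub>C X i x)"
  by (simp add: row_pair_def blinfun.sum_left)

lemma clinear_row_pair: "X \<in> nc_cball \<Longrightarrow> complex_linear_op (row_pair l X)"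
  unfolding row_pair_def by (intro clinear_intros nc_cball_cl)

lemma norm_row_pair:
  assumes X: "X \<in> nc_cball" shows "norm (row_pair l X) \<le> norm l"
proof (rule norm_blinfun_bound)
  fix x
  have "row_pair l X x = (\<Sum>i\<in>UNIV. X i (cnj (l $ i) *\<^sub>C x))"
    by (simp add: row_pair_apply clinear_apply[OF nc_cball_cl[OF X]])
  then have "norm (row_pair l X x) \<le> sqrt (\<Sum>i\<in>UNIV. (norm (cnj (l $ i) *\<^sub>C x))\<^sup>2)"
    using nc_cball_row_apply[OF X, of "\<lambda>i. cnj (l $ i) *\<^sub>C x"] by simp
  also have "(\<Sum>i\<in>UNIV. (norm (cnj (l $ i) *\<^sub>C x))\<^sup>2) = (norm l * norm x)\<^sup>2"
    by (simp add: norm_scaleC power_mult_distrib norm_vec_complex_sq sum_distrib_right)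
  finally show "norm (row_pair l X x) \<le> norm l * norm x" by simp
qed simp

lemma scaleC_scaleR_commute: "c *\<^sub>C r *\<^sub>R x = r *\<^sub>R c *\<^sub>C (x :: 'h::chilbert_space)"
  by (simp add: scaleR_scaleC scaleC_scaleC mult.commute)

context
  fixes l :: "complex^'n::finite" and s k :: real and X :: "('n, 'h::chilbert_space) op_tuple"
    and Z R :: "'h \<Rightarrow>\<^sub>L 'h"
  assumes l: "norm l < 1" and X: "X \<in> nc_cball"
  defines "s \<equiv> ball_defect l" and "k \<equiv> ball_kappa l"
    and "Z \<equiv> row_pair l X" and "R \<equiv> resolvent (row_pair l X)"
begin

lemma norm_row_pair_less_1: "norm Z < 1"
  using norm_row_pair[OF X, of l] l by (simp add: Z_def)

lemma clinear_row_pair_closed_ball: "complex_linear_op Z" unfolding Z_def by (rule clinear_row_pair[OF X])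
lemma clinear_resolvent_row_pair: "complex_linear_op R"
  using clinear_resolvent[OF norm_row_pair_less_1 clinear_row_pair_closed_ball] by (simp add: R_def Z_def)

lemma resolvent_row_pair_left: "R (x - Z x) = x"
  using resolvent_left[OF norm_row_pair_less_1] by (simp add: R_def Z_def)

text \<open>The definition with \<open>(I - l\<^sup>* l)\<^sup>1\<^sup>/\<^sup>2 = I - k l\<^sup>* l\<close> inserted.\<close>

lemma ball_involution_apply_unsimplified:
  "ball_involution l X j x = (l $ j) *\<^sub>C x - s *\<^sub>R R (X j x - (of_real k * l $ j) *\<^sub>C Z x)"
proof -
  have D: "row_mult X (matrix_sqrt (mat 1 - (\<chi> i j. cnj (l $ i) * l $ j))) j x =
      X j x - (of_real k * l $ j) *\<^sub>C Z x"
    unfolding matrix_sqrt_defect[OF l] row_mult_apply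
    by (simp add: cvs.scale_left_diff_distrib sum_subtractf if_distrib[of "\<lambda>c. c *\<^sub>C _"]
        scaleC_one Z_def row_pair_apply cvs.scale_sum_right scaleC_scaleC mult_ac k_def cong: if_cong)
  have inv: "inv_op (id_blinfun - (\<Sum>i\<in>UNIV. scaleC_op (cnj (l $ i)) (X i))) = R"
    using inv_op_resolvent[OF norm_row_pair_less_1] by (simp add: Z_def R_def row_pair_def)
  show ?thesis
    by (simp add: ball_involution_def blinfun.diff_left blinfun.scaleR_left inv D s_def ball_defect_def)
qed

text \<open>Both summands are brought under the common left factor \<open>R = (I - Z)\<^sup>-\<^sup>1\<close>: the j-th entry is
  \<open>R (l\<^sub>j (I - k Z) - s X\<^sub>j)\<close>. The involution property and the
  inclusion of the balls are computed from this form.\<close>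

lemma ball_involution_apply:
  "ball_involution l X j x = R ((l $ j) *\<^sub>C (x - k *\<^sub>R Z x) - s *\<^sub>R X j x)"
proof -
  note ball_involution_apply_unsimplified
  also have "(l $ j) *\<^sub>C x = R ((l $ j) *\<^sub>C (x - Z x))"
    by (simp add: clinear_apply[OF clinear_resolvent_row_pair] resolvent_row_pair_left)
  also have "R ((l $ j) *\<^sub>C (x - Z x)) - s *\<^sub>R R (X j x - (of_real k * l $ j) *\<^sub>C Z x)
      = R ((l $ j) *\<^sub>C (x - Z x) - s *\<^sub>R (X j x - (of_real k * l $ j) *\<^sub>C Z x))"
    by (simp add: blinfun.diff_right blinfun.scaleR_right)
  also have "(l $ j) *\<^sub>C (x - Z x) - s *\<^sub>R (X j x - (of_real k * l $ j) *\<^sub>C Z x)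
      = (l $ j) *\<^sub>C (x - (1 - s * k) *\<^sub>R Z x) - s *\<^sub>R X j x"
    by (simp add: scaleR_scaleC cvs.scale_right_diff_distrib cvs.scale_left_diff_distrib scaleC_scaleC
        scaleC_one algebra_simps)
  also have "1 - s * k = k" using ball_kappa_defect[OF l] by (simp add: s_def k_def)
  finally show ?thesis .
qed

lemma clinear_ball_involution: "complex_linear_op (ball_involution l X j)"
  unfolding complex_linear_op_def ball_involution_apply
  by (simp add: clinear_apply[OF clinear_resolvent_row_pair, symmetric] clinear_apply[OF clinear_row_pair_closed_ball]
     clinear_apply[OF nc_cball_cl[OF X]] cvs.scale_right_diff_distrib scaleR_scaleC
     scaleC_scaleC mult.commute mult.left_commute)

text \<open>In other words \<open>I - Y l\<^sup>* = (1 - |l|\<^sup>2) (I - X l\<^sup>*)\<^sup>-\<^sup>1\<close> for the image \<open>Y\<close> of \<open>X\<close>. This makes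
  the square of the map computable.\<close>

lemma row_pair_involution:
  "row_pair l (ball_involution l X) x = x - s\<^sup>2 *\<^sub>R R x"
proof -
  have "complex_of_real ((norm l)\<^sup>2) = (\<Sum>j\<in>UNIV. l $ j * cnj (l $ j))"
    by (simp add: norm_vec_complex_sq complex_norm_square del: of_real_power)
  then have norm_l: "(\<Sum>j\<in>UNIV. l $ j * cnj (l $ j)) = (complex_of_real (norm l))\<^sup>2"
    by simp
  have "row_pair l (ball_involution l X) x = R (\<Sum>j\<in>UNIV. cnj (l $ j) *\<^sub>C ((l $ j) *\<^sub>C (x - k *\<^sub>R Z x) - s *\<^sub>R X j x))"
    by (simp add: row_pair_apply ball_involution_apply blinfun.sum_right
        clinear_apply[OF clinear_resolvent_row_pair])
  also have "(\<Sum>j\<in>UNIV. cnj (l $ j) *\<^sub>C ((l $ j) *\<^sub>C (x - k *\<^sub>R Z x) - s *\<^sub>R X j x))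
      = (norm l)\<^sup>2 *\<^sub>R (x - k *\<^sub>R Z x) - s *\<^sub>R Z x"
    unfolding cvs.scale_right_diff_distrib[of _ "(l $ _) *\<^sub>C (x - k *\<^sub>R Z x)"] sum_subtractf scaleC_scaleC scaleC_scaleR_commute
    by (simp add: norm_l Z_def row_pair_apply scaleR_scaleC cvs.scale_sum_right scaleC_scaleC mult.commute
        flip: cvs.scale_sum_left)
  also have "\<dots> = (x - Z x) - (s\<^sup>2 *\<^sub>R x)"
  proof -
    have 1: "(norm l)\<^sup>2 * k = 1 - s" and 2: "(norm l)\<^sup>2 = 1 - s\<^sup>2"
      using ball_kappa_norm[OF l] ball_defect_sq[OF l] by (simp_all add: k_def s_def mult.commute)
    show ?thesis
      unfolding scaleR_right_diff_distrib[of "(norm l)\<^sup>2"] scaleR_scaleR 1 unfolding 2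
      by (simp add: algebra_simps)
  qed
  also have "R \<dots> = x - s\<^sup>2 *\<^sub>R R x" by (simp add: blinfun.diff_right[of R "x - Z x"] resolvent_row_pair_left blinfun.scaleR_right)
  finally show ?thesis .
qed

text \<open>This is the identity \<open>I - Y Y\<^sup>* = s\<^sup>2 R (I - X X\<^sup>*) R\<^sup>*\<close> for the image \<open>Y\<close> of \<open>X\<close>, written as a
  quadratic form with \<open>w = R\<^sup>* x\<close>. It shows that the closed ball is mapped into itself. The second
  part says that \<open>R\<^sup>*\<close> is bounded below, which gives the strict inequality for the open ball.\<close>

lemma involution_adj_identity:
  assumes w_def: "w = adj_op R x" and h_def: "\<And>j. h j = adj_op (X j) w"
  shows "(\<Sum>j\<in>UNIV. (norm (adj_op (ball_involution l X j) x))\<^sup>2)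
     = (norm x)\<^sup>2 - s\<^sup>2 * ((norm w)\<^sup>2 - (\<Sum>j\<in>UNIV. (norm (h j))\<^sup>2))"
    and "norm x \<le> 2 * norm w"
proof -
  define z where "z = (\<Sum>j\<in>UNIV. (l $ j) *\<^sub>C h j)"
  have z: "cinner z y = cinner w (Z y)" for y
    by (simp add: z_def h_def Z_def row_pair_apply cinner_sum_left cinner_sum_right cinner_scaleC_left
        cinner_scaleC_right cinner_adj_op[OF nc_cball_cl[OF X]])
  have x: "x = w - z"
    by (rule cinner_eqI) (simp add: cinner_diff_left z w_def cinner_adj_op[OF clinear_resolvent_row_pair] resolvent_row_pair_left
      flip: cinner_diff_right blinfun.diff_right)
  have "(norm z)\<^sup>2 \<le> norm w * norm z"
  proof -
    have "(norm z)\<^sup>2 = Re (cinner w (Z z))" by (simp add: z flip: Re_cinner_self)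
    also have "\<dots> \<le> norm w * norm (Z z)"
      using cinner_Cauchy_Schwarz complex_Re_le_cmod order_trans by blast
    also have "\<dots> \<le> norm w * (1 * norm z)"
      using norm_row_pair_less_1 norm_blinfun[of Z z] mult_right_mono[of "norm Z" 1 "norm z"]
      by (intro mult_left_mono) auto
    finally show ?thesis by simp
  qed
  then have "norm z \<le> norm w" by (cases "z = 0") (auto simp: power2_eq_square)
  then show "norm x \<le> 2 * norm w" using norm_triangle_ineq4[of w z] x by simp
  define u where "u = w - k *\<^sub>R z"
  have adj: "adj_op (ball_involution l X j) x = cnj (l $ j) *\<^sub>C u - s *\<^sub>R h j" for j
  proof (rule adj_op_eqI[OF clinear_ball_involution])
    fix y
    have "cinner x (ball_involution l X j y) = cinner w ((l $ j) *\<^sub>C (y - k *\<^sub>R Z y) - s *\<^sub>R X j y)"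
      by (simp add: ball_involution_apply w_def cinner_adj_op[OF clinear_resolvent_row_pair])
    then show "cinner (cnj (l $ j) *\<^sub>C u - s *\<^sub>R h j) y = cinner x (ball_involution l X j y)"
      by (simp add: u_def cinner_diff_left cinner_diff_right cinner_scaleC_left cinner_scaleC_right
          cinner_scaleR_left cinner_scaleR_right z h_def cinner_adj_op[OF nc_cball_cl[OF X]])
  qed
  have uz: "(\<Sum>j\<in>UNIV. Re (cinner (cnj (l $ j) *\<^sub>C u) (s *\<^sub>R h j))) = s * Re (cinner u z)"
    by (simp add: z_def cinner_sum_right cinner_scaleC_left cinner_scaleC_right cinner_scaleR_right
        sum_distrib_left)
  have "(\<Sum>j\<in>UNIV. (norm (adj_op (ball_involution l X j) x))\<^sup>2)
      = (\<Sum>j\<in>UNIV. (cmod (l $ j))\<^sup>2 * (norm u)\<^sup>2) - 2 * (s * Re (cinner u z)) + s\<^sup>2 * (\<Sum>j\<in>UNIV. (norm (h j))\<^sup>2)"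
    unfolding adj norm_diff_squared sum.distrib sum_subtractf uz[symmetric]
    by (simp add: sum_distrib_left norm_scaleC power_mult_distrib)
  also have "(\<Sum>j\<in>UNIV. (cmod (l $ j))\<^sup>2 * (norm u)\<^sup>2) = (norm l)\<^sup>2 * (norm u)\<^sup>2"
    by (simp add: norm_vec_complex_sq sum_distrib_right)
  also have "(norm u)\<^sup>2 = (norm w)\<^sup>2 - 2 * k * Re (cinner w z) + k\<^sup>2 * (norm z)\<^sup>2"
    by (simp add: u_def norm_diff_squared cinner_scaleR_right power_mult_distrib)
  also have "Re (cinner u z) = Re (cinner w z) - k * (norm z)\<^sup>2"
    by (simp add: u_def cinner_diff_left cinner_scaleR_left Re_cinner_self)
  finally have main: "(\<Sum>j\<in>UNIV. (norm (adj_op (ball_involution l X j) x))\<^sup>2)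
      = (norm l)\<^sup>2 * ((norm w)\<^sup>2 - 2 * k * Re (cinner w z) + k\<^sup>2 * (norm z)\<^sup>2)
        - 2 * (s * (Re (cinner w z) - k * (norm z)\<^sup>2)) + s\<^sup>2 * (\<Sum>j\<in>UNIV. (norm (h j))\<^sup>2)" .
  have e1: "(norm l)\<^sup>2 * k = 1 - s" and e2: "(norm l)\<^sup>2 = 1 - s\<^sup>2" and e3: "k\<^sup>2 * (norm l)\<^sup>2 = 2 * k - 1"
    and e4: "s * k = 1 - k"
    using ball_kappa_norm[OF l] ball_defect_sq[OF l] ball_kappa_quadratic[OF l] ball_kappa_defect[OF l]
    by (simp_all add: k_def s_def mult.commute)
  have "(norm l)\<^sup>2 * ((norm w)\<^sup>2 - 2 * k * Re (cinner w z) + k\<^sup>2 * (norm z)\<^sup>2)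
      = (1 - s\<^sup>2) * (norm w)\<^sup>2 - 2 * ((norm l)\<^sup>2 * k) * Re (cinner w z) + (k\<^sup>2 * (norm l)\<^sup>2) * (norm z)\<^sup>2"
    unfolding e2[symmetric] by (simp add: algebra_simps)
  moreover have "2 * (s * (Re (cinner w z) - k * (norm z)\<^sup>2)) = 2 * s * Re (cinner w z) - 2 * (s * k) * (norm z)\<^sup>2"
    by (simp add: algebra_simps)
  moreover have "(norm x)\<^sup>2 = (norm w)\<^sup>2 - 2 * Re (cinner w z) + (norm z)\<^sup>2"
    unfolding x by (rule norm_diff_squared)
  ultimately show "(\<Sum>j\<in>UNIV. (norm (adj_op (ball_involution l X j) x))\<^sup>2)
     = (norm x)\<^sup>2 - s\<^sup>2 * ((norm w)\<^sup>2 - (\<Sum>j\<in>UNIV. (norm (h j))\<^sup>2))"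
    unfolding main e1 e3 e4 by (simp add: algebra_simps)
qed

lemma ball_involution_cball: "ball_involution l X \<in> nc_cball"
  unfolding nc_cball_iff
proof (intro conjI allI clinear_ball_involution)
  fix x
  have "(\<Sum>j\<in>UNIV. (norm (adj_op (X j) (adj_op R x)))\<^sup>2) \<le> (norm (adj_op R x))\<^sup>2"
    using X unfolding nc_cball_iff by blast
  then show "(\<Sum>j\<in>UNIV. (norm (adj_op (ball_involution l X j) x))\<^sup>2) \<le> (norm x)\<^sup>2"
    unfolding involution_adj_identity(1)[OF refl refl] by simp
qed

end

lemma ball_involution_ball:
  assumes l: "norm l < 1" and X: "X \<in> nc_ball"
  shows "ball_involution l X \<in> nc_ball"
proof -
  note Xc = nc_ball_imp_cball[OF X]
  obtain c where c: "0 \<le> c" "c < 1" and le: "\<And>x. (\<Sum>i\<in>UNIV. (norm (adj_op (X i) x))\<^sup>2) \<le> c * (norm x)\<^sup>2"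
    using X unfolding nc_ball_iff by blast
  define s where "s = ball_defect l"
  have s: "0 < s" "s\<^sup>2 \<le> 1" using ball_defect_pos[OF l] ball_defect_sq[OF l] by (simp_all add: s_def)
  \<comment> \<open>The identity subtracts at least \<open>s\<^sup>2 (1 - c) |w|\<^sup>2\<close> from \<open>|x|\<^sup>2\<close>, and \<open>|x|\<^sup>2 \<le> 4 |w|\<^sup>2\<close>.\<close>
  define d where "d = 1 - s\<^sup>2 * (1 - c) / 4"
  have "s\<^sup>2 * (1 - c) > 0" "s\<^sup>2 * (1 - c) \<le> 1" using s c by (auto simp: mult_le_one)
  then have d: "0 \<le> d" "d < 1" by (auto simp: d_def)
  have "(\<Sum>j\<in>UNIV. (norm (adj_op (ball_involution l X j) x))\<^sup>2) \<le> d * (norm x)\<^sup>2" for x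
  proof -
    define w where "w = adj_op (resolvent (row_pair l X)) x"
    have x: "norm x \<le> 2 * norm w" unfolding w_def
      by (rule involution_adj_identity(2)[OF l Xc refl refl])
    have "(norm x)\<^sup>2 \<le> 4 * (norm w)\<^sup>2"
      using power_mono[OF x, of 2] by (simp add: power_mult_distrib)
    then have "s\<^sup>2 * (1 - c) / 4 * (norm x)\<^sup>2 \<le> s\<^sup>2 * (1 - c) / 4 * (4 * (norm w)\<^sup>2)"
      using c by (intro mult_left_mono) auto
    also have "\<dots> = s\<^sup>2 * ((norm w)\<^sup>2 - c * (norm w)\<^sup>2)" by (simp add: field_simps)
    also have "\<dots> \<le> s\<^sup>2 * ((norm w)\<^sup>2 - (\<Sum>j\<in>UNIV. (norm (adj_op (X j) w))\<^sup>2))"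
      using le[of w] by (intro mult_left_mono) auto
    finally show ?thesis
      unfolding involution_adj_identity(1)[OF l Xc refl refl] d_def
      by (simp add: s_def w_def left_diff_distrib)
  qed
  then show ?thesis
    unfolding nc_ball_iff using d clinear_ball_involution[OF l Xc] by blast
qed

lemma ball_involution_involution:
  assumes l: "norm l < 1" and X: "X \<in> nc_cball"
  shows "ball_involution l (ball_involution l X) = X"
proof
  fix j
  define Y where "Y = ball_involution l X"
  define s where "s = ball_defect l"
  define k where "k = ball_kappa l"
  define Z where "Z = row_pair l X"
  define R where "R = resolvent Z"
  define R' where "R' = resolvent (row_pair l Y)"
  have Y: "Y \<in> nc_cball" unfolding Y_def by (rule ball_involution_cball[OF l X])
  have clR: "complex_linear_op R" unfolding R_def Z_def by (rule clinear_resolvent_row_pair[OF l X])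
  have RZ: "R (x - Z x) = x" for x unfolding R_def Z_def by (rule resolvent_row_pair_left[OF l X])
  have Z': "row_pair l Y x = x - s\<^sup>2 *\<^sub>R R x" for x
    unfolding Y_def s_def R_def Z_def by (rule row_pair_involution[OF l X])
  have Yj: "Y j x = R ((l $ j) *\<^sub>C (x - k *\<^sub>R Z x) - s *\<^sub>R X j x)" for x
    unfolding Y_def s_def k_def R_def Z_def by (rule ball_involution_apply[OF l X])
  have R': "R' (s\<^sup>2 *\<^sub>R R x) = x" for x
    using resolvent_row_pair_left[OF l Y, of x] by (simp add: R'_def Z')
  have sk1: "s * k = 1 - k"
    using ball_kappa_defect[OF l] by (simp add: s_def k_def)
  have "s * (s * k) = s * (1 - k)" unfolding sk1 ..
  then have sk: "s * k = 1 - k" "s * (s * k) = s - s * k"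
    using sk1 by (simp_all only: right_diff_distrib mult_1_right)
  show "ball_involution l (ball_involution l X) j = X j"
  proof (rule blinfun_eqI)
    fix x
    have "(l $ j) *\<^sub>C (x - k *\<^sub>R row_pair l Y x) - s *\<^sub>R Y j x = s\<^sup>2 *\<^sub>R R (X j x)"
    proof -
      have "(l $ j) *\<^sub>C (x - k *\<^sub>R row_pair l Y x)
          = (l $ j) *\<^sub>C ((1 - k) *\<^sub>R R (x - Z x) + (k * s\<^sup>2) *\<^sub>R R x)"
        unfolding RZ Z' by (simp add: algebra_simps)
      also have "\<dots> = R ((l $ j) *\<^sub>C ((1 - k) *\<^sub>R (x - Z x) + (k * s\<^sup>2) *\<^sub>R x))"
        unfolding clinear_apply[OF clR] blinfun.add_right blinfun.scaleR_right ..
      finally have "(l $ j) *\<^sub>C (x - k *\<^sub>R row_pair l Y x) - s *\<^sub>R Y j x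
          = R ((l $ j) *\<^sub>C ((1 - k) *\<^sub>R (x - Z x) + (k * s\<^sup>2) *\<^sub>R x)
              - s *\<^sub>R ((l $ j) *\<^sub>C (x - k *\<^sub>R Z x) - s *\<^sub>R X j x))"
        unfolding Yj by (simp add: blinfun.diff_right blinfun.scaleR_right)
      also have "(l $ j) *\<^sub>C ((1 - k) *\<^sub>R (x - Z x) + (k * s\<^sup>2) *\<^sub>R x)
              - s *\<^sub>R ((l $ j) *\<^sub>C (x - k *\<^sub>R Z x) - s *\<^sub>R X j x)
          = (l $ j) *\<^sub>C ((1 - k) *\<^sub>R (x - Z x) + (s * (s * k)) *\<^sub>R x - s *\<^sub>R x + (s * k) *\<^sub>R Z x) + s\<^sup>2 *\<^sub>R X j x"
        by (simp add: cvs.scale_right_diff_distrib scaleC_add_right scaleC_scaleR_commute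
            scaleR_right_diff_distrib power2_eq_square mult_ac)
      also have "(1 - k) *\<^sub>R (x - Z x) + (s * (s * k)) *\<^sub>R x - s *\<^sub>R x + (s * k) *\<^sub>R Z x = 0"
      proof -
        have e: "(1 - k) + s * (s * k) - s = 0" "s * k - (1 - k) = 0" using sk by linarith+
        have "(1 - k) *\<^sub>R (x - Z x) + (s * (s * k)) *\<^sub>R x - s *\<^sub>R x + (s * k) *\<^sub>R Z x
            = ((1 - k) + s * (s * k) - s) *\<^sub>R x + (s * k - (1 - k)) *\<^sub>R Z x"
          by (simp only: scaleR_left_diff_distrib scaleR_left_distrib scaleR_right_diff_distrib) simp
        then show ?thesis unfolding e by simp
      qed
      finally show ?thesis by (simp add: blinfun.scaleR_right)
    qed
    then show "ball_involution l (ball_involution l X) j x = X j x"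
      using ball_involution_apply[OF l Y, of j x] R'[of "X j x"]
      by (simp add: Y_def[symmetric] R'_def s_def k_def)
  qed
qed

lemma vector_matrix_mult_conj_transpose:
  "l v* conj_transpose U = (\<chi> i. \<Sum>j\<in>UNIV. l $ j * cnj (U $ i $ j))"
  by (simp add: vector_matrix_mult_def conj_transpose_def mult.commute)

text \<open>A unitary substitution can be moved from the inside to the outside of an involution. The maps
  \<open>X \<mapsto> row_mult (ball_involution l X) U\<close> are therefore closed under inversion.\<close>

lemma ball_involution_row_mult:
  assumes l: "norm l < 1" and X: "X \<in> nc_cball" and U: "unitary_matrix U"
  shows "norm (l v* conj_transpose U) = norm l" (is ?th1)
    and "ball_involution l (row_mult X U) = row_mult (ball_involution ((l v* conj_transpose U)) X) U" (is ?th2)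
proof -
  define \<mu> where "\<mu> = (l v* conj_transpose U)"
  have \<mu>: "\<mu> $ i = (\<Sum>j\<in>UNIV. l $ j * cnj (U $ i $ j))" for i
    by (simp add: \<mu>_def vector_matrix_mult_conj_transpose)
  have \<mu>U: "(\<Sum>i\<in>UNIV. \<mu> $ i * U $ i $ j) = l $ j" for j
  proof -
    have "(\<Sum>i\<in>UNIV. \<mu> $ i * U $ i $ j) = (\<Sum>i\<in>UNIV. \<Sum>m\<in>UNIV. l $ m * (cnj (U $ i $ m) * U $ i $ j))"
      by (simp add: \<mu> sum_distrib_right mult.assoc)
    also have "\<dots> = (\<Sum>m\<in>UNIV. l $ m * (\<Sum>i\<in>UNIV. cnj (U $ i $ m) * U $ i $ j))"
      by (subst sum.swap) (simp add: sum_distrib_left)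
    also have "\<dots> = l $ j"
      by (simp add: unitary_col_sum[OF U] if_distrib[of "\<lambda>c. _ * c"] cong: if_cong)
    finally show ?thesis .
  qed
  have "complex_of_real ((norm \<mu>)\<^sup>2) = (\<Sum>i\<in>UNIV. \<mu> $ i * cnj (\<mu> $ i))"
    by (simp add: norm_vec_complex_sq complex_norm_square del: of_real_power)
  also have "\<dots> = (\<Sum>i\<in>UNIV. \<Sum>j\<in>UNIV. (\<mu> $ i * U $ i $ j) * cnj (l $ j))"
    unfolding \<mu> by (simp add: sum_distrib_left mult_ac)
  also have "\<dots> = (\<Sum>j\<in>UNIV. l $ j * cnj (l $ j))"
    by (subst sum.swap) (simp add: \<mu>U flip: sum_distrib_right)
  also have "\<dots> = complex_of_real ((norm l)\<^sup>2)"
    by (simp add: norm_vec_complex_sq complex_norm_square del: of_real_power)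
  finally have "(norm \<mu>)\<^sup>2 = (norm l)\<^sup>2" unfolding of_real_eq_iff .
  then have norm\<mu>: "norm \<mu> = norm l" by simp
  then show ?th1 by (simp add: \<mu>_def)
  have \<mu>1: "norm \<mu> < 1" using l norm\<mu> by simp
  have XU: "row_mult X U \<in> nc_cball" by (rule row_mult_unitary_cball[OF X U])
  have Z: "row_pair l (row_mult X U) = row_pair \<mu> X"
  proof (rule blinfun_eqI)
    fix x
    have "row_pair l (row_mult X U) x = (\<Sum>j\<in>UNIV. \<Sum>i\<in>UNIV. (cnj (l $ j) * U $ i $ j) *\<^sub>C X i x)"
      by (simp add: row_pair_apply row_mult_apply cvs.scale_sum_right scaleC_scaleC)
    also have "\<dots> = row_pair \<mu> X x"
      by (subst sum.swap) (simp add: row_pair_apply \<mu> cvs.scale_sum_left)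
    finally show "row_pair l (row_mult X U) x = row_pair \<mu> X x" .
  qed
  have const: "ball_defect \<mu> = ball_defect l" "ball_kappa \<mu> = ball_kappa l"
    by (simp_all add: ball_kappa_def ball_defect_def norm\<mu>)
  show ?th2 unfolding \<mu>_def[symmetric]
  proof
    fix j
    show "ball_involution l (row_mult X U) j = row_mult (ball_involution \<mu> X) U j"
    proof (rule blinfun_eqI)
      fix x
      define y where "y = x - ball_kappa l *\<^sub>R row_pair \<mu> X x"
      define R where "R = resolvent (row_pair \<mu> X)"
      have clR: "complex_linear_op R" unfolding R_def by (rule clinear_resolvent_row_pair[OF \<mu>1 X])
      have "row_mult (ball_involution \<mu> X) U j x
        = R (\<Sum>i\<in>UNIV. (U $ i $ j) *\<^sub>C ((\<mu> $ i) *\<^sub>C y - ball_defect l *\<^sub>R X i x))"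
        by (simp add: row_mult_apply ball_involution_apply[OF \<mu>1 X] const y_def R_def blinfun.sum_right
            clinear_apply[OF clR, unfolded R_def])
      also have "(\<Sum>i\<in>UNIV. (U $ i $ j) *\<^sub>C ((\<mu> $ i) *\<^sub>C y - ball_defect l *\<^sub>R X i x))
        = (\<Sum>i\<in>UNIV. \<mu> $ i * U $ i $ j) *\<^sub>C y - ball_defect l *\<^sub>R row_mult X U j x"
        by (simp add: cvs.scale_right_diff_distrib sum_subtractf scaleC_scaleC cvs.scale_sum_left
            row_mult_apply scaleR_sum_right scaleC_scaleR_commute mult.commute)
      also have "R \<dots> = ball_involution l (row_mult X U) j x"
        by (simp add: \<mu>U ball_involution_apply[OF l XU] Z R_def y_def)
      finally show "ball_involution l (row_mult X U) j x = row_mult (ball_involution \<mu> X) U j x" by simp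
    qed
  qed
qed

section \<open>Uniform limits of polynomials on the closed ball\<close>

lemma poly_value_sum: "poly_value (sum q I) X = (\<Sum>i\<in>I. poly_value (q i) X)"
  by (induction I rule: infinite_finite_induct) (auto simp: poly_value_add)

lemma poly_value_mult_exists:
  "\<exists>t. \<forall>X\<in>nc_cball. poly_value t X = poly_value q X o\<^sub>L poly_value r (X :: ('n::finite, 'h::chilbert_space) op_tuple)"
proof (intro exI ballI)
  let ?a = "Poly_Mapping.lookup q" and ?b = "Poly_Mapping.lookup r"
  fix X :: "('n, 'h) op_tuple" assume X: "X \<in> nc_cball"
  show "poly_value (\<Sum>\<alpha>\<in>Poly_Mapping.keys q. \<Sum>\<beta>\<in>Poly_Mapping.keys r. Poly_Mapping.single (\<alpha> @ \<beta>) (?a \<alpha> * ?b \<beta>)) X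
      = poly_value q X o\<^sub>L poly_value r X"
  proof (rule blinfun_eqI)
    fix x
    have "word_op X \<alpha> (poly_value r X x) = (\<Sum>\<beta>\<in>Poly_Mapping.keys r. ?b \<beta> *\<^sub>C word_op X \<alpha> (word_op X \<beta> x))" for \<alpha>
      by (simp add: poly_value_def blinfun.sum_left blinfun.sum_right
          clinear_apply[OF clinear_word[OF nc_cball_cl[OF X]]])
    then have "(poly_value q X o\<^sub>L poly_value r X) x =
        (\<Sum>\<alpha>\<in>Poly_Mapping.keys q. \<Sum>\<beta>\<in>Poly_Mapping.keys r. (?a \<alpha> * ?b \<beta>) *\<^sub>C word_op X \<alpha> (word_op X \<beta> x))"
      by (simp add: poly_value_def[of q] blinfun.sum_left cvs.scale_sum_right scaleC_scaleC)
    then show "poly_value (\<Sum>\<alpha>\<in>Poly_Mapping.keys q. \<Sum>\<beta>\<in>Poly_Mapping.keys r. Poly_Mapping.single (\<alpha> @ \<beta>) (?a \<alpha> * ?b \<beta>)) X x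
        = (poly_value q X o\<^sub>L poly_value r X) x"
      by (simp add: poly_value_sum poly_value_single blinfun.sum_left word_op_append)
  qed
qed

lemma poly_value_bounded:
  "\<exists>B. \<forall>X\<in>nc_cball. norm (poly_value q (X :: ('n::finite, 'h::chilbert_space) op_tuple)) \<le> B"
proof (intro exI ballI)
  fix X :: "('n, 'h) op_tuple" assume X: "X \<in> nc_cball"
  have "norm (scaleC_op c (word_op X \<alpha>)) \<le> cmod c" for c \<alpha>
    using norm_scaleC_op[of c "word_op X \<alpha>"] mult_left_mono[OF nc_cball_norm_word[OF X, of \<alpha>], of "cmod c"] by simp
  then show "norm (poly_value q X) \<le> (\<Sum>\<alpha>\<in>Poly_Mapping.keys q. cmod (Poly_Mapping.lookup q \<alpha>))"
    unfolding poly_value_def by (intro sum_norm_le)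
qed

text \<open>The closure of the noncommutative polynomials in the supremum norm over the closed ball: the
  noncommutative disc algebra.\<close>

definition nc_disc :: "(('n::finite, 'h::chilbert_space) op_tuple \<Rightarrow> 'h \<Rightarrow>\<^sub>L 'h) \<Rightarrow> bool" where
  "nc_disc f \<longleftrightarrow> (\<forall>e>0. \<exists>q. \<forall>X\<in>nc_cball. norm (f X - poly_value q X) \<le> e)"

lemma nc_disc_cong: "nc_disc f \<Longrightarrow> (\<And>X. X \<in> nc_cball \<Longrightarrow> g X = f X) \<Longrightarrow> nc_disc g"
  by (simp add: nc_disc_def)

lemma nc_disc_poly: "nc_disc (poly_value q)"
  unfolding nc_disc_def by (auto intro!: exI[of _ q])

lemma nc_disc_const: "nc_disc (\<lambda>X. scaleC_op c id_blinfun)"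
  by (rule nc_disc_cong[OF nc_disc_poly[of "Poly_Mapping.single [] c"]]) (simp add: poly_value_single)

lemma nc_disc_coordinate: "nc_disc (\<lambda>X. X i)"
  by (rule nc_disc_cong[OF nc_disc_poly[of "Poly_Mapping.single [i] 1"]])
    (auto simp: poly_value_single intro: blinfun_eqI)

lemma nc_disc_bounded:
  assumes "nc_disc f" shows "\<exists>B. B \<ge> 0 \<and> (\<forall>X\<in>nc_cball. norm (f X) \<le> B)"
proof -
  obtain q where q: "\<And>X. X \<in> nc_cball \<Longrightarrow> norm (f X - poly_value q X) \<le> 1"
    using assms unfolding nc_disc_def by (metis zero_less_one)
  obtain B where B: "\<And>X. X \<in> nc_cball \<Longrightarrow> norm (poly_value q X :: 'b \<Rightarrow>\<^sub>L 'b) \<le> B"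
    using poly_value_bounded by blast
  have "norm (f X) \<le> \<bar>B\<bar> + 1" if "X \<in> nc_cball" for X
    using q[OF that] B[OF that] norm_triangle_sub[of "f X" "poly_value q X"] by linarith
  then show ?thesis by (intro exI[of _ "\<bar>B\<bar> + 1"]) auto
qed

lemma nc_disc_add:
  assumes f: "nc_disc f" and g: "nc_disc g" shows "nc_disc (\<lambda>X. f X + g X)"
  unfolding nc_disc_def
proof (intro allI impI)
  fix e :: real assume "e > 0"
  then have e: "e / 2 > 0" by simp
  obtain q where q: "\<And>X. X \<in> nc_cball \<Longrightarrow> norm (f X - poly_value q X) \<le> e / 2"
    using f e unfolding nc_disc_def by blast
  obtain r where r: "\<And>X. X \<in> nc_cball \<Longrightarrow> norm (g X - poly_value r X) \<le> e / 2"
    using g e unfolding nc_disc_def by blast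
  have "norm ((f X + g X) - poly_value (q + r) X) \<le> e" if "X \<in> nc_cball" for X
    using norm_triangle_ineq[of "f X - poly_value q X" "g X - poly_value r X"] q[OF that] r[OF that]
    by (simp add: poly_value_add algebra_simps)
  then show "\<exists>q. \<forall>X\<in>nc_cball. norm (f X + g X - poly_value q X) \<le> e" by blast
qed

lemma nc_disc_comp:
  assumes f: "nc_disc f" and g: "nc_disc g" shows "nc_disc (\<lambda>X. f X o\<^sub>L g X)"
  unfolding nc_disc_def
proof (intro allI impI)
  fix e :: real assume e: "e > 0"
  obtain B where B: "B \<ge> 0" "\<And>X. X \<in> nc_cball \<Longrightarrow> norm (f X) \<le> B"
    using nc_disc_bounded[OF f] by blast
  have "e / (2 * (B + 1)) > 0" using e B by simp
  then obtain r where r: "\<And>X. X \<in> nc_cball \<Longrightarrow> norm (g X - poly_value r X) \<le> e / (2 * (B + 1))"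
    using g unfolding nc_disc_def by blast
  obtain C where C: "C \<ge> 0" "\<And>X. X \<in> nc_cball \<Longrightarrow> norm (poly_value r X :: 'b \<Rightarrow>\<^sub>L 'b) \<le> C"
    using nc_disc_bounded[OF nc_disc_poly[of r]] by blast
  have "e / (2 * (C + 1)) > 0" using e C by simp
  then obtain q where q: "\<And>X. X \<in> nc_cball \<Longrightarrow> norm (f X - poly_value q X) \<le> e / (2 * (C + 1))"
    using f unfolding nc_disc_def by blast
  obtain t where t: "\<And>X :: ('a, 'b) op_tuple. X \<in> nc_cball \<Longrightarrow> poly_value t X = poly_value q X o\<^sub>L poly_value r X"
    using poly_value_mult_exists by blast
  have "norm ((f X o\<^sub>L g X) - poly_value t X) \<le> e" if X: "X \<in> nc_cball" for X
  proof -
    have "(f X o\<^sub>L g X) - poly_value t X =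
        (f X o\<^sub>L (g X - poly_value r X)) + ((f X - poly_value q X) o\<^sub>L poly_value r X)"
      unfolding t[OF X] by (rule blinfun_eqI) (simp add: blinfun.bilinear_simps)
    also have "norm \<dots> \<le> norm (f X) * norm (g X - poly_value r X) + norm (f X - poly_value q X) * norm (poly_value r X)"
      by (rule order_trans[OF norm_triangle_ineq]) (intro add_mono norm_blinfun_compose)
    also have "\<dots> \<le> B * (e / (2 * (B + 1))) + e / (2 * (C + 1)) * C"
      using B(1) B(2)[OF X] r[OF X] q[OF X] C(1) C(2)[OF X] e
      by (intro add_mono mult_mono) auto
    also have "\<dots> \<le> e / 2 + e / 2"
      using B(1) C(1) e by (intro add_mono) (auto simp: field_simps)
    finally show ?thesis by simp
  qed
  then show "\<exists>q. \<forall>X\<in>nc_cball. norm ((f X o\<^sub>L g X) - poly_value q X) \<le> e" by blast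
qed

lemma nc_disc_scaleC:
  assumes "nc_disc f" shows "nc_disc (\<lambda>X. scaleC_op c (f X))"
  by (rule nc_disc_cong[OF nc_disc_comp[OF nc_disc_const[of c] assms]]) (auto intro: blinfun_eqI)

lemma nc_disc_sum:
  "(\<And>i. i \<in> I \<Longrightarrow> nc_disc (f i)) \<Longrightarrow> nc_disc (\<lambda>X. \<Sum>i\<in>I. f i X)"
proof (induction I rule: infinite_finite_induct)
  case (insert i I)
  then have "nc_disc (\<lambda>X. f i X + (\<Sum>i\<in>I. f i X))" by (intro nc_disc_add) auto
  then show ?case using insert by simp
qed (use nc_disc_const[of 0] in auto)

lemma nc_disc_diff:
  assumes "nc_disc f" "nc_disc g" shows "nc_disc (\<lambda>X. f X - g X)"
  by (rule nc_disc_cong[OF nc_disc_add[OF assms(1) nc_disc_scaleC[OF assms(2), of "-1"]]])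
    (auto intro!: blinfun_eqI simp: blinfun.bilinear_simps)

lemma nc_disc_id: "nc_disc (\<lambda>X. id_blinfun)"
  using nc_disc_const[of 1] by simp

lemma nc_disc_uniform_limit:
  assumes f: "\<And>e. e > 0 \<Longrightarrow> \<exists>g. nc_disc g \<and> (\<forall>X\<in>nc_cball. norm (f X - g X) \<le> e)"
  shows "nc_disc f"
  unfolding nc_disc_def
proof (intro allI impI)
  fix e :: real assume "e > 0"
  then have e: "e / 2 > 0" by simp
  obtain g where g: "nc_disc g" "\<And>X. X \<in> nc_cball \<Longrightarrow> norm (f X - g X) \<le> e / 2" using f[OF e] by blast
  obtain q where q: "\<And>X. X \<in> nc_cball \<Longrightarrow> norm (g X - poly_value q X) \<le> e / 2"
    using g(1) e unfolding nc_disc_def by blast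
  have "norm (f X - poly_value q X) \<le> e" if "X \<in> nc_cball" for X
    using norm_triangle_ineq[of "f X - g X" "g X - poly_value q X"] g(2)[OF that] q[OF that] by simp
  then show "\<exists>q. \<forall>X\<in>nc_cball. norm (f X - poly_value q X) \<le> e" by blast
qed

lemma nc_disc_poly_compose:
  assumes F: "\<And>j. nc_disc (\<lambda>X. F X j)"
  shows "nc_disc (\<lambda>X. poly_value q (F X))"
proof -
  have "nc_disc (\<lambda>X. word_op (F X) \<alpha>)" for \<alpha>
    by (induction \<alpha>) (auto intro: nc_disc_id nc_disc_comp F)
  then show ?thesis
    unfolding poly_value_def by (intro nc_disc_sum nc_disc_scaleC)
qed

lemma nc_disc_row_pair: "nc_disc (row_pair l)"
  unfolding row_pair_def[abs_def] by (intro nc_disc_sum nc_disc_scaleC nc_disc_coordinate)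

lemma nc_disc_resolvent_row_pair:
  assumes l: "norm l < 1" shows "nc_disc (\<lambda>X. resolvent (row_pair l X))"
proof (rule nc_disc_uniform_limit)
  fix e :: real assume e: "e > 0"
  obtain n where n: "norm l ^ n < e * (1 - norm l)"
    using real_arch_pow_inv[of "e * (1 - norm l)" "norm l"] e l by auto
  have "nc_disc (\<lambda>X. op_power (row_pair l X) k)" for k
    by (induction k) (auto intro: nc_disc_id nc_disc_comp nc_disc_row_pair)
  then have "nc_disc (\<lambda>X. \<Sum>k<n. op_power (row_pair l X) k)" by (intro nc_disc_sum)
  moreover have "norm (resolvent (row_pair l X) - (\<Sum>k<n. op_power (row_pair l X) k)) \<le> e"
    if "X \<in> nc_cball" for X :: "('a, 'b) op_tuple"
  proof -
    have "norm l ^ n / (1 - norm l) \<le> e" using n l by (simp add: divide_le_eq)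
    then show ?thesis using resolvent_tail[OF norm_row_pair[OF that] l, of n] by linarith
  qed
  ultimately show "\<exists>g. nc_disc g \<and> (\<forall>X\<in>nc_cball. norm (resolvent (row_pair l X :: 'b \<Rightarrow>\<^sub>L 'b) - g X) \<le> e)" by blast
qed

lemma nc_disc_ball_involution:
  assumes l: "norm l < 1" shows "nc_disc (\<lambda>X. ball_involution l X j)"
proof -
  have "nc_disc (\<lambda>X. resolvent (row_pair l X) o\<^sub>L
      (scaleC_op (l $ j) (id_blinfun - scaleC_op (of_real (ball_kappa l)) (row_pair l X))
        - scaleC_op (of_real (ball_defect l)) (X j)))"
    by (intro nc_disc_comp nc_disc_diff nc_disc_scaleC nc_disc_id nc_disc_coordinate nc_disc_row_pair
        nc_disc_resolvent_row_pair[OF l])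
  then show ?thesis
    by (rule nc_disc_cong)
      (auto intro!: blinfun_eqI simp: ball_involution_apply[OF l] blinfun.bilinear_simps scaleR_scaleC)
qed

lemma nc_disc_automorphism:
  assumes l: "norm l < 1" shows "nc_disc (\<lambda>X. row_mult (ball_involution l X) U j)"
  unfolding row_mult_def by (intro nc_disc_sum nc_disc_scaleC nc_disc_ball_involution[OF l])

section \<open>Invariance of the Harnack relation\<close>

lemma quad_form_diff_le:
  assumes "\<And>i j. i < m \<Longrightarrow> j < m \<Longrightarrow> norm (S i j - T i j) \<le> e" and e: "0 \<le> e"
  shows "\<bar>quad_form m S \<xi> - quad_form m T \<xi>\<bar> \<le> e * (real m * (\<Sum>i<m. (norm (\<xi> i))\<^sup>2))"
proof -
  have "quad_form m S \<xi> - quad_form m T \<xi> = Re (\<Sum>i<m. \<Sum>j<m. cinner (\<xi> i) ((S i j - T i j) (\<xi> j)))"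
    by (simp add: quad_form_def blinfun.diff_left cinner_diff_right sum_subtractf)
  also have "\<bar>\<dots>\<bar> \<le> (\<Sum>i<m. \<Sum>j<m. cmod (cinner (\<xi> i) ((S i j - T i j) (\<xi> j))))"
    by (rule order_trans[OF abs_Re_le_cmod]) (intro order_trans[OF norm_sum] sum_mono norm_sum)
  also have "\<dots> \<le> (\<Sum>i<m. \<Sum>j<m. e * (((norm (\<xi> i))\<^sup>2 + (norm (\<xi> j))\<^sup>2) / 2))"
  proof (intro sum_mono)
    fix i j assume ij: "i \<in> {..<m}" "j \<in> {..<m}"
    have "cmod (cinner (\<xi> i) ((S i j - T i j) (\<xi> j))) \<le> norm (\<xi> i) * (norm (S i j - T i j) * norm (\<xi> j))"
      by (rule order_trans[OF cinner_Cauchy_Schwarz]) (intro mult_left_mono norm_blinfun norm_ge_zero)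
    also have "\<dots> \<le> norm (\<xi> i) * (e * norm (\<xi> j))"
      using assms(1)[of i j] ij by (intro mult_left_mono mult_right_mono) auto
    also have "\<dots> = e * (norm (\<xi> i) * norm (\<xi> j))" by simp
    also have "\<dots> \<le> e * (((norm (\<xi> i))\<^sup>2 + (norm (\<xi> j))\<^sup>2) / 2)"
      using e sum_squares_bound[of "norm (\<xi> i)" "norm (\<xi> j)"] by (intro mult_left_mono) auto
    finally show "cmod (cinner (\<xi> i) ((S i j - T i j) (\<xi> j))) \<le> \<dots>" .
  qed
  also have "\<dots> = e * (real m * (\<Sum>i<m. (norm (\<xi> i))\<^sup>2))"
    by (simp add: add_divide_distrib distrib_left sum.distrib flip: sum_distrib_left sum_divide_distrib)
  finally show ?thesis .
qed

lemma le_of_le_add_small: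
  fixes x y K :: real
  assumes "\<And>e. e > 0 \<Longrightarrow> x \<le> y + e * K" and K: "0 \<le> K"
  shows "x \<le> y"
proof (rule field_le_epsilon)
  fix e :: real assume "e > 0"
  then have "x \<le> y + e / (K + 1) * K" using K by (intro assms(1)) auto
  also have "e / (K + 1) * K \<le> e" using \<open>e > 0\<close> K by (simp add: field_simps)
  finally show "x \<le> y + e" by simp
qed

text \<open>For \<open>p\<close> with \<open>Re p \<ge> 0\<close> the composition \<open>p \<circ> F\<close> has nonnegative real part on the ball and is a
  uniform limit of polynomials \<open>q\<close> on the closed ball. The polynomial \<open>q\<close> itself may fail to have
  nonnegative real part, but adding a small multiple of the identity repairs this. The Harnack
  inequalities for the corrected polynomials give those for \<open>p \<circ> F\<close> in the limit, with the same
  constant.\<close>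

lemma harnack_le_transfer:
  fixes F :: "('n::finite, 'h::chilbert_space) op_tuple \<Rightarrow> ('n, 'h) op_tuple"
  assumes disc: "\<And>j. nc_disc (\<lambda>X. F X j)"
    and ball: "\<And>X. X \<in> nc_ball \<Longrightarrow> F X \<in> nc_ball"
    and cball: "\<And>X. X \<in> nc_cball \<Longrightarrow> F X \<in> nc_cball"
    and A: "A \<in> nc_cball" and B: "B \<in> nc_cball" and AB: "harnack_le c A B"
  shows "harnack_le c (F A) (F B)"
  unfolding harnack_le_iff[OF cball[OF A] cball[OF B]]
proof (intro allI impI)
  fix m :: nat and p :: "'n nc_matrix_poly" and \<xi> :: "nat \<Rightarrow> 'h"
  assume p: "nc_Re_nonneg TYPE('h) m p"
  define a where "a = quad_form m (nc_eval p (F A)) \<xi>"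
  define b where "b = quad_form m (nc_eval p (F B)) \<xi>"
  define N where "N \<eta> = real m * (\<Sum>i<m. (norm (\<eta> i :: 'h))\<^sup>2)" for \<eta>
  have N0: "0 \<le> N \<eta>" for \<eta> by (simp add: N_def sum_nonneg)
  define K where "K = 2 * N \<xi> * (1 + c\<^sup>2 + 1 / c\<^sup>2)"
  have K: "0 \<le> K" using N0 by (simp add: K_def)
  have approx: "(1 / c\<^sup>2) * b \<le> a + e * K \<and> a \<le> c\<^sup>2 * b + e * K" if e: "e > 0" for e
  proof -
    have "\<exists>q. \<forall>X\<in>nc_cball. norm (poly_value (p i j) (F X) - poly_value q X) \<le> e" for i j
      using nc_disc_poly_compose[of F, OF disc, of "p i j"] e unfolding nc_disc_def by blast
    then obtain q where q: "\<And>i j X. X \<in> nc_cball \<Longrightarrow> norm (poly_value (p i j) (F X) - poly_value (q i j) X) \<le> e"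
      by metis
    \<comment> \<open>The correction \<open>e m\<close> dominates the error \<open>e\<close> in each of the \<open>m\<^sup>2\<close> entries.\<close>
    define q' where "q' i j = q i j + (if i = j then Poly_Mapping.single [] (of_real (e * real m)) else 0)" for i j
    have qf': "quad_form m (nc_eval q' X) \<eta> = quad_form m (nc_eval q X) \<eta> + e * N \<eta>"
      for X :: "('n, 'h) op_tuple" and \<eta>
    proof -
      have "cinner (\<eta> i) (nc_eval q' X i j (\<eta> j)) = cinner (\<eta> i) (nc_eval q X i j (\<eta> j)) +
          (if j = i then of_real (e * real m * (norm (\<eta> i))\<^sup>2) else 0)" for i j
        by (simp add: nc_eval_poly_value q'_def poly_value_add poly_value_single blinfun.add_left
            cinner_add_right cinner_scaleC_right cinner_self)
      then show ?thesis
        by (simp add: quad_form_def sum.distrib N_def sum_distrib_left mult.assoc)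
    qed
    have close: "\<bar>quad_form m (nc_eval p (F X)) \<eta> - quad_form m (nc_eval q X) \<eta>\<bar> \<le> e * N \<eta>"
      if "X \<in> nc_cball" for X \<eta>
      unfolding N_def using q[OF that] e by (intro quad_form_diff_le) (auto simp: nc_eval_poly_value)
    have "nc_Re_nonneg TYPE('h) m q'"
      unfolding nc_Re_nonneg_iff
    proof (intro ballI allI)
      fix X :: "('n, 'h) op_tuple" and \<eta> assume X: "X \<in> nc_ball"
      have "0 \<le> quad_form m (nc_eval p (F X)) \<eta>"
        using p ball[OF X] unfolding nc_Re_nonneg_iff by blast
      then show "0 \<le> quad_form m (nc_eval q' X) \<eta>"
        using close[OF nc_ball_imp_cball[OF X], of \<eta>] unfolding qf' by linarith
    qed
    then have h: "(1 / c\<^sup>2) * quad_form m (nc_eval q' B) \<xi> \<le> quad_form m (nc_eval q' A) \<xi>"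
      "quad_form m (nc_eval q' A) \<xi> \<le> c\<^sup>2 * quad_form m (nc_eval q' B) \<xi>"
      using AB unfolding harnack_le_iff[OF A B] by blast+
    define t where "t = 2 * (e * N \<xi>)"
    have t: "0 \<le> t" using e N0 by (simp add: t_def)
    have a': "a \<le> quad_form m (nc_eval q' A) \<xi>" "quad_form m (nc_eval q' A) \<xi> \<le> a + t"
      using close[OF A, of \<xi>] unfolding qf' t_def a_def by linarith+
    have b': "b \<le> quad_form m (nc_eval q' B) \<xi>" "quad_form m (nc_eval q' B) \<xi> \<le> b + t"
      using close[OF B, of \<xi>] unfolding qf' t_def b_def by linarith+
    have eK: "e * K = t + c\<^sup>2 * t + (1 / c\<^sup>2) * t" by (simp add: K_def t_def distrib_left distrib_right)
    have "(1 / c\<^sup>2) * b \<le> (1 / c\<^sup>2) * quad_form m (nc_eval q' B) \<xi>"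
      using b'(1) by (intro mult_left_mono) auto
    moreover have "c\<^sup>2 * quad_form m (nc_eval q' B) \<xi> \<le> c\<^sup>2 * (b + t)"
      using b'(2) by (intro mult_left_mono) auto
    moreover have "0 \<le> c\<^sup>2 * t" "0 \<le> (1 / c\<^sup>2) * t" using t by auto
    ultimately show ?thesis using h a' t unfolding eK distrib_left by linarith
  qed
  have "(1 / c\<^sup>2) * b \<le> a" by (rule le_of_le_add_small[OF _ K]) (use approx in blast)
  moreover have "a \<le> c\<^sup>2 * b" by (rule le_of_le_add_small[OF _ K]) (use approx in blast)
  ultimately show "(1 / c\<^sup>2) * quad_form m (nc_eval p (F B)) \<xi> \<le> quad_form m (nc_eval p (F A)) \<xi> \<and>
      quad_form m (nc_eval p (F A)) \<xi> \<le> c\<^sup>2 * quad_form m (nc_eval p (F B)) \<xi>"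
    by (simp add: a_def b_def)
qed

lemma automorphism_ball:
  assumes "norm l < 1" "unitary_matrix U" "X \<in> nc_ball"
  shows "row_mult (ball_involution l X) U \<in> nc_ball"
  by (intro row_mult_unitary_ball ball_involution_ball assms)

lemma automorphism_cball:
  assumes "norm l < 1" "unitary_matrix U" "X \<in> nc_cball"
  shows "row_mult (ball_involution l X) U \<in> nc_cball"
  by (intro row_mult_unitary_cball ball_involution_cball assms)

lemma harnack_le_automorphism:
  assumes "norm l < 1" "unitary_matrix U" "A \<in> nc_cball" "B \<in> nc_cball" "harnack_le c A B"
  shows "harnack_le c (row_mult (ball_involution l A) U) (row_mult (ball_involution l B) U)"
  using assms
  by (intro harnack_le_transfer[where F = "\<lambda>X. row_mult (ball_involution l X) U"]
      nc_disc_automorphism automorphism_ball automorphism_cball)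

text \<open>The inverse map is \<open>Y \<mapsto> ball_involution l (row_mult Y (conj_transpose U))\<close>; moving the unitary
  outside gives it the shape of the original map.\<close>

lemma automorphism_inverse:
  assumes l: "norm l < 1" and U: "unitary_matrix U" and X: "X \<in> nc_cball"
  shows "row_mult (ball_involution ((l v* U)) (row_mult (ball_involution l X) U)) (conj_transpose U) = X"
    and "norm (l v* U) < 1"
proof -
  define Y where "Y = ball_involution l X"
  note U' = unitary_conj_transpose[OF U]
  have Y: "Y \<in> nc_cball" unfolding Y_def by (rule ball_involution_cball[OF l X])
  have YU: "row_mult Y U \<in> nc_cball" by (rule row_mult_unitary_cball[OF Y U])
  show "norm (l v* U) < 1"
    using ball_involution_row_mult(1)[OF l YU U'] l by simp
  have "row_mult (ball_involution ((l v* U)) (row_mult Y U)) (conj_transpose U)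
      = ball_involution l (row_mult (row_mult Y U) (conj_transpose U))"
    using ball_involution_row_mult(2)[OF l YU U'] by simp
  also have "row_mult (row_mult Y U) (conj_transpose U) = Y"
    using U by (simp add: row_mult_row_mult unitary_matrix_def)
  also have "ball_involution l Y = X" unfolding Y_def by (rule ball_involution_involution[OF l X])
  finally show "row_mult (ball_involution ((l v* U)) (row_mult (ball_involution l X) U)) (conj_transpose U) = X"
    unfolding Y_def .
qed

lemma harnack_le_automorphism_iff:
  assumes l: "norm l < 1" and U: "unitary_matrix U" and A: "A \<in> nc_cball" and B: "B \<in> nc_cball"
  shows "harnack_le c (row_mult (ball_involution l A) U) (row_mult (ball_involution l B) U) \<longleftrightarrow> harnack_le c A B"
proof
  assume "harnack_le c (row_mult (ball_involution l A) U) (row_mult (ball_involution l B) U)"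
  from harnack_le_automorphism[OF automorphism_inverse(2)[OF l U A] unitary_conj_transpose[OF U]
      automorphism_cball[OF l U A] automorphism_cball[OF l U B] this]
  show "harnack_le c A B"
    unfolding automorphism_inverse(1)[OF l U A] automorphism_inverse(1)[OF l U B] .
qed (rule harnack_le_automorphism[OF l U A B])

lemma harnack_dist_automorphism:
  assumes l: "norm l < 1" and U: "unitary_matrix U" and AB: "harnack_equiv A B"
  shows "harnack_equiv (row_mult (ball_involution l A) U) (row_mult (ball_involution l B) U)"
    and "harnack_dist (row_mult (ball_involution l A) U) (row_mult (ball_involution l B) U) = harnack_dist A B"
proof -
  have A: "A \<in> nc_cball" and B: "B \<in> nc_cball" using AB by (auto simp: harnack_equiv_def)
  note iff = harnack_le_automorphism_iff[OF l U A B]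
  show e: "harnack_equiv (row_mult (ball_involution l A) U) (row_mult (ball_involution l B) U)"
    using AB automorphism_cball[OF l U] unfolding harnack_equiv_def iff by blast
  show "harnack_dist (row_mult (ball_involution l A) U) (row_mult (ball_involution l B) U) = harnack_dist A B"
    by (simp add: harnack_dist_eq[OF AB] harnack_dist_eq[OF e] harnack_omega_def iff)
qed

section \<open>Orthonormal families\<close>

text \<open>Gram-Schmidt: no finite set spans the space, so a further vector always exists.\<close>

lemma exists_orthonormal_family:
  assumes inf: "\<nexists>S :: 'h::chilbert_space set. finite S \<and> module.span (scaleC :: complex \<Rightarrow> 'h \<Rightarrow> 'h) S = UNIV"
    and "finite W"
  shows "\<exists>e :: 'i \<Rightarrow> 'h. \<forall>a\<in>W. \<forall>b\<in>W. cinner (e a) (e b) = (if a = b then 1 else 0)"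
  using \<open>finite W\<close>
proof (induction W)
  case (insert c W)
  then obtain e :: "'i \<Rightarrow> 'h" where e: "\<And>a b. a \<in> W \<Longrightarrow> b \<in> W \<Longrightarrow> cinner (e a) (e b) = (if a = b then 1 else 0)"
    by blast
  have "cvs.span (e ` W) \<noteq> UNIV" using inf insert.hyps(1) by blast
  then obtain y where y: "y \<notin> cvs.span (e ` W)" by blast
  define v where "v = y - (\<Sum>a\<in>W. cinner (e a) y *\<^sub>C e a)"
  have "(\<Sum>a\<in>W. cinner (e a) y *\<^sub>C e a) \<in> cvs.span (e ` W)"
    by (intro cvs.span_sum cvs.span_scale cvs.span_base) auto
  then have v0: "v \<noteq> 0" using y by (auto simp: v_def)
  have ev: "cinner (e b) v = 0" if "b \<in> W" for b
    using that insert.hyps(1)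
    by (simp add: v_def cinner_diff_right cinner_sum_right cinner_scaleC_right e if_distrib[of "\<lambda>x. _ * x"] cong: if_cong)
  define w where "w = (1 / norm v) *\<^sub>R v"
  have ww: "cinner w w = 1" using v0
    by (simp add: w_def cinner_scaleR_left cinner_scaleR_right cinner_self power2_eq_square)
  have ew: "cinner (e b) w = 0" "cinner w (e b) = 0" if "b \<in> W" for b
    using ev[OF that] cinner_commute[of v "e b"] by (simp_all add: w_def cinner_scaleR_left cinner_scaleR_right)
  have "cinner ((e(c := w)) a) ((e(c := w)) b) = (if a = b then 1 else 0)"
    if "a \<in> insert c W" "b \<in> insert c W" for a b
    using that e[of a b] ew ww insert.hyps(2) by auto
  then show ?case by blast
qed simp

lemma norm_sum_orthonormal:
  assumes "finite W" and e: "\<And>a b. a \<in> W \<Longrightarrow> b \<in> W \<Longrightarrow> cinner (e a) (e b :: 'h::chilbert_space) = (if a = b then 1 else 0)"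
  shows "(norm (\<Sum>a\<in>W. c a *\<^sub>C e a))\<^sup>2 = (\<Sum>a\<in>W. (cmod (c a))\<^sup>2)"
proof -
  have "cinner (e b) (\<Sum>a\<in>W. c a *\<^sub>C e a) = c b" if "b \<in> W" for b
    using that \<open>finite W\<close>
    by (simp add: cinner_sum_right cinner_scaleC_right e if_distrib[of "\<lambda>x. _ * x"] cong: if_cong)
  then have "complex_of_real ((norm (\<Sum>a\<in>W. c a *\<^sub>C e a))\<^sup>2) = (\<Sum>a\<in>W. cnj (c a) * c a)"
    unfolding cinner_self[symmetric] cinner_sum_left cinner_scaleC_left by simp
  also have "\<dots> = complex_of_real (\<Sum>a\<in>W. (cmod (c a))\<^sup>2)"
    by (simp add: complex_norm_square mult.commute del: of_real_power)
  finally show ?thesis unfolding of_real_eq_iff .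
qed

lemma bessel_inequality:
  assumes "finite W" and e: "\<And>a b. a \<in> W \<Longrightarrow> b \<in> W \<Longrightarrow> cinner (e a) (e b :: 'h::chilbert_space) = (if a = b then 1 else 0)"
  shows "(\<Sum>a\<in>W. (cmod (cinner (e a) x))\<^sup>2) \<le> (norm x)\<^sup>2"
proof -
  define p where "p = (\<Sum>a\<in>W. cinner (e a) x *\<^sub>C e a)"
  have p: "(norm p)\<^sup>2 = (\<Sum>a\<in>W. (cmod (cinner (e a) x))\<^sup>2)"
    unfolding p_def by (rule norm_sum_orthonormal[OF assms])
  have "cinner p x = (\<Sum>a\<in>W. complex_of_real ((cmod (cinner (e a) x))\<^sup>2))"
    by (simp add: p_def cinner_sum_left cinner_scaleC_left complex_norm_square mult.commute del: of_real_power)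
  then have "Re (cinner p x) = (norm p)\<^sup>2" unfolding p of_real_sum[symmetric] by simp
  moreover have "Re (cinner x p) = Re (cinner p x)" by (simp add: cinner_commute[of x p])
  ultimately have "(norm (x - p))\<^sup>2 = (norm x)\<^sup>2 - (norm p)\<^sup>2" by (simp add: norm_diff_squared)
  then show ?thesis unfolding p[symmetric] by (metis diff_ge_0_iff_ge zero_le_power2)
qed

section \<open>Truncated creation operators\<close>

definition rank_one :: "'h::chilbert_space \<Rightarrow> 'h \<Rightarrow> ('h \<Rightarrow>\<^sub>L 'h)" where
  "rank_one u v = Blinfun (\<lambda>x. cinner u x *\<^sub>C v)"

lemma rank_one_apply [simp]: "rank_one u v x = cinner u x *\<^sub>C v"
proof -
  have "bounded_linear (\<lambda>x. cinner u x *\<^sub>C v)"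
  proof (rule bounded_linear_intro)
    show "norm (cinner u x *\<^sub>C v) \<le> norm x * (norm u * norm v)" for x
      using mult_right_mono[OF cinner_Cauchy_Schwarz[of u x], of "norm v"] by (simp add: norm_scaleC mult_ac)
  qed (simp_all add: cinner_add_right scaleC_add_left cinner_scaleC_right scaleR_scaleC scaleC_scaleC)
  then show ?thesis by (simp add: rank_one_def bounded_linear_Blinfun_apply)
qed

lemma finite_words [simp]: "finite {\<alpha> :: 'n::finite list. length \<alpha> \<le> N}" "finite {\<alpha> :: 'n::finite list. length \<alpha> < N}"
    "finite {\<alpha> :: 'n::finite list. length \<alpha> = N}"
proof -
  show "finite {\<alpha> :: 'n::finite list. length \<alpha> \<le> N}" for N using finite_lists_length_le[of "UNIV :: 'n set" N] by simp
  then show "finite {\<alpha> :: 'n::finite list. length \<alpha> < N}"  "finite {\<alpha> :: 'n::finite list. length \<alpha> = N}"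
    by (auto intro: finite_subset[of _ "{\<alpha> :: 'n list. length \<alpha> \<le> N}"])
qed

lemma scaleC_op_0_right [simp]: "scaleC_op c 0 = 0"
  by (rule blinfun_eqI) simp

text \<open>On tuples with this property every power series is a finite sum, and functions composed of power
  series remain polynomials of degree at most \<open>N\<close>.\<close>

definition nilpotent_tuple :: "nat \<Rightarrow> ('n, 'h::chilbert_space) op_tuple \<Rightarrow> bool" where
  "nilpotent_tuple N X \<longleftrightarrow> (\<forall>\<alpha>. N < length \<alpha> \<longrightarrow> word_op X \<alpha> = 0)"

lemma word_op_scaleC:
  assumes "\<And>i. complex_linear_op (X i)"
  shows "word_op (\<lambda>i. scaleC_op c (X i)) \<alpha> = scaleC_op (c ^ length \<alpha>) (word_op X \<alpha>)"
  by (induction \<alpha>) (auto intro!: blinfun_eqI simp: clinear_apply[OF assms] scaleC_scaleC scaleC_one)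

text \<open>An orthonormal family indexed by the words of length at most \<open>N\<close>: the full Fock space on \<open>n\<close>
  generators, cut off at degree \<open>N\<close> and placed inside the Hilbert space. Its creation operators form
  a nilpotent row contraction from which the coefficients of a power series can be read off.\<close>

locale truncated_fock =
  fixes e :: "'n::finite list \<Rightarrow> 'h::chilbert_space" and N :: nat
  assumes orthonormal: "length \<alpha> \<le> N \<Longrightarrow> length \<beta> \<le> N \<Longrightarrow> cinner (e \<alpha>) (e \<beta>) = (if \<alpha> = \<beta> then 1 else 0)"
begin

definition shift :: "('n, 'h) op_tuple" where
  "shift i = (\<Sum>\<alpha>\<in>{\<alpha>. length \<alpha> < N}. rank_one (e \<alpha>) (e (i # \<alpha>)))"

lemma shift_apply: "shift i x = (\<Sum>\<alpha>\<in>{\<alpha>. length \<alpha> < N}. cinner (e \<alpha>) x *\<^sub>C e (i # \<alpha>))"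
  by (simp add: shift_def blinfun.sum_left)

lemma clinear_shift: "complex_linear_op (shift i)"
  by (simp add: complex_linear_op_def shift_apply cinner_scaleC_right cvs.scale_sum_right scaleC_scaleC)

lemma shift_e: assumes "length \<alpha> < N" shows "shift i (e \<alpha>) = e (i # \<alpha>)"
proof -
  have "shift i (e \<alpha>) = (\<Sum>\<beta>\<in>{\<beta>. length \<beta> < N}. if \<beta> = \<alpha> then e (i # \<beta>) else 0)"
    unfolding shift_apply using assms by (intro sum.cong) (auto simp: orthonormal scaleC_one)
  then show ?thesis using assms by simp
qed

lemma word_shift_e: "length \<alpha> \<le> N \<Longrightarrow> word_op shift \<alpha> (e []) = e \<alpha>"
  by (induction \<alpha>) (auto simp: shift_e)

text \<open>A word of length \<open>m\<close> in the creation operators raises the degree by \<open>m\<close>, so its range is orthogonal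
  to all basis vectors of smaller degree.\<close>

lemma cinner_word_shift:
  "length \<gamma> < length \<alpha> \<Longrightarrow> length \<gamma> \<le> N \<Longrightarrow> cinner (e \<gamma>) (word_op shift \<alpha> x) = 0"
proof (induction \<alpha> arbitrary: \<gamma>)
  case (Cons i \<alpha>)
  have "cinner (e \<gamma>) (shift i y) = 0" if y: "\<And>\<delta>. length \<delta> < length \<gamma> \<Longrightarrow> cinner (e \<delta>) y = 0" for y
    unfolding shift_apply cinner_sum_right cinner_scaleC_right
  proof (rule sum.neutral, rule ballI)
    fix \<delta> :: "'n list" assume \<delta>: "\<delta> \<in> {\<alpha>. length \<alpha> < N}"
    show "cinner (e \<delta>) y * cinner (e \<gamma>) (e (i # \<delta>)) = 0"
      using \<delta> Cons.prems y[of \<delta>] by (cases "\<gamma> = i # \<delta>") (auto simp: orthonormal)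
  qed
  moreover have "cinner (e \<delta>) (word_op shift \<alpha> x) = 0" if "length \<delta> < length \<gamma>" for \<delta>
    using Cons.IH[of \<delta>] that Cons.prems by simp
  ultimately show ?case by simp
qed simp

lemma nilpotent_shift: "nilpotent_tuple N shift"
  unfolding nilpotent_tuple_def
proof (intro allI impI)
  fix \<alpha> :: "'n list" assume "N < length \<alpha>"
  then show "word_op shift \<alpha> = 0"
  proof (induction \<alpha>)
    case (Cons i \<alpha>)
    show ?case
    proof (cases "N < length \<alpha>")
      case False
      then have "length \<alpha> = N" using Cons.prems by simp
      then show ?thesis
        by (intro blinfun_eqI) (simp add: shift_apply cinner_word_shift)
    qed (use Cons.IH in simp)
  qed simp
qed

lemma adj_shift: "adj_op (shift i) x = (\<Sum>\<alpha>\<in>{\<alpha>. length \<alpha> < N}. cinner (e (i # \<alpha>)) x *\<^sub>C e \<alpha>)"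
  by (rule adj_op_eqI[OF clinear_shift])
    (simp add: shift_apply cinner_sum_left cinner_sum_right cinner_scaleC_left cinner_scaleC_right
      mult.commute flip: cinner_commute)

lemma adj_shift_e: assumes "0 < N" shows "adj_op (shift i) (e [i]) = e []"
proof -
  have "adj_op (shift i) (e [i]) = (\<Sum>\<beta>\<in>{\<beta>. length \<beta> < N}. if \<beta> = [] then e \<beta> else 0)"
    unfolding adj_shift using assms by (intro sum.cong) (auto simp: orthonormal scaleC_one)
  then show ?thesis using assms by simp
qed

text \<open>The words \<open>i # \<alpha>\<close> with letter \<open>i\<close> and tail \<open>\<alpha>\<close> are pairwise distinct, so the claim is Bessel's
  inequality for the basis vectors of positive degree.\<close>

lemma shift_cball: "shift \<in> nc_cball"
  unfolding nc_cball_iff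
proof (intro conjI allI clinear_shift)
  fix x
  let ?W = "{\<alpha> :: 'n list. length \<alpha> < N}"
  have "(\<Sum>i\<in>UNIV. (norm (adj_op (shift i) x))\<^sup>2) = (\<Sum>i\<in>UNIV. \<Sum>\<alpha>\<in>?W. (cmod (cinner (e (i # \<alpha>)) x))\<^sup>2)"
    unfolding adj_shift by (intro sum.cong refl norm_sum_orthonormal finite_words orthonormal) auto
  also have "\<dots> = (\<Sum>\<beta>\<in>(\<lambda>(i, \<alpha>). i # \<alpha>) ` (UNIV \<times> ?W). (cmod (cinner (e \<beta>) x))\<^sup>2)"
    by (subst sum.reindex) (auto simp: sum.cartesian_product inj_on_def intro!: sum.cong)
  also have "\<dots> \<le> (norm x)\<^sup>2"
    by (rule bessel_inequality) (auto simp: orthonormal split: if_splits)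
  finally show "(\<Sum>i\<in>UNIV. (norm (adj_op (shift i) x))\<^sup>2) \<le> (norm x)\<^sup>2" .
qed

definition scaled_shift :: "real \<Rightarrow> ('n, 'h) op_tuple" where
  "scaled_shift r = (\<lambda>i. scaleC_op (of_real r) (shift i))"

lemma scaled_shift_word: "word_op (scaled_shift r) \<alpha> = scaleC_op (of_real r ^ length \<alpha>) (word_op shift \<alpha>)"
  unfolding scaled_shift_def by (rule word_op_scaleC[OF clinear_shift])

lemma nilpotent_scaled_shift: "nilpotent_tuple N (scaled_shift r)"
  using nilpotent_shift by (auto simp: nilpotent_tuple_def scaled_shift_word intro!: blinfun_eqI)

end

lemma adj_scaleC_op:
  "complex_linear_op T \<Longrightarrow> adj_op (scaleC_op c T) x = cnj c *\<^sub>C adj_op T x"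
  by (rule adj_op_eqI) (auto intro: clinear_intros simp: cinner_scaleC_left cinner_scaleC_right cinner_adj_op)

context truncated_fock
begin

lemma scaled_shift_ball:
  assumes r: "0 \<le> r" "r < 1" shows "scaled_shift r \<in> nc_ball"
  unfolding nc_ball_iff
proof (intro conjI allI exI[of _ "r\<^sup>2"])
  show "complex_linear_op (scaled_shift r i)" for i
    unfolding scaled_shift_def by (intro clinear_intros clinear_shift)
  show "r\<^sup>2 < 1" using r by (simp add: power_less_one_iff)
  fix x
  have "(\<Sum>i\<in>UNIV. (norm (adj_op (scaled_shift r i) x))\<^sup>2) = r\<^sup>2 * (\<Sum>i\<in>UNIV. (norm (adj_op (shift i) x))\<^sup>2)"
    by (simp add: scaled_shift_def adj_scaleC_op clinear_shift norm_scaleC power_mult_distrib sum_distrib_left)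
  also have "\<dots> \<le> r\<^sup>2 * (norm x)\<^sup>2"
    using shift_cball unfolding nc_cball_iff by (intro mult_left_mono) auto
  finally show "(\<Sum>i\<in>UNIV. (norm (adj_op (scaled_shift r i) x))\<^sup>2) \<le> r\<^sup>2 * (norm x)\<^sup>2" .
qed simp

lemma word_sum_shift_e:
  "(\<Sum>\<alpha> | length \<alpha> \<le> N. scaleC_op (b \<alpha>) (word_op (scaled_shift r) \<alpha>)) (e [])
    = (\<Sum>\<alpha> | length \<alpha> \<le> N. (b \<alpha> * of_real r ^ length \<alpha>) *\<^sub>C e \<alpha>)"
  unfolding blinfun.sum_left scaled_shift_word
  by (intro sum.cong refl) (simp add: scaleC_scaleC word_shift_e)

lemma word_sum_shift_coeff:
  assumes "length \<alpha> \<le> N"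
  shows "cinner (e \<alpha>) ((\<Sum>\<alpha> | length \<alpha> \<le> N. scaleC_op (b \<alpha>) (word_op (scaled_shift r) \<alpha>)) (e []))
    = b \<alpha> * of_real r ^ length \<alpha>"
proof -
  have "cinner (e \<alpha>) (\<Sum>\<beta>\<in>{\<alpha>. length \<alpha> \<le> N}. (b \<beta> * of_real r ^ length \<beta>) *\<^sub>C e \<beta>)
      = (\<Sum>\<beta>\<in>{\<alpha>. length \<alpha> \<le> N}. if \<beta> = \<alpha> then b \<beta> * of_real r ^ length \<beta> else 0)"
    unfolding cinner_sum_right cinner_scaleC_right using assms by (intro sum.cong) (auto simp: orthonormal)
  then show ?thesis unfolding word_sum_shift_e using assms by simp
qed

end

lemma exists_truncated_fock:
  assumes inf: "\<nexists>S :: 'h::chilbert_space set. finite S \<and> module.span (scaleC :: complex \<Rightarrow> 'h \<Rightarrow> 'h) S = UNIV"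
  shows "\<exists>e :: 'n::finite list \<Rightarrow> 'h. truncated_fock e N"
proof -
  obtain e :: "'n list \<Rightarrow> 'h" where "\<forall>\<alpha>\<in>{\<alpha>. length \<alpha> \<le> N}. \<forall>\<beta>\<in>{\<alpha>. length \<alpha> \<le> N}.
      cinner (e \<alpha>) (e \<beta>) = (if \<alpha> = \<beta> then 1 else 0)"
    using exists_orthonormal_family[OF inf finite_words(1)[of N]] by blast
  then have "truncated_fock e N" by (intro truncated_fock.intro) simp
  then show ?thesis by blast
qed

section \<open>Power series on nilpotent tuples\<close>

definition nil_poly :: "nat \<Rightarrow> (('n::finite, 'h::chilbert_space) op_tuple \<Rightarrow> 'h \<Rightarrow>\<^sub>L 'h) \<Rightarrow> bool" where
  "nil_poly N f \<longleftrightarrow> (\<exists>q. \<forall>X\<in>nc_ball. nilpotent_tuple N X \<longrightarrow> f X = poly_value q X)"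

text \<open>The coefficient family does not depend on the order \<open>N\<close> of nilpotency: \<open>b\<close> is the formal Taylor series
  of \<open>f\<close> at the origin.\<close>

definition nil_series :: "(('n::finite, 'h::chilbert_space) op_tuple \<Rightarrow> 'h \<Rightarrow>\<^sub>L 'h) \<Rightarrow> ('n list \<Rightarrow> complex) \<Rightarrow> bool" where
  "nil_series f b \<longleftrightarrow> (\<forall>N. \<forall>X\<in>nc_ball. nilpotent_tuple N X \<longrightarrow>
     f X = (\<Sum>\<alpha> | length \<alpha> \<le> N. scaleC_op (b \<alpha>) (word_op X \<alpha>)))"

lemma poly_value_nilpotent:
  assumes "nilpotent_tuple N (X :: ('n::finite, 'h::chilbert_space) op_tuple)"
  shows "poly_value q X = (\<Sum>\<alpha> | length \<alpha> \<le> N. scaleC_op (Poly_Mapping.lookup q \<alpha>) (word_op X \<alpha>))"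
proof -
  let ?f = "\<lambda>\<alpha>. scaleC_op (Poly_Mapping.lookup q \<alpha>) (word_op X \<alpha>)"
  let ?W = "{\<alpha> :: 'n list. length \<alpha> \<le> N}"
  have "poly_value q X = sum ?f (Poly_Mapping.keys q \<union> ?W)"
    by (intro poly_value_superset) (auto intro: finite_words)
  also have "\<dots> = sum ?f ?W"
    using assms by (intro sum.mono_neutral_right)
      (auto simp: finite_words nilpotent_tuple_def intro!: blinfun_eqI)
  finally show ?thesis .
qed

lemma nil_poly_add: "nil_poly N f \<Longrightarrow> nil_poly N g \<Longrightarrow> nil_poly N (\<lambda>X. f X + g X)"
  unfolding nil_poly_def by (metis poly_value_add)

lemma nil_poly_comp: 
  fixes f g :: "('n::finite, 'h::chilbert_space) op_tuple \<Rightarrow> 'h \<Rightarrow>\<^sub>L 'h"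
  assumes "nil_poly N f" "nil_poly N g" shows "nil_poly N (\<lambda>X. f X o\<^sub>L g X)"
proof -
  obtain q r where q: "\<And>X. X \<in> nc_ball \<Longrightarrow> nilpotent_tuple N X \<Longrightarrow> f X = poly_value q X"
    and r: "\<And>X. X \<in> nc_ball \<Longrightarrow> nilpotent_tuple N X \<Longrightarrow> g X = poly_value r X"
    using assms unfolding nil_poly_def by blast
  obtain t where "\<And>X :: ('n, 'h) op_tuple. X \<in> nc_cball \<Longrightarrow> poly_value t X = poly_value q X o\<^sub>L poly_value r X"
    using poly_value_mult_exists by blast
  then show ?thesis unfolding nil_poly_def using q r by (intro exI[of _ t]) (simp add: nc_ball_imp_cball)
qed

lemma nil_poly_const: "nil_poly N (\<lambda>X. scaleC_op c id_blinfun)"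
  unfolding nil_poly_def by (intro exI[of _ "Poly_Mapping.single [] c"]) (simp add: poly_value_single)

lemma nil_poly_scaleC: "nil_poly N f \<Longrightarrow> nil_poly N (\<lambda>X. scaleC_op c (f X))"
proof -
  assume "nil_poly N f"
  then have "nil_poly N (\<lambda>X. scaleC_op c id_blinfun o\<^sub>L f X)" by (rule nil_poly_comp[OF nil_poly_const])
  moreover have "scaleC_op c id_blinfun o\<^sub>L f X = scaleC_op c (f X)" for X by (rule blinfun_eqI) simp
  ultimately show ?thesis by simp
qed

lemma nil_poly_sum: "finite I \<Longrightarrow> (\<And>i. i \<in> I \<Longrightarrow> nil_poly N (f i)) \<Longrightarrow> nil_poly N (\<lambda>X. \<Sum>i\<in>I. f i X)"
proof (induction I rule: finite_induct)
  case (insert i I)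
  then have "nil_poly N (\<lambda>X. f i X + (\<Sum>i\<in>I. f i X))" by (intro nil_poly_add) auto
  then show ?case using insert by simp
qed (use nil_poly_const[of N 0] in simp)

lemma nil_poly_word: "(\<And>i. nil_poly N (\<lambda>X. F X i)) \<Longrightarrow> nil_poly N (\<lambda>X. word_op (F X) \<alpha>)"
  using nil_poly_const[of N 1] by (induction \<alpha>) (auto intro: nil_poly_comp)

lemma nil_series_imp_nil_poly: 
  fixes f :: "('n::finite, 'h::chilbert_space) op_tuple \<Rightarrow> 'h \<Rightarrow>\<^sub>L 'h"
  shows "nil_series f b \<Longrightarrow> nil_poly N f"
  unfolding nil_poly_def nil_series_def
  by (intro exI[of _ "\<Sum>\<alpha> | length \<alpha> \<le> N. Poly_Mapping.single \<alpha> (b \<alpha>)"])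
    (simp add: poly_value_sum poly_value_single)

context
  assumes inf: "\<nexists>S :: 'h::chilbert_space set. finite S \<and> module.span (scaleC :: complex \<Rightarrow> 'h \<Rightarrow> 'h) S = UNIV"
begin

text \<open>Applied to the vacuum vector \<open>e []\<close>, the polynomial in the truncated creation operators displays
  its coefficients along an orthonormal family.\<close>

lemma nil_coefficients_unique:
  fixes b c :: "'n::finite list \<Rightarrow> complex"
  assumes eq: "\<And>X :: ('n, 'h) op_tuple. X \<in> nc_ball \<Longrightarrow> nilpotent_tuple N X \<Longrightarrow>
      (\<Sum>\<alpha> | length \<alpha> \<le> N. scaleC_op (b \<alpha>) (word_op X \<alpha>))
      = (\<Sum>\<alpha> | length \<alpha> \<le> N. scaleC_op (c \<alpha>) (word_op X \<alpha>))"
    and \<alpha>: "length \<alpha> \<le> N"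
  shows "b \<alpha> = c \<alpha>"
proof -
  obtain e :: "'n list \<Rightarrow> 'h" where "truncated_fock e N" using exists_truncated_fock[OF inf] by blast
  then interpret truncated_fock e N .
  have "b \<alpha> * of_real (1/2) ^ length \<alpha> = c \<alpha> * of_real (1/2) ^ length \<alpha>"
    unfolding word_sum_shift_coeff[OF \<alpha>, of _ "1/2", symmetric]
    by (subst eq) (auto intro: scaled_shift_ball nilpotent_scaled_shift)
  then show ?thesis by simp
qed

lemma nil_series_unique:
  fixes f :: "('n::finite, 'h) op_tuple \<Rightarrow> 'h \<Rightarrow>\<^sub>L 'h"
  assumes "nil_series f b" "nil_series f c" shows "b = c"
proof
  fix \<alpha>
  show "b \<alpha> = c \<alpha>"
    by (rule nil_coefficients_unique[of "length \<alpha>"]) (use assms in \<open>auto simp: nil_series_def\<close>)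
qed

lemma nil_polys_imp_nil_series:
  fixes f :: "('n::finite, 'h) op_tuple \<Rightarrow> 'h \<Rightarrow>\<^sub>L 'h"
  assumes "\<And>N. nil_poly N f" shows "\<exists>b. nil_series f b"
proof -
  have "\<forall>N. \<exists>q. \<forall>X\<in>nc_ball. nilpotent_tuple N X \<longrightarrow> f X = poly_value q X"
    using assms unfolding nil_poly_def by blast
  then obtain q where q: "\<And>N X. X \<in> nc_ball \<Longrightarrow> nilpotent_tuple N X \<Longrightarrow> f X = poly_value (q N) X"
    by metis
  \<comment> \<open>Each coefficient is taken from the lowest order of nilpotency at which it is visible.\<close>
  define b where "b \<alpha> = Poly_Mapping.lookup (q (length \<alpha>)) \<alpha>" for \<alpha>
  have b: "Poly_Mapping.lookup (q N) \<alpha> = b \<alpha>" if "length \<alpha> \<le> N" for N \<alpha>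
    unfolding b_def
  proof (rule nil_coefficients_unique[of "length \<alpha>" "Poly_Mapping.lookup (q N)" "Poly_Mapping.lookup (q (length \<alpha>))"])
    fix X :: "('n, 'h) op_tuple" assume X: "X \<in> nc_ball" "nilpotent_tuple (length \<alpha>) X"
    then have "nilpotent_tuple N X" using that by (auto simp: nilpotent_tuple_def)
    then show "(\<Sum>\<beta> | length \<beta> \<le> length \<alpha>. scaleC_op (Poly_Mapping.lookup (q N) \<beta>) (word_op X \<beta>)) =
        (\<Sum>\<beta> | length \<beta> \<le> length \<alpha>. scaleC_op (Poly_Mapping.lookup (q (length \<alpha>)) \<beta>) (word_op X \<beta>))"
      using q[OF X] q[OF X(1)] poly_value_nilpotent[OF X(2)] by simp
  qed simp
  have "f X = (\<Sum>\<alpha> | length \<alpha> \<le> N. scaleC_op (b \<alpha>) (word_op X \<alpha>))"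
    if "X \<in> nc_ball" "nilpotent_tuple N X" for N X
    using q[OF that] poly_value_nilpotent[OF that(2), of "q N"] b by simp
  then show ?thesis unfolding nil_series_def by blast
qed

end

lemma words_upto_Suc: "{\<alpha>. length \<alpha> \<le> N} = (\<Union>k\<in>{..<Suc N}. {\<alpha>. length \<alpha> = k})"
  by auto

lemma sum_words_upto:
  fixes f :: "'n::finite list \<Rightarrow> 'b::comm_monoid_add"
  shows "(\<Sum>\<alpha> | length \<alpha> \<le> N. f \<alpha>) = (\<Sum>k<Suc N. \<Sum>\<alpha> | length \<alpha> = k. f \<alpha>)"
  unfolding words_upto_Suc by (rule sum.UNION_disjoint) (auto simp: finite_words)

lemma free_series_nil_series:
  fixes F :: "('n::finite, 'h::chilbert_space) op_tuple \<Rightarrow> 'h \<Rightarrow>\<^sub>L 'h"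
  assumes "\<And>X. X \<in> nc_ball \<Longrightarrow> (\<lambda>k. \<Sum>\<alpha> | length \<alpha> = k. scaleC_op (a \<alpha>) (word_op X \<alpha>)) sums F X"
  shows "nil_series F a"
  unfolding nil_series_def
proof (intro allI ballI impI)
  fix N and X :: "('n, 'h) op_tuple" assume X: "X \<in> nc_ball" "nilpotent_tuple N X"
  have "(\<lambda>k. \<Sum>\<alpha> | length \<alpha> = k. scaleC_op (a \<alpha>) (word_op X \<alpha>)) sums
      (\<Sum>k<Suc N. \<Sum>\<alpha> | length \<alpha> = k. scaleC_op (a \<alpha>) (word_op X \<alpha>))"
    using X(2) by (intro sums_finite) (auto simp: nilpotent_tuple_def intro!: sum.neutral blinfun_eqI)
  from sums_unique2[OF assms[OF X(1)] this]
  show "F X = (\<Sum>\<alpha> | length \<alpha> \<le> N. scaleC_op (a \<alpha>) (word_op X \<alpha>))"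
    by (simp add: sum_words_upto)
qed

lemma bounded_linear_scaleC_op_left: "bounded_linear (\<lambda>c. scaleC_op c T)"
proof (rule bounded_linear_intro[where K = "norm T"])
  show "scaleC_op (r *\<^sub>R c) T = r *\<^sub>R scaleC_op c T" for r c
    by (rule blinfun_eqI) (simp add: blinfun.scaleR_left scaleR_scaleC scaleC_scaleC scaleR_conv_of_real)
qed (auto simp: scaleC_op_add_left norm_scaleC_op)

text \<open>On nilpotent tuples the partial sums of \<open>H (K X)\<close> are polynomials of degree at most \<open>N\<close> in \<open>X\<close>.
  They converge, in particular at a multiple of the truncated creation operators; there the
  coefficients can be read off, so every coefficient converges and the limit is again a polynomial.
  This replaces the substitution of one infinite series into another.\<close>

lemma nil_poly_compose_free_holomorphic:
  fixes H K :: "('n::finite, 'h::chilbert_space) op_tuple \<Rightarrow> ('n, 'h) op_tuple"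
  assumes fock: "truncated_fock (e :: 'n list \<Rightarrow> 'h) N"
    and H: "free_holomorphic H"
    and K: "\<And>i. nil_poly N (\<lambda>X. K X i)" and ball: "\<And>X. X \<in> nc_ball \<Longrightarrow> K X \<in> nc_ball"
  shows "nil_poly N (\<lambda>X. H (K X) j)"
proof -
  interpret truncated_fock e N by (rule fock)
  obtain a where a: "\<And>X j. X \<in> nc_ball \<Longrightarrow>
      (\<lambda>k. \<Sum>\<alpha> | length \<alpha> = k. scaleC_op (a j \<alpha>) (word_op X \<alpha>)) sums H X j"
    using H unfolding free_holomorphic_def by blast
  define P where "P m X = (\<Sum>k<m. \<Sum>\<alpha> | length \<alpha> = k. scaleC_op (a j \<alpha>) (word_op (K X) \<alpha>))"
    for m :: nat and X
  have lim: "(\<lambda>m. P m X) \<longlonglongrightarrow> H (K X) j" if "X \<in> nc_ball" for X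
    using a[OF ball[OF that], of j] by (simp add: sums_def P_def)
  have "nil_poly N (P m)" for m
    unfolding P_def[abs_def] by (intro nil_poly_sum nil_poly_scaleC nil_poly_word K finite_words finite_lessThan)
  then have "\<forall>m. \<exists>q. \<forall>X\<in>nc_ball. nilpotent_tuple N X \<longrightarrow> P m X = poly_value q X"
    unfolding nil_poly_def by blast
  then obtain q where q0: "\<And>m X. X \<in> nc_ball \<Longrightarrow> nilpotent_tuple N X \<Longrightarrow> P m X = poly_value (q m) X"
    by metis
  define b where "b m \<alpha> = Poly_Mapping.lookup (q m) \<alpha>" for m \<alpha>
  have q: "P m X = (\<Sum>\<alpha> | length \<alpha> \<le> N. scaleC_op (b m \<alpha>) (word_op X \<alpha>))"
    if "X \<in> nc_ball" "nilpotent_tuple N X" for m X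
    using q0[OF that] poly_value_nilpotent[OF that(2)] by (simp add: b_def)
  have "\<exists>c. (\<lambda>m. b m \<alpha>) \<longlonglongrightarrow> c" if \<alpha>: "length \<alpha> \<le> N" for \<alpha>
  proof -
    let ?S = "scaled_shift (1/2)"
    have S: "?S \<in> nc_ball" by (rule scaled_shift_ball) auto
    have "(\<lambda>m. cinner (e \<alpha>) (P m ?S (e []))) \<longlonglongrightarrow> cinner (e \<alpha>) (H (K ?S) j (e []))"
      by (intro bounded_linear.tendsto[OF bounded_linear_cinner_right] blinfun.tendsto lim[OF S] tendsto_const)
    then have "(\<lambda>m. b m \<alpha> * (1/2) ^ length \<alpha>) \<longlonglongrightarrow> cinner (e \<alpha>) (H (K ?S) j (e []))"
      unfolding q[OF S nilpotent_scaled_shift] word_sum_shift_coeff[OF \<alpha>] by simp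
    from tendsto_mult[OF this tendsto_const[of "2 ^ length \<alpha>"]]
    show ?thesis by (auto simp: mult.assoc power_one_over)
  qed
  then obtain c where c: "\<And>\<alpha>. length \<alpha> \<le> N \<Longrightarrow> (\<lambda>m. b m \<alpha>) \<longlonglongrightarrow> c \<alpha>" by metis
  have "H (K X) j = poly_value (\<Sum>\<alpha> | length \<alpha> \<le> N. Poly_Mapping.single \<alpha> (c \<alpha>)) X"
    if X: "X \<in> nc_ball" "nilpotent_tuple N X" for X
  proof -
    have "(\<lambda>m. P m X) \<longlonglongrightarrow> (\<Sum>\<alpha> | length \<alpha> \<le> N. scaleC_op (c \<alpha>) (word_op X \<alpha>))"
      unfolding q[OF X] by (intro tendsto_sum bounded_linear.tendsto[OF bounded_linear_scaleC_op_left] c) simp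
    from LIMSEQ_unique[OF lim[OF X(1)] this] show ?thesis
      by (simp add: poly_value_sum poly_value_single)
  qed
  then show ?thesis unfolding nil_poly_def by blast
qed

text \<open>Agreement on nilpotent tuples determines all coefficients of both series, hence both functions.\<close>

lemma free_holomorphic_eqI:
  fixes F G :: "('n::finite, 'h::chilbert_space) op_tuple \<Rightarrow> ('n, 'h) op_tuple"
  assumes inf: "\<nexists>S :: 'h set. finite S \<and> module.span (scaleC :: complex \<Rightarrow> 'h \<Rightarrow> 'h) S = UNIV"
    and F: "free_holomorphic F" and G: "free_holomorphic G"
    and eq: "\<And>N X. X \<in> nc_ball \<Longrightarrow> nilpotent_tuple N X \<Longrightarrow> F X = G X"
    and X: "X \<in> nc_ball"
  shows "F X = G X"
proof
  fix j
  obtain a where a: "\<And>X j. X \<in> nc_ball \<Longrightarrow>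
      (\<lambda>k. \<Sum>\<alpha> | length \<alpha> = k. scaleC_op (a j \<alpha>) (word_op X \<alpha>)) sums F X j"
    using F unfolding free_holomorphic_def by blast
  obtain b where b: "\<And>X j. X \<in> nc_ball \<Longrightarrow>
      (\<lambda>k. \<Sum>\<alpha> | length \<alpha> = k. scaleC_op (b j \<alpha>) (word_op X \<alpha>)) sums G X j"
    using G unfolding free_holomorphic_def by blast
  have "nil_series (\<lambda>X. F X j) (a j)" by (rule free_series_nil_series) (rule a)
  moreover have "nil_series (\<lambda>X. F X j) (b j)"
    using free_series_nil_series[where F = "\<lambda>X. G X j", OF b] eq unfolding nil_series_def by metis
  ultimately have ab: "a j = b j" by (rule nil_series_unique[OF inf])
  show "F X j = G X j" using sums_unique2[OF a[OF X, of j, unfolded ab] b[OF X, of j]] .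
qed

section \<open>The involutions are free holomorphic\<close>

lemma sum_words_Suc:
  fixes f :: "'n::finite list \<Rightarrow> 'b::comm_monoid_add"
  shows "(\<Sum>\<alpha> | length \<alpha> = Suc k. f \<alpha>) = (\<Sum>i\<in>UNIV. \<Sum>\<alpha> | length \<alpha> = k. f (i # \<alpha>))"
proof -
  have "{\<alpha> :: 'n list. length \<alpha> = Suc k} = (\<lambda>(i, \<alpha>). i # \<alpha>) ` (UNIV \<times> {\<alpha>. length \<alpha> = k})"
    by (auto simp: length_Suc_conv image_iff)
  then show ?thesis
    by (simp add: sum.reindex inj_on_def sum.cartesian_product case_prod_unfold)
qed

text \<open>The coefficients of the involution: the Neumann series of \<open>(I - Z)\<^sup>-\<^sup>1\<close> is multiplied on the right
  by the linear form \<open>-s (X\<^sub>j - k l\<^sub>j Z)\<close>, so the last letter of a word takes its coefficient from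
  that form and every earlier letter \<open>i\<close> contributes \<open>cnj (l $ i)\<close>.\<close>

fun involution_coeff :: "complex^'n \<Rightarrow> 'n \<Rightarrow> 'n list \<Rightarrow> complex" where
  "involution_coeff l j [] = l $ j"
| "involution_coeff l j [i] = - of_real (ball_defect l) * ((if i = j then 1 else 0) - of_real (ball_kappa l) * l $ j * cnj (l $ i))"
| "involution_coeff l j (i # i' # \<beta>) = cnj (l $ i) * involution_coeff l j (i' # \<beta>)"

lemma free_holomorphic_ball_involution:
  assumes l: "norm l < 1"
  shows "free_holomorphic (ball_involution l :: ('n::finite, 'h::chilbert_space) op_tuple \<Rightarrow> _)"
  unfolding free_holomorphic_def
proof (intro exI ballI allI)
  fix X :: "('n, 'h) op_tuple" and j assume "X \<in> nc_ball"
  then have X: "X \<in> nc_cball" by (rule nc_ball_imp_cball)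
  define Z where "Z = row_pair l X"
  define s where "s = ball_defect l"
  define W where "W = X j - scaleC_op (of_real (ball_kappa l) * l $ j) Z"
  let ?T = "\<lambda>k. \<Sum>\<alpha> | length \<alpha> = k. scaleC_op (involution_coeff l j \<alpha>) (word_op X \<alpha>)"
  have Z1: "norm Z < 1" unfolding Z_def by (rule norm_row_pair_less_1[OF l X])
  have "(-s) *\<^sub>R (op_power Z k o\<^sub>L W) = ?T (Suc k)" for k
  proof (induction k)
    case 0
    have "?T (Suc 0) = (\<Sum>i\<in>UNIV. scaleC_op (involution_coeff l j [i]) (X i))"
      unfolding sum_words_Suc by (intro sum.cong refl) (auto intro!: blinfun_eqI)
    also have "\<dots> = (-s) *\<^sub>R W"
    proof (rule blinfun_eqI)
      fix x
      have "(\<Sum>i\<in>UNIV. scaleC_op (involution_coeff l j [i]) (X i)) x =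
          (\<Sum>i\<in>UNIV. (- of_real s) *\<^sub>C ((if i = j then X i x else 0) - (of_real (ball_kappa l) * l $ j) *\<^sub>C (cnj (l $ i) *\<^sub>C X i x)))"
        unfolding blinfun.sum_left
        by (intro sum.cong refl) (auto simp: s_def scaleC_scaleC cvs.scale_left_diff_distrib cvs.scale_right_diff_distrib
            scaleC_one right_diff_distrib left_diff_distrib mult_ac)
      also have "\<dots> = (- of_real s) *\<^sub>C (X j x - (of_real (ball_kappa l) * l $ j) *\<^sub>C Z x)"
        by (simp only: cvs.scale_sum_right[symmetric] sum_subtractf) (simp add: Z_def row_pair_apply)
      finally show "(\<Sum>i\<in>UNIV. scaleC_op (involution_coeff l j [i]) (X i)) x = ((-s) *\<^sub>R W) x"
        by (simp add: W_def blinfun.diff_left blinfun.minus_left blinfun.scaleR_left scaleR_scaleC)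
    qed
    finally show ?case by (auto intro!: blinfun_eqI simp: blinfun.minus_left blinfun.scaleR_left)
  next
    case (Suc k)
    have "?T (Suc (Suc k)) = (\<Sum>i\<in>UNIV. scaleC_op (cnj (l $ i)) (X i) o\<^sub>L ?T (Suc k))"
    proof -
      have "(\<Sum>\<alpha> | length \<alpha> = Suc k. scaleC_op (involution_coeff l j (i # \<alpha>)) (word_op X (i # \<alpha>)))
          = scaleC_op (cnj (l $ i)) (X i) o\<^sub>L ?T (Suc k)" for i
      proof (rule blinfun_eqI)
        fix x
        have "involution_coeff l j (i # \<alpha>) = cnj (l $ i) * involution_coeff l j \<alpha>" if "length \<alpha> = Suc k" for \<alpha>
          using that by (cases \<alpha>) auto
        then show "(\<Sum>\<alpha> | length \<alpha> = Suc k. scaleC_op (involution_coeff l j (i # \<alpha>)) (word_op X (i # \<alpha>))) x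
          = (scaleC_op (cnj (l $ i)) (X i) o\<^sub>L ?T (Suc k)) x"
          by (simp add: blinfun.sum_left blinfun.sum_right cvs.scale_sum_right scaleC_scaleC
              clinear_apply[OF nc_cball_cl[OF X]])
      qed
      then show ?thesis by (simp add: sum_words_Suc[of _ "Suc k"])
    qed
    also have "\<dots> = Z o\<^sub>L ?T (Suc k)"
      by (rule blinfun_eqI) (simp add: Z_def row_pair_apply blinfun.sum_left)
    also have "\<dots> = (-s) *\<^sub>R (op_power Z (Suc k) o\<^sub>L W)"
      unfolding Suc[symmetric] by (rule blinfun_eqI) (simp add: blinfun.minus_left blinfun.minus_right blinfun.scaleR_left blinfun.scaleR_right)
    finally show ?case ..
  qed
  moreover have "bounded_linear (\<lambda>T. (-s) *\<^sub>R (T o\<^sub>L W))"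
    by (intro bounded_linear_scaleR_right[THEN bounded_linear_compose]
        bounded_bilinear.bounded_linear_left[OF bounded_bilinear_blinfun_compose])
  ultimately have "(\<lambda>k. ?T (Suc k)) sums ((-s) *\<^sub>R (resolvent Z o\<^sub>L W))"
    using bounded_linear.sums[OF _ resolvent_sums[OF Z1], of "\<lambda>T. (-s) *\<^sub>R (T o\<^sub>L W)"] by simp
  then have "?T sums ((-s) *\<^sub>R (resolvent Z o\<^sub>L W) + ?T 0)" by (rule sums_Suc)
  moreover have "(-s) *\<^sub>R (resolvent Z o\<^sub>L W) + ?T 0 = ball_involution l X j"
    by (rule blinfun_eqI)
      (simp add: ball_involution_apply_unsimplified[OF l X] W_def Z_def s_def blinfun.bilinear_simps)
  ultimately show "?T sums ball_involution l X j" by simp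
qed

lemma free_holomorphic_row_mult:
  assumes "free_holomorphic F"
  shows "free_holomorphic (\<lambda>X. row_mult (F X) U)"
proof -
  obtain a where a: "\<And>X j. X \<in> nc_ball \<Longrightarrow>
      (\<lambda>k. \<Sum>\<alpha> | length \<alpha> = k. scaleC_op (a j \<alpha>) (word_op X \<alpha>)) sums F X j"
    using assms unfolding free_holomorphic_def by blast
  have lin: "bounded_linear (scaleC_op c :: ('b \<Rightarrow>\<^sub>L 'b) \<Rightarrow> _)" for c
    by (rule bounded_linear_intro[where K = "cmod c"])
      (auto intro!: blinfun_eqI order_trans[OF norm_scaleC_op] simp: blinfun.bilinear_simps scaleC_add_right scaleC_scaleR_commute mult.commute)
  show ?thesis
    unfolding free_holomorphic_def
  proof (intro exI ballI allI)
    fix X :: "('a, 'b) op_tuple" and j assume X: "X \<in> nc_ball"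
    have "(\<lambda>k. \<Sum>i\<in>UNIV. scaleC_op (U $ i $ j) (\<Sum>\<alpha> | length \<alpha> = k. scaleC_op (a i \<alpha>) (word_op X \<alpha>)))
        sums row_mult (F X) U j"
      unfolding row_mult_def by (intro sums_sum bounded_linear.sums[OF lin] a X)
    moreover have "(\<Sum>i\<in>UNIV. scaleC_op (U $ i $ j) (\<Sum>\<alpha> | length \<alpha> = k. scaleC_op (a i \<alpha>) (word_op X \<alpha>)))
        = (\<Sum>\<alpha> | length \<alpha> = k. scaleC_op (\<Sum>i\<in>UNIV. U $ i $ j * a i \<alpha>) (word_op X \<alpha>))" for k
    proof (rule blinfun_eqI)
      fix x
      show "(\<Sum>i\<in>UNIV. scaleC_op (U $ i $ j) (\<Sum>\<alpha> | length \<alpha> = k. scaleC_op (a i \<alpha>) (word_op X \<alpha>))) x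
        = (\<Sum>\<alpha> | length \<alpha> = k. scaleC_op (\<Sum>i\<in>UNIV. U $ i $ j * a i \<alpha>) (word_op X \<alpha>)) x"
        by (simp add: blinfun.sum_left cvs.scale_sum_right cvs.scale_sum_left scaleC_scaleC) (rule sum.swap)
    qed
    ultimately show "(\<lambda>k. \<Sum>\<alpha> | length \<alpha> = k. scaleC_op (\<Sum>i\<in>UNIV. U $ i $ j * a i \<alpha>) (word_op X \<alpha>)) sums row_mult (F X) U j"
      by simp
  qed
qed

section \<open>Isometric and contractive matrices\<close>

lemma vector_matrix_mult_scaleR: "(r *\<^sub>R v) v* M = r *\<^sub>R ((v :: complex^'n) v* (M :: complex^'n^'n))"
  by (simp add: vector_matrix_mult_def vec_eq_iff scaleR_sum_right)

text \<open>If \<open>v\<close> violated the bound, the multiple of \<open>v\<close> with image of norm 1 would lie in the open ball.\<close>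

lemma contraction_from_ball:
  fixes M :: "complex^'n^'n"
  assumes "\<And>v. norm v < 1 \<Longrightarrow> norm (v v* M) < 1"
  shows "norm (v v* M) \<le> norm v"
proof (rule ccontr)
  assume "\<not> ?thesis"
  then have n: "norm v < norm (v v* M)" by simp
  then have p: "0 < norm (v v* M)" using norm_ge_zero[of v] by linarith
  have "norm ((1 / norm (v v* M)) *\<^sub>R v) < 1" using n p by (simp add: field_simps)
  from assms[OF this] show False using p by (simp add: vector_matrix_mult_scaleR)
qed

text \<open>Polarisation turns the preservation of norms into the preservation of inner products.\<close>

lemma isometry_imp_unitary:
  fixes M :: "complex^'n^'n"
  assumes iso: "\<And>v. norm (v v* M) = norm v"
  shows "unitary_matrix M"
proof -
  define ip where "ip u v = (\<Sum>j\<in>UNIV. u $ j * cnj (v $ j))" for u v :: "complex^'n"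
  have ip_self: "ip u u = of_real ((norm u)\<^sup>2)" for u
    by (simp add: ip_def norm_vec_complex_sq complex_norm_square del: of_real_power)
  have ip_add: "ip (u + v) w = ip u w + ip v w" "ip w (u + v) = ip w u + ip w v" for u v w
    by (simp_all add: ip_def algebra_simps sum.distrib)
  have ip_scale: "ip (c *s u) w = c * ip u w" "ip w (c *s u) = cnj c * ip w u" for c u w
    by (simp_all add: ip_def sum_distrib_left mult_ac)
  have M_add: "(u + v) v* M = u v* M + v v* M" for u v :: "complex^'n"
    by (simp add: vec_eq_iff vector_matrix_mult_def algebra_simps sum.distrib)
  have M_scale: "(c *s u) v* M = c *s (u v* M)" for c and u :: "complex^'n"
    by (simp add: vec_eq_iff vector_matrix_mult_def sum_distrib_left mult_ac)
  define N where "N u v = ip (u v* M) (v v* M) - ip u v" for u v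
  have N_self: "N u u = 0" for u by (simp add: N_def ip_self iso)
  have N1: "N u v + N v u = 0" for u v
    using N_self[of "u + v"] N_self[of u] N_self[of v] by (simp add: N_def M_add ip_add algebra_simps)
  have N2: "N u v - N v u = 0" for u v
  proof -
    have "\<i> * (N u v - N v u) = 0"
      using N1[of "\<i> *s u" v] by (simp add: N_def M_scale ip_scale algebra_simps)
    then show ?thesis by simp
  qed
  have "N u v = 0" for u v
  proof -
    have "2 * N u v = (N u v + N v u) + (N u v - N v u)" by simp
    then show ?thesis unfolding N1 N2 by simp
  qed
  then have inner: "ip (axis i 1 v* M) (axis k 1 v* M) = ip (axis i 1) (axis k 1)" for i k
    by (simp add: N_def)
  have row: "axis i 1 v* M = M $ i" for i
    by (simp add: vec_eq_iff vector_matrix_mult_def axis_def if_distrib[of "\<lambda>c. c * _"] cong: if_cong)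
  have "M ** conj_transpose M = mat 1"
  proof (simp add: vec_eq_iff, intro allI)
    fix i k
    have "(M ** conj_transpose M) $ i $ k = ip (M $ i) (M $ k)"
      by (simp add: matrix_matrix_mult_def conj_transpose_def ip_def)
    also have "\<dots> = ip (axis i 1) (axis k 1)" using inner by (simp add: row)
    also have "\<dots> = mat 1 $ i $ k"
      by (auto simp: ip_def axis_def mat_def if_distrib[of "\<lambda>c. _ * c"] if_distrib[of cnj] cong: if_cong)
    finally show "(M ** conj_transpose M) $ i $ k = mat 1 $ i $ k" .
  qed
  then show ?thesis unfolding unitary_matrix_def using matrix_left_right_inverse by blast
qed

section \<open>Tuples of multiples of one operator\<close>

text \<open>The scalar row \<open>v\<close> tensored with an operator. For \<open>T = I\<close> these are the scalar points of the ball;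
  for \<open>T\<^sup>2 = 0\<close> a power series reduces at them to its constant and linear terms.\<close>

definition tensor_tuple :: "complex^'n \<Rightarrow> ('h::chilbert_space \<Rightarrow>\<^sub>L 'h) \<Rightarrow> ('n, 'h) op_tuple" where
  "tensor_tuple v T = (\<lambda>i. scaleC_op (v $ i) T)"

lemma adj_tensor_tuple:
  assumes "complex_linear_op T"
  shows "(\<Sum>i\<in>UNIV. (norm (adj_op (tensor_tuple v T i) x))\<^sup>2) = (norm v)\<^sup>2 * (norm (adj_op T x))\<^sup>2"
  by (simp add: tensor_tuple_def adj_scaleC_op assms norm_scaleC power_mult_distrib norm_vec_complex_sq
      sum_distrib_right)

lemma tensor_tuple_ball:
  assumes T: "complex_linear_op T" and le: "\<And>x. norm (adj_op T x) \<le> norm x" and v: "norm v < 1"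
  shows "tensor_tuple v T \<in> nc_ball"
  unfolding nc_ball_iff adj_tensor_tuple[OF T]
proof (intro conjI allI exI[of _ "(norm v)\<^sup>2"])
  show "complex_linear_op (tensor_tuple v T i)" for i unfolding tensor_tuple_def by (intro clinear_intros T)
  show "(norm v)\<^sup>2 < 1" using v by (simp add: power_less_one_iff)
  show "(norm v)\<^sup>2 * (norm (adj_op T x))\<^sup>2 \<le> (norm v)\<^sup>2 * (norm x)\<^sup>2" for x
    using le[of x] by (intro mult_left_mono power_mono) auto
qed simp

lemma tensor_tuple_ball_imp_norm:
  assumes X: "tensor_tuple v T \<in> nc_ball" and T: "complex_linear_op T"
    and x: "norm (adj_op T x) = norm x" "x \<noteq> 0"
  shows "norm v < 1"
proof -
  obtain c where c: "c < 1" "(norm v)\<^sup>2 * (norm (adj_op T x))\<^sup>2 \<le> c * (norm x)\<^sup>2"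
    using X unfolding nc_ball_iff adj_tensor_tuple[OF T] by blast
  then have "(norm v)\<^sup>2 \<le> c" using x by (simp add: mult_le_cancel_right)
  then have "(norm v)\<^sup>2 < 1" using c by simp
  then show ?thesis by (simp add: power_less_one_iff)
qed

lemma adj_id_blinfun: "adj_op id_blinfun x = x"
  by (rule adj_op_eqI) auto

lemma zero_tuple_ball: "(\<lambda>i. 0) \<in> nc_ball"
  using tensor_tuple_ball[of id_blinfun 0] by (simp add: tensor_tuple_def adj_id_blinfun)

lemma nilpotent_zero_tuple: "nilpotent_tuple N (\<lambda>i. 0)"
  unfolding nilpotent_tuple_def
proof (intro allI impI)
  show "N < length \<alpha> \<Longrightarrow> word_op (\<lambda>i. 0) \<alpha> = 0" for \<alpha> by (cases \<alpha>) auto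
qed

section \<open>Cartan uniqueness for nilpotent tuples\<close>

lemma nil_series_at_zero:
  assumes "nil_series f b" shows "f (\<lambda>i. 0) = scaleC_op (b []) id_blinfun"
proof -
  have "f (\<lambda>i. 0) = (\<Sum>\<alpha> | length \<alpha> \<le> 0. scaleC_op (b \<alpha>) (word_op (\<lambda>i. 0) \<alpha>))"
    using assms zero_tuple_ball nilpotent_zero_tuple unfolding nil_series_def by blast
  then show ?thesis by simp
qed

lemma nil_series_order_1:
  assumes "nil_series f b" "X \<in> nc_ball" "nilpotent_tuple 1 X"
  shows "f X = scaleC_op (b []) id_blinfun + (\<Sum>i\<in>UNIV. scaleC_op (b [i]) (X i))"
proof -
  have "f X = (\<Sum>\<alpha> | length \<alpha> \<le> 1. scaleC_op (b \<alpha>) (word_op X \<alpha>))"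
    using assms unfolding nil_series_def by blast
  also have "\<dots> = (\<Sum>\<alpha> | length \<alpha> = 0. scaleC_op (b \<alpha>) (word_op X \<alpha>)) + (\<Sum>\<alpha> | length \<alpha> = Suc 0. scaleC_op (b \<alpha>) (word_op X \<alpha>))"
    unfolding sum_words_upto by simp
  also have "(\<Sum>\<alpha> | length \<alpha> = Suc 0. scaleC_op (b \<alpha>) (word_op X \<alpha>)) = (\<Sum>i\<in>UNIV. scaleC_op (b [i]) (X i))"
    unfolding sum_words_Suc by (intro sum.cong refl) (auto intro!: blinfun_eqI)
  finally show ?thesis by simp
qed

lemma tendsto_power_one_left: "((\<lambda>r::real. r ^ k) \<longlongrightarrow> 1) (at_left 1)"
  by (rule tendsto_eq_intros) (auto intro!: tendsto_eq_intros)

text \<open>A Parseval bound: the value at \<open>r\<close> times the truncated creation operators, applied to the vacuum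
  vector, has squared norm equal to the sum of \<open>(|b \<alpha>| r ^ length \<alpha>)\<^sup>2\<close>. Then let \<open>r\<close> tend to 1.\<close>

lemma nil_series_coefficients_square_sum:
  fixes f :: "('n::finite, 'h::chilbert_space) op_tuple \<Rightarrow> 'h \<Rightarrow>\<^sub>L 'h"
  assumes inf: "\<nexists>S :: 'h set. finite S \<and> module.span (scaleC :: complex \<Rightarrow> 'h \<Rightarrow> 'h) S = UNIV"
    and f: "nil_series f b" and le: "\<And>X. X \<in> nc_ball \<Longrightarrow> norm (f X) \<le> 1"
  shows "(\<Sum>\<alpha> | length \<alpha> \<le> N. (cmod (b \<alpha>))\<^sup>2) \<le> 1"
proof -
  obtain e :: "'n list \<Rightarrow> 'h" where "truncated_fock e N" using exists_truncated_fock[OF inf] by blast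
  then interpret truncated_fock e N .
  have norm_e: "norm (e []) = 1"
  proof -
    have "complex_of_real ((norm (e []))\<^sup>2) = of_real 1"
      using orthonormal[of "[]" "[]"] by (simp add: cinner_self)
    then have "(norm (e []))\<^sup>2 = 1" unfolding of_real_eq_iff .
    then show ?thesis by (simp add: power2_eq_1_iff) (use norm_ge_zero[of "e []"] in linarith)
  qed
  have bound: "(\<Sum>\<alpha> | length \<alpha> \<le> N. (cmod (b \<alpha>))\<^sup>2 * (r ^ length \<alpha>)\<^sup>2) \<le> 1" if r: "0 \<le> r" "r < 1" for r
  proof -
    have S: "scaled_shift r \<in> nc_ball" by (rule scaled_shift_ball[OF r])
    have "f (scaled_shift r) = (\<Sum>\<alpha> | length \<alpha> \<le> N. scaleC_op (b \<alpha>) (word_op (scaled_shift r) \<alpha>))"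
      using f S nilpotent_scaled_shift unfolding nil_series_def by blast
    then have "(norm (f (scaled_shift r) (e [])))\<^sup>2 = (\<Sum>\<alpha> | length \<alpha> \<le> N. (cmod (b \<alpha> * of_real r ^ length \<alpha>))\<^sup>2)"
      unfolding word_sum_shift_e by (simp only: word_sum_shift_e) (rule norm_sum_orthonormal, auto simp: orthonormal)
    moreover have "norm (f (scaled_shift r) (e [])) \<le> 1"
      using norm_blinfun[of "f (scaled_shift r)" "e []"] le[OF S] norm_e by simp
    then have "(norm (f (scaled_shift r) (e [])))\<^sup>2 \<le> 1" by (simp add: power_le_one)
    ultimately show ?thesis
      using r by (simp add: norm_mult norm_power power_mult_distrib)
  qed
  have "((\<lambda>r. \<Sum>\<alpha>\<in>{\<alpha> :: 'n list. length \<alpha> \<le> N}. (cmod (b \<alpha>))\<^sup>2 * (r ^ length \<alpha>)\<^sup>2)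
      \<longlongrightarrow> (\<Sum>\<alpha>\<in>{\<alpha> :: 'n list. length \<alpha> \<le> N}. (cmod (b \<alpha>))\<^sup>2 * 1\<^sup>2)) (at_left (1::real))"
    by (intro tendsto_intros tendsto_power_one_left)
  moreover have "\<forall>\<^sub>F r in at_left (1::real). (\<Sum>\<alpha>\<in>{\<alpha> :: 'n list. length \<alpha> \<le> N}. (cmod (b \<alpha>))\<^sup>2 * (r ^ length \<alpha>)\<^sup>2) \<le> 1"
    using eventually_at_left_real[OF zero_less_one] by (rule eventually_mono) (auto intro: bound)
  ultimately have "(\<Sum>\<alpha>\<in>{\<alpha> :: 'n list. length \<alpha> \<le> N}. (cmod (b \<alpha>))\<^sup>2 * 1\<^sup>2) \<le> 1"
    by (rule tendsto_upperbound) simp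
  then show ?thesis by simp
qed

text \<open>At the tuples \<open>v \<otimes> T\<close> with \<open>T\<^sup>2 = 0\<close> the maps act on the row \<open>v\<close> by their linear parts. Since balls
  go to balls, both linear parts are contractive, and they are inverse to each other; so the linear
  part of \<open>G\<close> is isometric.\<close>

lemma nil_series_linear_part_unitary:
  fixes G G' :: "('n::finite, 'h::chilbert_space) op_tuple \<Rightarrow> ('n, 'h) op_tuple"
  assumes inf: "\<nexists>S :: 'h set. finite S \<and> module.span (scaleC :: complex \<Rightarrow> 'h \<Rightarrow> 'h) S = UNIV"
    and G: "\<And>j. nil_series (\<lambda>X. G X j) (g j)" and G': "\<And>j. nil_series (\<lambda>X. G' X j) (g' j)"
    and ball: "\<And>X. X \<in> nc_ball \<Longrightarrow> G X \<in> nc_ball" "\<And>X. X \<in> nc_ball \<Longrightarrow> G' X \<in> nc_ball"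
    and zero: "G (\<lambda>i. 0) = (\<lambda>i. 0)" "G' (\<lambda>i. 0) = (\<lambda>i. 0)"
    and inverse: "\<And>X. X \<in> nc_ball \<Longrightarrow> G' (G X) = X"
  shows "unitary_matrix (\<chi> i j. g j [i])"
proof -
  obtain e :: "'n list \<Rightarrow> 'h" where "truncated_fock e 1" using exists_truncated_fock[OF inf] by blast
  then interpret truncated_fock e 1 .
  have e0: "e \<alpha> \<noteq> 0" if "length \<alpha> \<le> 1" for \<alpha> using orthonormal[OF that that] by auto
  have const: "b [] = 0" if "nil_series f b" "f (\<lambda>i. 0) = 0"
    for f :: "('n, 'h) op_tuple \<Rightarrow> 'h \<Rightarrow>\<^sub>L 'h" and b
  proof -
    have "scaleC_op (b []) id_blinfun (e []) = 0" using nil_series_at_zero[OF that(1)] that(2) by simp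
    then show ?thesis using e0[of "[]"] by simp
  qed
  have g0: "g j [] = 0" "g' j [] = 0" for j
    using const[OF G] const[OF G'] zero by (simp_all add: fun_eq_iff)
  define T where "T = shift (undefined :: 'n)"
  have T: "complex_linear_op T" unfolding T_def by (rule clinear_shift)
  have Te: "T (e []) = e [undefined]" unfolding T_def by (rule shift_e) simp
  have adjT: "adj_op T (e [undefined]) = e []" unfolding T_def by (rule adj_shift_e) simp
  have norm_e: "norm (e [undefined]) = norm (e [])"
  proof -
    have "complex_of_real ((norm (e [undefined]))\<^sup>2) = complex_of_real ((norm (e []))\<^sup>2)"
      unfolding cinner_self[symmetric] by (simp add: orthonormal)
    then have "(norm (e [undefined]))\<^sup>2 = (norm (e []))\<^sup>2" unfolding of_real_eq_iff .
    then show ?thesis by simp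
  qed
  have adj_le: "norm (adj_op T x) \<le> norm x" for x
  proof -
    have "(norm (adj_op T x))\<^sup>2 \<le> (\<Sum>i\<in>UNIV. (norm (adj_op (shift i) x))\<^sup>2)"
      unfolding T_def by (rule member_le_sum) auto
    also have "\<dots> \<le> (norm x)\<^sup>2" using shift_cball unfolding nc_cball_iff by blast
    finally show ?thesis by (rule power2_le_imp_le) simp
  qed
  have nil: "nilpotent_tuple 1 (tensor_tuple v T)" for v :: "complex^'n"
    unfolding nilpotent_tuple_def
  proof (intro allI impI)
    fix \<alpha> :: "'n list" assume "1 < length \<alpha>"
    then obtain i k \<beta> where \<alpha>: "\<alpha> = i # k # \<beta>" by (cases \<alpha>; cases "tl \<alpha>") auto
    have "word_op shift [undefined, undefined] = 0"
      by (rule nilpotent_shift[unfolded nilpotent_tuple_def, rule_format]) simp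
    then have "T (T x) = 0" for x unfolding T_def by (metis blinfun_apply_blinfun_compose word_op.simps blinfun_apply_id_blinfun zero_blinfun.rep_eq)
    then show "word_op (tensor_tuple v T) \<alpha> = 0"
      by (intro blinfun_eqI) (simp add: \<alpha> tensor_tuple_def clinear_apply[OF T])
  qed
  have tensor: "H (tensor_tuple v T) = tensor_tuple (v v* (\<chi> i j. h j [i])) T"
    if H: "\<And>j. nil_series (\<lambda>X. H X j) (h j)" and h0: "\<And>j. h j [] = 0" and v: "norm v < 1"
    for H :: "('n, 'h) op_tuple \<Rightarrow> ('n, 'h) op_tuple" and h and v :: "complex^'n"
  proof
    fix j
    have "H (tensor_tuple v T) j = scaleC_op (h j []) id_blinfun + (\<Sum>i\<in>UNIV. scaleC_op (h j [i]) (tensor_tuple v T i))"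
      by (rule nil_series_order_1[OF H tensor_tuple_ball[OF T adj_le v] nil])
    then show "H (tensor_tuple v T) j = tensor_tuple (v v* (\<chi> i j. h j [i])) T j"
      by (auto intro!: blinfun_eqI simp: h0 tensor_tuple_def blinfun.sum_left scaleC_scaleC
        vector_matrix_mult_def cvs.scale_sum_left mult.commute)
  qed
  have ball_T: "norm v < 1" if "tensor_tuple v T \<in> nc_ball" for v :: "complex^'n"
    by (rule tensor_tuple_ball_imp_norm[OF that T, of "e [undefined]"]) (use adjT norm_e e0 in auto)
  let ?M = "\<chi> i j. g j [i]" and ?M' = "\<chi> i j. g' j [i]"
  have M1: "norm (v v* ?M) < 1" if "norm v < 1" for v
    using ball(1)[OF tensor_tuple_ball[OF T adj_le that]] unfolding tensor[OF G g0(1) that] by (rule ball_T)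
  have M2: "norm (v v* ?M') < 1" if "norm v < 1" for v
    using ball(2)[OF tensor_tuple_ball[OF T adj_le that]] unfolding tensor[OF G' g0(2) that] by (rule ball_T)
  have inv_small: "(v v* ?M) v* ?M' = v" if v: "norm v < 1" for v
  proof -
    have "tensor_tuple ((v v* ?M) v* ?M') T = tensor_tuple v T"
      using inverse[OF tensor_tuple_ball[OF T adj_le v]]
      unfolding tensor[OF G g0(1) v] tensor[OF G' g0(2) M1[OF v]] .
    then have eq: "((v v* ?M) v* ?M') $ i *\<^sub>C e [undefined] = v $ i *\<^sub>C e [undefined]" for i
      unfolding tensor_tuple_def fun_eq_iff by (metis Te scaleC_op_apply)
    show ?thesis unfolding vec_eq_iff using eq e0[of "[undefined]"] by simp
  qed
  have "norm (v v* ?M) = norm v" for v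
  proof (rule order_antisym)
    show "norm (v v* ?M) \<le> norm v" by (rule contraction_from_ball[OF M1])
    define t where "t = 1 / (norm v + 1)"
    have t: "t > 0" by (simp add: t_def add_nonneg_pos)
    have "norm (t *\<^sub>R v) < 1" using t by (simp add: t_def field_simps add_nonneg_pos)
    from inv_small[OF this] have "t *\<^sub>R ((v v* ?M) v* ?M') = t *\<^sub>R v" by (simp add: vector_matrix_mult_scaleR)
    then have "(v v* ?M) v* ?M' = v" using t by simp
    then show "norm v \<le> norm (v v* ?M)" using contraction_from_ball[OF M2, of "v v* ?M"] by simp
  qed
  then show "unitary_matrix ?M" by (rule isometry_imp_unitary)
qed

text \<open>The noncommutative form of Cartan's theorem. The coefficients of the j-th component have square sum
  at most 1 by the Parseval bound, and the linear ones alone, a column of a unitary matrix, already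
  have square sum 1. All other coefficients vanish.\<close>

lemma origin_fixing_bijection_linear:
  fixes G G' :: "('n::finite, 'h::chilbert_space) op_tuple \<Rightarrow> ('n, 'h) op_tuple"
  assumes inf: "\<nexists>S :: 'h set. finite S \<and> module.span (scaleC :: complex \<Rightarrow> 'h \<Rightarrow> 'h) S = UNIV"
    and G: "\<And>j. nil_series (\<lambda>X. G X j) (g j)" and G': "\<And>j. nil_series (\<lambda>X. G' X j) (g' j)"
    and ball: "\<And>X. X \<in> nc_ball \<Longrightarrow> G X \<in> nc_ball" "\<And>X. X \<in> nc_ball \<Longrightarrow> G' X \<in> nc_ball"
    and zero: "G (\<lambda>i. 0) = (\<lambda>i. 0)" "G' (\<lambda>i. 0) = (\<lambda>i. 0)"
    and inverse: "\<And>X. X \<in> nc_ball \<Longrightarrow> G' (G X) = X"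
  shows "\<exists>M. unitary_matrix M \<and> (\<forall>N. \<forall>X\<in>nc_ball. nilpotent_tuple N X \<longrightarrow> G X = row_mult X M)"
proof -
  define M :: "complex^'n^'n" where "M = (\<chi> i j. g j [i])"
  have M: "unitary_matrix M"
    unfolding M_def by (rule nil_series_linear_part_unitary[OF inf G G' ball zero inverse])
  have g0: "g j \<alpha> = 0" if \<alpha>: "length \<alpha> \<noteq> 1" for j \<alpha>
  proof -
    \<comment> \<open>The successor ensures that the words of length 1 are among those of length at most \<open>N\<close> even for
      \<open>\<alpha> = []\<close>.\<close>
    define N where "N = Suc (length \<alpha>)"
    have "norm (G X j) \<le> 1" if "X \<in> nc_ball" for X
      by (rule nc_cball_norm_le[OF nc_ball_imp_cball[OF ball(1)[OF that]]])
    then have "(\<Sum>\<beta> | length \<beta> \<le> N. (cmod (g j \<beta>))\<^sup>2) \<le> 1"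
      by (rule nil_series_coefficients_square_sum[OF inf G])
    moreover have "(\<Sum>\<beta>\<in>insert \<alpha> (range (\<lambda>i. [i])). (cmod (g j \<beta>))\<^sup>2) \<le> (\<Sum>\<beta> | length \<beta> \<le> N. (cmod (g j \<beta>))\<^sup>2)"
      by (rule sum_mono2) (auto simp: N_def)
    moreover have "(\<Sum>\<beta>\<in>insert \<alpha> (range (\<lambda>i. [i])). (cmod (g j \<beta>))\<^sup>2)
        = (cmod (g j \<alpha>))\<^sup>2 + (\<Sum>i\<in>UNIV. (cmod (g j [i]))\<^sup>2)"
      using \<alpha> by (subst sum.insert) (auto simp: sum.reindex inj_on_def)
    moreover have "(\<Sum>i\<in>UNIV. (cmod (g j [i]))\<^sup>2) = 1"
    proof -
      have "complex_of_real (\<Sum>i\<in>UNIV. (cmod (M $ i $ j))\<^sup>2) = of_real 1"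
        using unitary_col_sum[OF M, of j j]
        by (simp add: complex_norm_square mult.commute del: of_real_power)
      then show ?thesis unfolding of_real_eq_iff by (simp add: M_def)
    qed
    ultimately have "(cmod (g j \<alpha>))\<^sup>2 \<le> 0" by linarith
    then show ?thesis by simp
  qed
  have "G X = row_mult X M" if X: "X \<in> nc_ball" "nilpotent_tuple N X" for N X
  proof
    fix j
    \<comment> \<open>For \<open>N = 0\<close> the words of length 1 would not be among the summands.\<close>
    have "nilpotent_tuple (Suc N) X" using X(2) by (simp add: nilpotent_tuple_def)
    then have "G X j = (\<Sum>\<alpha> | length \<alpha> \<le> Suc N. scaleC_op (g j \<alpha>) (word_op X \<alpha>))"
      using G X(1) unfolding nil_series_def by blast
    also have "\<dots> = (\<Sum>\<alpha> | length \<alpha> = Suc 0. scaleC_op (g j \<alpha>) (word_op X \<alpha>))"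
      by (rule sum.mono_neutral_right) (auto simp: g0)
    also have "\<dots> = row_mult X M j"
      unfolding sum_words_Suc row_mult_def by (intro sum.cong refl) (auto intro!: blinfun_eqI simp: M_def)
    finally show "G X j = row_mult X M j" .
  qed
  with M show ?thesis by blast
qed

section \<open>The form of the free holomorphic automorphisms\<close>

lemma ball_involution_zero:
  fixes l :: "complex^'n::finite"
  assumes l: "norm l < 1"
  shows "ball_involution l (\<lambda>i. 0) = (tensor_tuple l id_blinfun :: ('n, 'h::chilbert_space) op_tuple)"
proof
  fix j
  show "ball_involution l (\<lambda>i. 0) j = (tensor_tuple l id_blinfun :: ('n, 'h) op_tuple) j"
    by (rule blinfun_eqI)
      (simp add: ball_involution_apply_unsimplified[OF l nc_ball_imp_cball[OF zero_tuple_ball]]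
        tensor_tuple_def row_pair_apply)
qed

text \<open>The value at the origin is a scalar row \<open>\<nu>\<close>, because only the constant coefficients of the series
  contribute. After composition with the involution for \<open>\<nu>\<close> the origin is fixed and the map is linear
  and unitary on nilpotent tuples. So on those tuples \<open>\<Phi>\<close> has the asserted form, and two free
  holomorphic functions that agree there are equal.\<close>

lemma free_holomorphic_automorphism_form:
  fixes \<Phi> :: "('n::finite, 'h::chilbert_space) op_tuple \<Rightarrow> ('n, 'h) op_tuple"
  assumes inf: "\<nexists>S :: 'h set. finite S \<and> module.span (scaleC :: complex \<Rightarrow> 'h \<Rightarrow> 'h) S = UNIV"
    and \<Phi>: "free_holomorphic_automorphism \<Phi>"
  shows "\<exists>U l. unitary_matrix U \<and> norm l < 1 \<and> (\<forall>X\<in>nc_ball. \<Phi> X = row_mult (ball_involution l X) U)"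
proof -
  define \<Psi> where "\<Psi> = inv_into nc_ball \<Phi>"
  have bij: "bij_betw \<Phi> nc_ball nc_ball" and hol: "free_holomorphic \<Phi>" "free_holomorphic \<Psi>"
    using \<Phi> by (auto simp: free_holomorphic_automorphism_def \<Psi>_def)
  have ball: "\<Phi> X \<in> nc_ball" "\<Psi> X \<in> nc_ball" "\<Psi> (\<Phi> X) = X" if "X \<in> nc_ball" for X
    using that bij bij_betw_inv_into[OF bij] bij_betw_inv_into_left[OF bij]
    unfolding \<Psi>_def by (auto dest: bij_betwE)
  obtain a where "\<And>X j. X \<in> nc_ball \<Longrightarrow>
      (\<lambda>k. \<Sum>\<alpha> | length \<alpha> = k. scaleC_op (a j \<alpha>) (word_op X \<alpha>)) sums \<Phi> X j"
    using hol(1) unfolding free_holomorphic_def by blast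
  then have a: "nil_series (\<lambda>X. \<Phi> X j) (a j)" for j by (intro free_series_nil_series)
  define \<nu> where "\<nu> = (\<chi> j. a j [])"
  have \<Phi>0: "\<Phi> (\<lambda>i. 0) = tensor_tuple \<nu> id_blinfun"
    using nil_series_at_zero[OF a] by (simp add: fun_eq_iff tensor_tuple_def \<nu>_def)
  obtain e :: "'n list \<Rightarrow> 'h" where fock0: "truncated_fock e 0" using exists_truncated_fock[OF inf] by blast
  have \<nu>: "norm \<nu> < 1"
  proof (rule tensor_tuple_ball_imp_norm)
    show "tensor_tuple \<nu> id_blinfun \<in> (nc_ball :: ('n, 'h) op_tuple set)"
      using ball(1)[OF zero_tuple_ball] unfolding \<Phi>0 .
    show "e [] \<noteq> 0" using truncated_fock.orthonormal[OF fock0, of "[]" "[]"] by auto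
  qed (auto simp: adj_id_blinfun)
  let ?B = "ball_involution \<nu> :: ('n, 'h) op_tuple \<Rightarrow> ('n, 'h) op_tuple"
  note hol_B = free_holomorphic_ball_involution[OF \<nu>, where 'h = 'h]
  note ball_B = ball_involution_ball[OF \<nu>]
  have BB: "?B (?B X) = X" if "X \<in> nc_ball" for X
    by (rule ball_involution_involution[OF \<nu> nc_ball_imp_cball[OF that]])
  have B0: "?B (\<lambda>i. 0) = \<Phi> (\<lambda>i. 0)" unfolding \<Phi>0 by (rule ball_involution_zero[OF \<nu>])
  have series: "\<exists>b. \<forall>j. nil_series (\<lambda>X. H (K X) j) (b j)"
    if H: "free_holomorphic H" and K: "free_holomorphic K" and KB: "\<And>X. X \<in> nc_ball \<Longrightarrow> K X \<in> nc_ball"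
    for H K :: "('n, 'h) op_tuple \<Rightarrow> ('n, 'h) op_tuple"
  proof -
    obtain c where "\<And>X j. X \<in> nc_ball \<Longrightarrow>
        (\<lambda>k. \<Sum>\<alpha> | length \<alpha> = k. scaleC_op (c j \<alpha>) (word_op X \<alpha>)) sums K X j"
      using K unfolding free_holomorphic_def by blast
    then have Kn: "nil_poly N (\<lambda>X. K X i)" for N i
      by (intro nil_series_imp_nil_poly free_series_nil_series)
    have "nil_poly N (\<lambda>X. H (K X) j)" for N j
    proof -
      obtain e :: "'n list \<Rightarrow> 'h" where "truncated_fock e N" using exists_truncated_fock[OF inf] by blast
      then show ?thesis by (rule nil_poly_compose_free_holomorphic[OF _ H Kn KB])
    qed
    then have "\<forall>j. \<exists>b. nil_series (\<lambda>X. H (K X) j) b"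
      using nil_polys_imp_nil_series[OF inf] by blast
    then show ?thesis by metis
  qed
  obtain g where g: "\<And>j. nil_series (\<lambda>X. ?B (\<Phi> X) j) (g j)"
    using series[OF hol_B hol(1) ball(1)] by blast
  obtain g' where g': "\<And>j. nil_series (\<lambda>X. \<Psi> (?B X) j) (g' j)"
    using series[OF hol(2) hol_B ball_B] by blast
  have "\<exists>M. unitary_matrix M \<and> (\<forall>N. \<forall>X\<in>nc_ball. nilpotent_tuple N X \<longrightarrow> ?B (\<Phi> X) = row_mult X M)"
  proof (rule origin_fixing_bijection_linear[OF inf g g'])
    show "?B (\<Phi> (\<lambda>i. 0)) = (\<lambda>i. 0)" unfolding B0[symmetric] by (rule BB[OF zero_tuple_ball])
    show "\<Psi> (?B (\<lambda>i. 0)) = (\<lambda>i. 0)" unfolding B0 by (rule ball(3)[OF zero_tuple_ball])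
  qed (use ball ball_B BB in auto)
  then obtain M where M: "unitary_matrix M"
    and lin: "\<And>N X. X \<in> nc_ball \<Longrightarrow> nilpotent_tuple N X \<Longrightarrow> ?B (\<Phi> X) = row_mult X M" by blast
  define l where "l = \<nu> v* conj_transpose M"
  note zb = nc_ball_imp_cball[OF zero_tuple_ball]
  have l: "norm l < 1"
    using ball_involution_row_mult(1)[OF \<nu> zb M] \<nu> by (simp add: l_def)
  have nil: "\<Phi> X = row_mult (ball_involution l X) M" if X: "X \<in> nc_ball" "nilpotent_tuple N X" for N X
  proof -
    have "\<Phi> X = ?B (row_mult X M)" using BB[OF ball(1)[OF X(1)]] lin[OF X] by simp
    also have "\<dots> = row_mult (ball_involution l X) M"
      unfolding l_def by (rule ball_involution_row_mult(2)[OF \<nu> nc_ball_imp_cball[OF X(1)] M])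
    finally show ?thesis .
  qed
  have "\<Phi> X = row_mult (ball_involution l X) M" if "X \<in> nc_ball" for X
    by (rule free_holomorphic_eqI[OF inf hol(1) free_holomorphic_row_mult[OF free_holomorphic_ball_involution[OF l]] nil that])
  then show ?thesis using M l by blast
qed

text \<open>The form of the automorphisms shows that the choice in the definition of the extension is made from
  a nonempty set.\<close>

lemma closed_ball_extension_form:
  fixes \<Phi> :: "('n::finite, 'h::chilbert_space) op_tuple \<Rightarrow> ('n, 'h) op_tuple"
  assumes inf: "\<nexists>S :: 'h set. finite S \<and> module.span (scaleC :: complex \<Rightarrow> 'h \<Rightarrow> 'h) S = UNIV"
    and \<Phi>: "free_holomorphic_automorphism \<Phi>"
  shows "\<exists>U l. unitary_matrix U \<and> norm l < 1 \<and>
     closed_ball_extension \<Phi> = (\<lambda>X. row_mult (ball_involution l X) U)"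
proof -
  have "\<exists>\<Psi> :: ('n, 'h) op_tuple \<Rightarrow> ('n, 'h) op_tuple. \<exists>U l. unitary_matrix U \<and> norm l < 1 \<and>
     (\<forall>X\<in>nc_ball. \<Phi> X = row_mult (ball_involution l X) U) \<and>
     \<Psi> = (\<lambda>X. row_mult (ball_involution l X) U)"
    using free_holomorphic_automorphism_form[OF inf \<Phi>] by blast
  from someI_ex[OF this] show ?thesis
    unfolding closed_ball_extension_def[symmetric] by blast
qed

theorem theorem9p1:
  fixes \<Delta> :: "('n::finite, 'h::chilbert_space) op_tuple set"
  assumes separable: "separable_space (euclidean :: 'h topology)"
    and infinite_dimensional:
      "\<nexists>S :: 'h set. finite S \<and> module.span (scaleC :: complex \<Rightarrow> 'h \<Rightarrow> 'h) S = UNIV"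
    and part: "\<Delta> \<in> harnack_parts"
  shows "(Metric_space \<Delta> harnack_dist \<and> Metric_space.mbounded \<Delta> harnack_dist \<Delta>) \<and>
    (\<forall>\<Phi> :: ('n, 'h) op_tuple \<Rightarrow> ('n, 'h) op_tuple. free_holomorphic_automorphism \<Phi> \<longrightarrow>
      (\<forall>X\<in>\<Delta>. \<forall>Y\<in>\<Delta>.
        harnack_equiv (closed_ball_extension \<Phi> X) (closed_ball_extension \<Phi> Y) \<and>
        harnack_dist X Y =
          harnack_dist (closed_ball_extension \<Phi> X) (closed_ball_extension \<Phi> Y)))"
proof (intro conjI allI impI ballI)
  show "Metric_space \<Delta> harnack_dist" by (rule harnack_dist_Metric_space[OF part])
  show "Metric_space.mbounded \<Delta> harnack_dist \<Delta>" by (rule harnack_dist_mbounded[OF part])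
  fix \<Phi> :: "('n, 'h) op_tuple \<Rightarrow> ('n, 'h) op_tuple" and X Y
  assume "free_holomorphic_automorphism \<Phi>" and X: "X \<in> \<Delta>" and Y: "Y \<in> \<Delta>"
  then obtain U l where U: "unitary_matrix U" and l: "norm l < 1"
    and ext: "closed_ball_extension \<Phi> = (\<lambda>X. row_mult (ball_involution l X) U)"
    using closed_ball_extension_form[OF infinite_dimensional] by blast
  note XY = harnack_part_equiv[OF part X Y]
  show "harnack_equiv (closed_ball_extension \<Phi> X) (closed_ball_extension \<Phi> Y)"
    unfolding ext by (rule harnack_dist_automorphism(1)[OF l U XY])
  show "harnack_dist X Y = harnack_dist (closed_ball_extension \<Phi> X) (closed_ball_extension \<Phi> Y)"
    unfolding ext by (rule harnack_dist_automorphism(2)[OF l U XY, symmetric])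
qed

end
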